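(* Let $d=3$. For $R>0$ and $a,b\in S^2$ let $$K_R(a,b)=\int_{S^2}\int_{S^2}Q_R(a+\theta+\vartheta)\,Q_R(b-\theta-\vartheta)\,d\sigma(\theta)\,d\sigma(\vartheta),\qquad Q_R(\xi)=\int_{B_R}e^{i\xi\cdot x}\,dx .$$ Then, as $R\to\infty$, $$I(R):=\int_{S^2}\int_{S^2}K_R(a,b)^2\,d\sigma(a)\,d\sigma(b)\ \sim\ 2\pi^6R^4 .$$
   Context: $S^2\subset\mathbb{R}^3$ is the unit sphere, $\sigma$ is the uniform probability measure on $S^2$ (surface measure divided by $4\pi$), and $B_R\subset\mathbb{R}^3$ is the ball of radius $R$ centered at the origin. The function $Q_R$ is real-valued and radial. Equivalently, $K_R(a,b)=\int_{\mathbb{R}^3}\rho(p)Q_R(a+p)Q_R(b-p)\,dp$, where $\rho(p)=\frac{\mathbf 1_{\{|p|<2\}}}{8\pi|p|}$ is the density of $\sigma*\sigma$. The notation $\sim$ means that the ratio tends to $1$. *)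

theory Defs
  imports "HOL-Analysis.Analysis" "HOL-Library.Landau_Symbols"
begin

text \<open>
  Surface measure on the unit sphere \<open>S\<^sup>2\<close>, as the cone measure: the area of \<open>A\<close> is three
  times the volume of the cone \<open>{x. 0 < \<bar>x\<bar> < 1 \<and> x/\<bar>x\<bar> \<in> A}\<close> over \<open>A\<close>; here \<open>sgn x = x/\<bar>x\<bar>\<close>.
  The factor 3 is the one of the polar coordinate formula \<open>dx = r\<^sup>2 dr dS\<close>, since
  \<open>r\<^sup>2\<close> integrates to 1/3 over (0,1). The underlying space is the sphere itself.
\<close>

definition sphere_measure :: "(real^3) measure" where
  "sphere_measure = scale_measure 3
     (distr (restrict_space lborel (ball 0 1 - {0})) (restrict_space borel (sphere 0 1)) sgn)"

definition sigma2 :: "(real^3) measure" where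
  "sigma2 = scale_measure (ennreal (1 / (4 * pi))) sphere_measure"

definition Q_ball :: "real \<Rightarrow> real^3 \<Rightarrow> complex" where
  "Q_ball R \<xi> = (LINT x:ball 0 R|lborel. exp (\<i> * complex_of_real (\<xi> \<bullet> x)))"

definition K_ball :: "real \<Rightarrow> real^3 \<Rightarrow> real^3 \<Rightarrow> complex" where
  "K_ball R a b = (LINT \<theta>|sigma2. (LINT \<phi>|sigma2. Q_ball R (a + \<theta> + \<phi>) * Q_ball R (b - \<theta> - \<phi>)))"

definition I_ball :: "real \<Rightarrow> complex" where
  "I_ball R = (LINT a|sigma2. (LINT b|sigma2. (K_ball R a b)\<^sup>2))"

lemma space_sphere_measure [simp]: "space sphere_measure = sphere 0 1"
  by (simp add: sphere_measure_def space_scale_measure space_restrict_space)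

lemma sets_sphere_measure: "sets sphere_measure = sets (restrict_space borel (sphere 0 1))"
  by (simp add: sphere_measure_def)

lemma space_sigma2 [simp]: "space sigma2 = sphere 0 1"
  by (simp add: sigma2_def space_scale_measure)

lemma sets_sigma2: "sets sigma2 = sets (restrict_space borel (sphere 0 1))"
  by (simp add: sigma2_def sets_sphere_measure)

lemma measurable_sgn_sphere:
  "sgn \<in> measurable (restrict_space lborel (ball 0 1 - {0}))
           (restrict_space borel (sphere 0 1 :: (real^3) set))"
proof (rule measurable_restrict_space2)
  have "(\<lambda>x::real^3. x /\<^sub>R norm x) \<in> borel_measurable borel"
    by measurable
  then have "sgn \<in> borel_measurable (borel :: (real^3) measure)"
    by (simp add: sgn_div_norm [abs_def])
  then show "sgn \<in> borel_measurable (restrict_space lborel (ball 0 1 - {0} :: (real^3) set))"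
    by (simp add: measurable_restrict_space1)
qed (auto simp: space_restrict_space norm_sgn)

lemma emeasure_sphere_measure:
  assumes "A \<in> sets sphere_measure"
  shows "emeasure sphere_measure A = 3 * emeasure lborel {x. 0 < norm x \<and> norm x < 1 \<and> sgn x \<in> A}"
proof -
  have "emeasure sphere_measure A =
    3 * emeasure (restrict_space lborel (ball 0 1 - {0})) (sgn -` A \<inter> (ball 0 1 - {0}))"
    using assms measurable_sgn_sphere
    by (simp add: sphere_measure_def emeasure_distr space_restrict_space)
  also have "\<dots> = 3 * emeasure lborel (sgn -` A \<inter> (ball 0 1 - {0}))"
    by (subst emeasure_restrict_space) auto
  also have "sgn -` A \<inter> (ball 0 1 - {0}) = {x. 0 < norm x \<and> norm x < 1 \<and> sgn x \<in> A}"
    by auto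
  finally show ?thesis .
qed

lemma emeasure_sphere_measure_space: "emeasure sphere_measure (sphere 0 1) = ennreal (4 * pi)"
proof -
  have "sphere 0 1 \<in> sets sphere_measure"
    by (metis sets.top space_sphere_measure)
  then have "emeasure sphere_measure (sphere 0 1) =
      3 * emeasure lborel {x::real^3. 0 < norm x \<and> norm x < 1 \<and> sgn x \<in> sphere 0 1}"
    by (rule emeasure_sphere_measure)
  also have "{x::real^3. 0 < norm x \<and> norm x < 1 \<and> sgn x \<in> sphere 0 1} = ball 0 1 - {0}"
    by (auto simp: norm_sgn)
  also have "emeasure lborel (ball 0 1 - {0::real^3}) = emeasure lborel (ball (0::real^3) 1)"
    by (rule emeasure_Diff_null_set) auto
  also have "\<dots> = ennreal (4 / 3 * pi)"
    by (simp add: emeasure_ball unit_ball_vol_3)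
  also have "3 * \<dots> = ennreal (4 * pi)"
    by (subst ennreal_numeral [symmetric], subst ennreal_mult [symmetric]) auto
  finally show ?thesis .
qed

lemma emeasure_sigma2_space: "emeasure sigma2 (sphere 0 1) = 1"
  by (simp add: sigma2_def emeasure_sphere_measure_space ennreal_mult [symmetric])

lemma emeasure_sphere_measure_orthogonal:
  fixes f :: "real^3 \<Rightarrow> real^3"
  assumes f: "orthogonal_transformation f" and A: "A \<in> sets sphere_measure"
  shows "emeasure sphere_measure (f ` A) = emeasure sphere_measure A"
proof -
  define C where "C B = {x::real^3. 0 < norm x \<and> norm x < 1 \<and> sgn x \<in> B}" for B
  obtain g where g: "orthogonal_transformation g" "\<And>x. g (f x) = x" "\<And>x. f (g x) = x"
    using f orthogonal_transformation_inv orthogonal_transformation_bij bij_inv_eq_iff by metis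
  have lin: "linear f" "linear g" and nm: "norm (f x) = norm x" "norm (g x) = norm x" for x
    using f g by (auto simp: orthogonal_transformation orthogonal_transformation_linear)
  have gb: "g \<in> borel_measurable borel"
    using lin(2) by (intro borel_measurable_continuous_onI linear_continuous_on)
      (simp add: linear_conv_bounded_linear)
  have Ab: "A \<in> sets borel" "A \<subseteq> sphere 0 1"
    using A by (auto simp: sets_sphere_measure sets_restrict_space)
  have im: "f ` B = g -` B" for B
    using g by (auto simp: image_iff) metis
  have "f ` A \<in> sets borel"
    using measurable_sets[OF gb Ab(1)] by (simp add: im)
  moreover have "f ` A \<subseteq> sphere 0 1"
    using Ab nm by auto
  ultimately have fA: "f ` A \<in> sets sphere_measure"
    by (auto simp: sets_sphere_measure sets_restrict_space)
  have sg: "sgn (g x) = g (sgn x)" for x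
    using lin(2) nm by (simp add: sgn_div_norm linear_scale)
  have CfA: "C (f ` A) = f ` C A"
    unfolding im C_def vimage_def mem_Collect_eq nm sg ..
  have Cb: "C B \<in> sets borel" if "B \<in> sets borel" for B
  proof -
    have sb: "sgn \<in> borel_measurable (borel :: (real^3) measure)"
      unfolding sgn_div_norm [abs_def] by measurable
    have "C B = (ball 0 1 - {0}) \<inter> sgn -` B"
      by (auto simp: C_def)
    then show ?thesis
      using measurable_sets[OF sb that] by auto
  qed
  have "bounded (C A)"
    by (rule bounded_subset[of "ball 0 1"]) (auto simp: C_def)
  then have CA: "C A \<in> lmeasurable"
    using Cb[OF Ab(1)] by (auto intro!: bounded_set_imp_lmeasurable)
  have "emeasure lborel (C (f ` A)) = emeasure lebesgue (f ` C A)"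
    using Cb[OF \<open>f ` A \<in> sets borel\<close>] by (simp add: CfA)
  also have "\<dots> = emeasure lebesgue (C A)"
    using measurable_orthogonal_image[OF f CA] measure_orthogonal_image[OF f CA] CA
    by (simp add: emeasure_eq_measure2 fmeasurableD2 emeasure_eq_ennreal_measure)
  also have "\<dots> = emeasure lborel (C A)"
    using Cb[OF Ab(1)] by simp
  finally show ?thesis
    using emeasure_sphere_measure[OF A] emeasure_sphere_measure[OF fA] by (simp add: C_def)
qed

end

theory Submission
  imports Defs "HOL-Probability.Probability" "HOL-Real_Asymp.Real_Asymp"
begin

text \<open>
  The density \<open>rho\<close> of \<open>\<sigma> * \<sigma>\<close> turns the kernel into an integral of \<open>rho (q - a) Q(q) Q(a + b - q)\<close>
  over \<open>q\<close>, where \<open>Q = Q_R\<close>. Freezing \<open>rho\<close> at its value \<open>1 / (8 \<pi>)\<close> at \<open>q = 0\<close> leaves the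
  self-convolution \<open>Q * Q = (2 \<pi>)\<^sup>3 Q\<close>, so that \<open>K_R(a, b) = \<pi>\<^sup>2 Q_R(a + b) + E_R(a, b)\<close>. Since
  \<open>|Q_R(q)| \<le> 8 \<pi> R / |q|\<^sup>2\<close>, the error \<open>E_R / R\<^sup>2\<close> is an integral of a fixed integrable function
  against the oscillating factors \<open>cos (R |q|) cos (R |a + b - q|)\<close> up to terms that vanish in the
  limit. Hence it tends to 0 pointwise by a Riemann--Lebesgue argument along the rays from
  the origin, and in the mean square because it is dominated by a multiple of
  \<open>|a + b|\<close> to the power \<open>-1/2\<close>. The main term is the elementary integral
  \<open>8 \<pi>\<^sup>6 R\<^sup>4 \<integral> (sin s - s cos s)\<^sup>2 / s\<^sup>5 ds\<close> over \<open>[0, 2 R]\<close>, and the integral over \<open>[0, \<infinity>)\<close> is \<open>1 / 4\<close>.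
\<close>

subsection \<open>Polar coordinates\<close>

text \<open>The order \<open>R ^ 4\<close> comes from nearly antipodal pairs. The law of
  \<open>norm (a + b)\<close> has density \<open>r / 2\<close> on \<open>[0, 2]\<close>, so the
  pairs with \<open>norm (a + b)\<close> of order \<open>1 / R\<close> have measure of order
  \<open>1 / R\<^sup>2\<close>, and there \<open>Q_R (a + b)\<close> is of the size of the volume,
  \<open>R ^ 3\<close>. For a fixed pair with \<open>a + b \<noteq> 0\<close> the main term is only
  O(R), while the error is merely shown to be o(R^2). The two are therefore never compared
  pointwise, only in mean square after division by \<open>R\<^sup>2\<close>. The obstacle is
  domination near the antipodal pairs, where the inverse squares centred at 0 and at
  \<open>a + b\<close> merge; there it matters that \<open>rho (q - a) - 1 / (8 * pi)\<close> is of
  the size of \<open>norm q\<close>. All Fourier analysis concerns radial objects and rests on one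
  fact about the sphere: the height of a uniform point is uniform on \<open>[-1, 1]\<close>. Neither
  inversion nor uniqueness of transforms is invoked; explicit kernels and Fubini on finite measures
  take their place.\<close>

lemma emeasure_lborel_vimage_scaleR:
  fixes A :: "'a::euclidean_space set"
  assumes "c > 0" and A [measurable]: "A \<in> sets borel"
  shows "emeasure lborel A = ennreal (c ^ DIM('a)) * emeasure lborel ((\<lambda>x. c *\<^sub>R x) -` A)"
proof -
  have "emeasure lborel A =
      emeasure (density (distr lborel borel (\<lambda>x. 0 + c *\<^sub>R x)) (\<lambda>_. ennreal (\<bar>c\<bar> ^ DIM('a)))) A"
    using assms by (subst lborel_affine[of c 0]) auto
  also have "\<dots> = ennreal (c ^ DIM('a)) * emeasure (distr lborel borel (\<lambda>x. c *\<^sub>R x)) A"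
    using assms by (simp add: emeasure_density_const)
  also have "emeasure (distr lborel borel (\<lambda>x::'a. c *\<^sub>R x)) A = emeasure lborel ((\<lambda>x. c *\<^sub>R x) -` A)"
    by (subst emeasure_distr) auto
  finally show ?thesis .
qed

lemma borel_measurable_sgn_euclidean [measurable]:
  "sgn \<in> borel_measurable (borel :: 'a::euclidean_space measure)"
  unfolding sgn_div_norm [abs_def] by measurable

interpretation sigma2: prob_space sigma2
  by standard (simp add: emeasure_sigma2_space)

lemma sets_sigma2_iff: "B \<in> sets sigma2 \<longleftrightarrow> B \<in> sets borel \<and> B \<subseteq> sphere 0 1"
  by (auto simp: sets_sigma2 sets_restrict_space)

lemma sets_sigma2_borel: "B \<in> sets sigma2 \<Longrightarrow> B \<in> sets borel"
  by (simp add: sets_sigma2_iff)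

lemma emeasure_sigma2:
  assumes "B \<in> sets sigma2"
  shows "ennreal (4 * pi / 3) * emeasure sigma2 B =
    emeasure lborel {x. 0 < norm x \<and> norm x < 1 \<and> sgn x \<in> B}"
proof -
  have B: "B \<in> sets sphere_measure"
    using assms by (simp add: sets_sigma2 sets_sphere_measure)
  have "ennreal (4 * pi / 3) * emeasure sigma2 B
      = ennreal (4 * pi / 3) * (ennreal (1 / (4 * pi)) * (ennreal 3 *
          emeasure lborel {x. 0 < norm x \<and> norm x < 1 \<and> sgn x \<in> B}))"
    using emeasure_sphere_measure[OF B] by (simp add: sigma2_def)
  also have "\<dots> = ennreal (4 * pi / 3 * (1 / (4 * pi) * 3)) *
          emeasure lborel {x. 0 < norm x \<and> norm x < 1 \<and> sgn x \<in> B}"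
    by (simp only: ennreal_mult'' mult.assoc pi_ge_zero zero_le_divide_1_iff zero_le_mult_iff zero_le_numeral simp_thms)
  finally show ?thesis by simp
qed

lemma emeasure_cone:
  assumes B: "B \<in> sets sigma2" and t: "t > 0"
  shows "emeasure lborel {x. 0 < norm x \<and> norm x < t \<and> sgn x \<in> B} =
    ennreal (4 * pi * t ^ 3 / 3) * emeasure sigma2 B"
proof -
  have [measurable]: "B \<in> sets borel"
    using B by (rule sets_sigma2_borel)
  have "emeasure lborel {x. 0 < norm x \<and> norm x < t \<and> sgn x \<in> B} =
    ennreal (t ^ DIM(real^3)) *
      emeasure lborel ((\<lambda>x. t *\<^sub>R x) -` {x. 0 < norm x \<and> norm x < t \<and> sgn x \<in> B})"
    using t by (intro emeasure_lborel_vimage_scaleR) measurable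
  also have "(\<lambda>x. t *\<^sub>R x) -` {x. 0 < norm x \<and> norm x < t \<and> sgn x \<in> B} =
      {x. 0 < norm x \<and> norm x < 1 \<and> sgn x \<in> B}"
    using t by (auto simp: sgn_scaleR)
  also have "emeasure lborel \<dots> = ennreal (4 * pi / 3) * emeasure sigma2 B"
    using emeasure_sigma2[OF B] by simp
  also have "ennreal (t ^ DIM(real^3)) * (ennreal (4 * pi / 3) * emeasure sigma2 B) =
      ennreal (t ^ 3 * (4 * pi / 3)) * emeasure sigma2 B"
    using t by (subst ennreal_mult) (auto simp: mult.assoc)
  finally show ?thesis by (simp add: field_simps)
qed

text \<open>The law of \<open>norm x\<close> under Lebesgue measure on the punctured space. The
  whole area \<open>4 * pi * r\<^sup>2\<close> of the sphere of radius \<open>r\<close> sits here,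
  since \<open>sigma2\<close> is normalised to mass 1.\<close>

definition radial_measure :: "real measure" where
  "radial_measure = density lborel (\<lambda>r. ennreal (indicator {0<..} r * (4 * pi * r\<^sup>2)))"

lemma sets_radial_measure [measurable_cong, simp]: "sets radial_measure = sets borel"
  and space_radial_measure [simp]: "space radial_measure = UNIV"
  by (simp_all add: radial_measure_def)

lemma emeasure_radial_lessThan:
  assumes "t > 0"
  shows "emeasure radial_measure {..<t} = ennreal (4 * pi * t ^ 3 / 3)"
proof -
  have "emeasure radial_measure {..<t} =
      (\<integral>\<^sup>+r. ennreal (indicator {0<..} r * (4 * pi * r\<^sup>2)) * indicator {..<t} r \<partial>lborel)"
    by (simp add: radial_measure_def emeasure_density)
  also have "\<dots> = (\<integral>\<^sup>+r. ennreal (4 * pi * r\<^sup>2) * indicator {0..t} r \<partial>lborel)"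
    by (intro nn_integral_cong_AE) (use AE_lborel_singleton[of 0] AE_lborel_singleton[of t] in
      \<open>eventually_elim, auto simp: indicator_def\<close>)
  also have "\<dots> = ennreal (4 * pi * t ^ 3 / 3 - 4 * pi * 0 ^ 3 / 3)"
    using assms by (intro nn_integral_FTC_Icc)
     (auto intro!: derivative_eq_intros simp: power2_eq_square field_simps)
  finally show ?thesis by simp
qed

interpretation radial: sigma_finite_measure radial_measure
  unfolding radial_measure_def
  by (subst sigma_finite_measure.sigma_finite_iff_density_finite[OF sigma_finite_lborel]) auto

text \<open>The origin is removed because \<open>sgn 0 = 0\<close> is not on the sphere, which is
  the space of \<open>sigma2\<close>.\<close>

lemma norm_sgn_measurable:
  "(\<lambda>x::real^3. (norm x, sgn x)) \<in> restrict_space lborel (-{0}) \<rightarrow>\<^sub>M borel \<Otimes>\<^sub>M sigma2"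
proof -
  have "sgn \<in> restrict_space lborel (-{0}) \<rightarrow>\<^sub>M restrict_space borel (sphere 0 1 :: (real^3) set)"
    by (rule measurable_restrict_space2) (auto simp: space_restrict_space norm_sgn intro: measurable_restrict_space1)
  then have "sgn \<in> restrict_space lborel (-{0}) \<rightarrow>\<^sub>M sigma2"
    using measurable_cong_sets[OF refl sets_sigma2] by blast
  then show ?thesis
    by (intro measurable_Pair) (auto intro: measurable_restrict_space1)
qed

text \<open>Rectangles \<open>A \<times> B\<close> determine the product measure. For fixed
  \<open>B\<close> both sides are measures in \<open>A\<close>, so it suffices to compare them on
  the half-lines \<open>{..<t}\<close>, and there the claim is the cubic growth of the volume of a
  cone.\<close>

lemma distr_norm_sgn:
  "distr (restrict_space lborel (-{0})) (borel \<Otimes>\<^sub>M sigma2) (\<lambda>x. (norm x, sgn x)) =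
    radial_measure \<Otimes>\<^sub>M sigma2"
proof (rule sym, rule pair_measure_eqI)
  show "sigma_finite_measure radial_measure" "sigma_finite_measure sigma2"
    by unfold_locales
  note m = norm_sgn_measurable
  show "sets (radial_measure \<Otimes>\<^sub>M sigma2) =
    sets (distr (restrict_space lborel (-{0})) (borel \<Otimes>\<^sub>M sigma2) (\<lambda>x. (norm x, sgn x)))"
    by (simp cong: sets_pair_measure_cong)
  fix A :: "real set" and B assume A: "A \<in> sets radial_measure" and B: "B \<in> sets sigma2"
  have [measurable]: "A \<in> sets borel" "B \<in> sets borel"
    using A sets_sigma2_borel[OF B] by auto
  define M1 where "M1 = distr (density lborel (indicator {x::real^3. x \<noteq> 0 \<and> sgn x \<in> B})) borel norm"
  define M2 where "M2 = scale_measure (emeasure sigma2 B) radial_measure"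
  have M1: "emeasure M1 A = emeasure lborel {x. x \<noteq> 0 \<and> norm x \<in> A \<and> sgn x \<in> B}"
    if [measurable]: "A \<in> sets borel" for A
  proof -
    have [measurable]: "(norm :: real^3 \<Rightarrow> real) -` A \<in> sets borel"
      using measurable_sets[of norm borel borel A] that by simp
    have "emeasure M1 A = (\<integral>\<^sup>+x. indicator {x. x \<noteq> 0 \<and> sgn x \<in> B} x * indicator (norm -` A) x \<partial>lborel)"
      unfolding M1_def by (subst emeasure_distr, simp, simp, subst emeasure_density) auto
    also have "\<dots> = (\<integral>\<^sup>+x. indicator {x. x \<noteq> 0 \<and> norm x \<in> A \<and> sgn x \<in> B} x \<partial>lborel)"
      by (intro nn_integral_cong) (auto simp: indicator_def)
    finally show ?thesis by simp
  qed
  have "M1 = M2"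
  proof (rule measure_eqI_generator_eq[where E="range lessThan" and \<Omega>=UNIV and A="\<lambda>n. {..<real n}"])
    show "Int_stable (range lessThan :: real set set)"
    proof (rule Int_stableI)
      fix a b :: "real set" assume "a \<in> range lessThan" "b \<in> range lessThan"
      then obtain s t where "a = {..<s}" "b = {..<t}" by auto
      then have "a \<inter> b = {..<min s t}" by auto
      then show "a \<inter> b \<in> range lessThan" by blast
    qed
    show "sets M1 = sigma_sets UNIV (range lessThan)" "sets M2 = sigma_sets UNIV (range lessThan)"
      by (simp_all add: M1_def M2_def borel_Iio)
    have "emeasure M1 {..<t} = emeasure M2 {..<t}" for t
    proof (cases "t > 0")
      case True
      have "{x::real^3. x \<noteq> 0 \<and> norm x \<in> {..<t} \<and> sgn x \<in> B} = {x. 0 < norm x \<and> norm x < t \<and> sgn x \<in> B}"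
        by auto
      then show ?thesis
        using True emeasure_cone[OF B True] by (simp add: M1 M2_def emeasure_radial_lessThan mult.commute)
    next
      case False
      then have "{x::real^3. x \<noteq> 0 \<and> norm x \<in> {..<t} \<and> sgn x \<in> B} = {}"
        by (auto simp: not_less) (smt (verit) norm_ge_zero)
      then have "emeasure M1 {..<t} = 0"
        using M1[of "{..<t}"] by (simp only: emeasure_empty lessThan_borel)
      moreover have "emeasure radial_measure {..<t} = 0"
        using False by (auto simp: radial_measure_def emeasure_density indicator_def
            intro!: nn_integral_0_iff_AE[THEN iffD2])
      ultimately show ?thesis by (simp add: M2_def)
    qed
    then show "\<And>X. X \<in> range lessThan \<Longrightarrow> emeasure M1 X = emeasure M2 X" by auto
    show "emeasure M1 {..<real n} \<noteq> \<infinity>" for n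
    proof -
      have "emeasure M1 {..<real n} \<le> emeasure lborel (ball (0::real^3) n)"
        by (subst M1) (auto intro!: emeasure_mono)
      then show ?thesis using emeasure_lborel_ball_finite[of "0::real^3" n] by (auto simp: top_unique)
    qed
    show "(\<Union>n. {..<real n}) = UNIV"
      using reals_Archimedean2 by auto
  qed auto
  then have "emeasure M1 A = emeasure M2 A" by simp
  moreover have "emeasure (distr (restrict_space lborel (-{0})) (borel \<Otimes>\<^sub>M sigma2) (\<lambda>x. (norm x, sgn x))) (A \<times> B)
    = emeasure lborel {x. x \<noteq> 0 \<and> norm x \<in> A \<and> sgn x \<in> B}"
  proof -
    have "emeasure (distr (restrict_space lborel (-{0})) (borel \<Otimes>\<^sub>M sigma2) (\<lambda>x. (norm x, sgn x))) (A \<times> B)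
      = emeasure (restrict_space lborel (-{0})) {x. x \<noteq> 0 \<and> norm x \<in> A \<and> sgn x \<in> B}"
      using B by (subst emeasure_distr[OF m])
       (auto simp: space_restrict_space intro!: arg_cong[where f="emeasure _"])
    then show ?thesis by (subst (asm) emeasure_restrict_space) auto
  qed
  ultimately show "emeasure radial_measure A * emeasure sigma2 B = 
    emeasure (distr (restrict_space lborel (-{0})) (borel \<Otimes>\<^sub>M sigma2) (\<lambda>x. (norm x, sgn x))) (A \<times> B)"
    using A by (simp add: M1 M2_def mult.commute)
qed

lemma id_measurable_sigma2: "(\<lambda>x. x) \<in> borel_measurable sigma2"
  by (subst measurable_cong_sets[OF sets_sigma2 refl]) (auto intro: measurable_restrict_space1)

lemma measurable_sigma2I: "f \<in> borel_measurable borel \<Longrightarrow> f \<in> borel_measurable sigma2"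
  using measurable_compose[OF id_measurable_sigma2] by blast

lemma polar_measurable [measurable]:
  "(\<lambda>(r, w). r *\<^sub>R w) \<in> borel_measurable (radial_measure \<Otimes>\<^sub>M sigma2)"
proof -
  have [measurable]: "(\<lambda>z. snd z) \<in> borel_measurable (radial_measure \<Otimes>\<^sub>M sigma2)"
    by (rule measurable_compose[OF measurable_snd id_measurable_sigma2])
  show ?thesis unfolding case_prod_unfold by measurable
qed

text \<open>Off the origin, which is a null set, \<open>r *\<^sub>R w\<close> inverts the map to
  norm and direction.\<close>

lemma lborel_polar: "lborel = distr (radial_measure \<Otimes>\<^sub>M sigma2) borel (\<lambda>(r, w). r *\<^sub>R w)"
proof -
  have "distr (radial_measure \<Otimes>\<^sub>M sigma2) borel (\<lambda>(r, w). r *\<^sub>R w)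
    = distr (restrict_space lborel (-{0})) borel ((\<lambda>(r, w). r *\<^sub>R w) \<circ> (\<lambda>x::real^3. (norm x, sgn x)))"
    unfolding distr_norm_sgn[symmetric] using norm_sgn_measurable
    by (intro distr_distr) simp_all
  also have "(\<lambda>(r, w). r *\<^sub>R w) \<circ> (\<lambda>x::real^3. (norm x, sgn x)) = (\<lambda>x. x)"
    by (rule ext) (case_tac "x = 0"; simp add: sgn_div_norm)
  also have "distr (restrict_space lborel (-{0})) borel (\<lambda>x::real^3. x) = lborel"
  proof (rule measure_eqI)
    fix A assume A: "A \<in> sets (distr (restrict_space lborel (-{0})) borel (\<lambda>x::real^3. x))"
    then have [measurable]: "A \<in> sets borel" by simp
    have "emeasure (distr (restrict_space lborel (-{0})) borel (\<lambda>x::real^3. x)) A = emeasure lborel (A - {0})"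
      by (subst emeasure_distr) (auto simp: space_restrict_space emeasure_restrict_space
          intro!: measurable_restrict_space1 arg_cong[where f="emeasure _"])
    also have "\<dots> = emeasure lborel A"
      by (rule emeasure_Diff_null_set) auto
    finally show "emeasure (distr (restrict_space lborel (-{0})) borel (\<lambda>x::real^3. x)) A = emeasure lborel A" .
  qed simp
  finally show ?thesis by simp
qed

lemma nn_integral_polar:
  assumes [measurable]: "f \<in> borel_measurable borel"
  shows "(\<integral>\<^sup>+x. f x \<partial>lborel) = (\<integral>\<^sup>+r. (\<integral>\<^sup>+w. f (r *\<^sub>R w) \<partial>sigma2) \<partial>radial_measure)"
  by (subst lborel_polar, subst nn_integral_distr)
     (auto simp: sigma2.nn_integral_fst[symmetric])

lemma nn_integral_radial_measure:
  assumes [measurable]: "f \<in> borel_measurable borel"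
  shows "(\<integral>\<^sup>+r. f r \<partial>radial_measure) = (\<integral>\<^sup>+r. ennreal (4 * pi * r\<^sup>2) * f r * indicator {0<..} r \<partial>lborel)"
  unfolding radial_measure_def
  by (subst nn_integral_density) (auto intro!: nn_integral_cong simp: indicator_def)

lemma nn_integral_norm:
  assumes [measurable]: "f \<in> borel_measurable borel"
  shows "(\<integral>\<^sup>+x. f (norm (x :: real^3)) \<partial>lborel) = (\<integral>\<^sup>+r. ennreal (4 * pi * r\<^sup>2) * f r * indicator {0<..} r \<partial>lborel)"
proof -
  have "(\<integral>\<^sup>+x. f (norm (x :: real^3)) \<partial>lborel) = (\<integral>\<^sup>+r. (\<integral>\<^sup>+w. f \<bar>r\<bar> \<partial>sigma2) \<partial>radial_measure)"
  proof -
    have "(\<integral>\<^sup>+w. f (norm (r *\<^sub>R w)) \<partial>sigma2) = (\<integral>\<^sup>+w. f \<bar>r\<bar> \<partial>sigma2)" for r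
      by (intro nn_integral_cong) simp
    then show ?thesis by (subst nn_integral_polar) simp_all
  qed
  also have "\<dots> = (\<integral>\<^sup>+r. f \<bar>r\<bar> \<partial>radial_measure)"
    using emeasure_sigma2_space by simp
  also have "\<dots> = (\<integral>\<^sup>+r. ennreal (4 * pi * r\<^sup>2) * f r * indicator {0<..} r \<partial>lborel)"
    by (subst nn_integral_radial_measure) (auto intro!: nn_integral_cong simp: indicator_def)
  finally show ?thesis .
qed

interpretation radial_sigma2: pair_sigma_finite radial_measure sigma2 ..

lemma integrable_polar:
  fixes f :: "real^3 \<Rightarrow> 'b::{banach, second_countable_topology}"
  assumes "integrable lborel f"
  shows "integrable (radial_measure \<Otimes>\<^sub>M sigma2) (\<lambda>(r, w). f (r *\<^sub>R w))"
  using assms by (subst (asm) lborel_polar, subst (asm) integrable_distr_eq)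
    (auto simp: case_prod_unfold borel_measurable_integrable)

lemma integral_polar:
  fixes f :: "real^3 \<Rightarrow> 'b::{banach, second_countable_topology}"
  assumes f: "integrable lborel f"
  shows "(LINT x|lborel. f x) = (LINT r|radial_measure. LINT w|sigma2. f (r *\<^sub>R w))"
    and "(LINT x|lborel. f x) = (LINT w|sigma2. LINT r|radial_measure. f (r *\<^sub>R w))"
proof -
  have [measurable]: "f \<in> borel_measurable borel"
    using f by auto
  have "(LINT x|lborel. f x) = integral\<^sup>L (radial_measure \<Otimes>\<^sub>M sigma2) (\<lambda>(r, w). f (r *\<^sub>R w))"
    by (subst lborel_polar, subst integral_distr) (auto simp: case_prod_unfold)
  then show "(LINT x|lborel. f x) = (LINT r|radial_measure. LINT w|sigma2. f (r *\<^sub>R w))"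
    "(LINT x|lborel. f x) = (LINT w|sigma2. LINT r|radial_measure. f (r *\<^sub>R w))"
    using radial_sigma2.integral_fst'[OF integrable_polar[OF f]]
      radial_sigma2.integral_snd[OF integrable_polar[OF f]] by auto
qed

lemma integral_radial_measure:
  fixes f :: "real \<Rightarrow> 'b::{banach, second_countable_topology}"
  assumes [measurable]: "f \<in> borel_measurable borel"
  shows "(LINT r|radial_measure. f r) = (LINT r:{0<..}|lborel. (4 * pi * r\<^sup>2) *\<^sub>R f r)"
  unfolding radial_measure_def set_lebesgue_integral_def
  by (subst integral_density) auto

lemma integrable_radial_measure:
  fixes f :: "real \<Rightarrow> 'b::{banach, second_countable_topology}"
  assumes [measurable]: "f \<in> borel_measurable borel"
  shows "integrable radial_measure f \<longleftrightarrow> set_integrable lborel {0<..} (\<lambda>r. (4 * pi * r\<^sup>2) *\<^sub>R f r)"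
  unfolding radial_measure_def set_integrable_def
  by (subst integrable_density) auto

subsection \<open>Archimedes' hat-box theorem\<close>

text \<open>Splits space into a line and a plane, so that Fubini can slice a solid of revolution
  about the first axis into discs, which are balls of \<open>real \<times> real\<close>.\<close>

definition coords3 :: "real \<times> real \<times> real \<Rightarrow> real^3" where
  "coords3 = (\<lambda>(s, u, v). vector [s, u, v])"

lemma coords3_nth [simp]:
  "coords3 (s, y) $ 1 = s" "coords3 (s, y) $ 2 = fst y" "coords3 (s, y) $ 3 = snd y"
  by (simp_all add: coords3_def vector_3 split: prod.splits)

lemma coords3_measurable [measurable]: "coords3 \<in> borel_measurable borel"
proof -
  have "(\<lambda>x. coords3 x $ i) \<in> borel_measurable borel" for i
  proof -
    consider "i = 1" | "i = 2" | "i = 3" using exhaust_3[of i] by blast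
    then show ?thesis
      by cases (auto simp: coords3_def case_prod_unfold vector_3
          intro!: borel_measurable_continuous_onI continuous_intros)
  qed
  then show ?thesis
    by (subst borel_measurable_euclidean_space) (auto simp: Basis_vec_def inner_axis)
qed

lemma emeasure_lborel_Times:
  assumes "A \<in> sets borel" "B \<in> sets borel"
  shows "emeasure lborel (A \<times> B) = emeasure lborel A * emeasure lborel B"
  using lborel.emeasure_pair_measure_Times[of A lborel B] assms
  by (simp only: lborel_prod sets_lborel)

lemma lborel_coords3: "lborel = distr lborel borel coords3"
proof (rule lborel_eqI)
  fix l u :: "real^3"
  assume le: "\<And>b. b \<in> Basis \<Longrightarrow> l \<bullet> b \<le> u \<bullet> b"
  have le': "l $ i \<le> u $ i" for i
    using le[of "axis i 1"] by (simp add: inner_axis)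
  have "coords3 -` box l u = {l $ 1<..<u $ 1} \<times> {l $ 2<..<u $ 2} \<times> {l $ 3<..<u $ 3}"
    by (auto simp: mem_box_cart forall_3 coords3_def vector_3)
  then have "emeasure (distr lborel borel coords3) (box l u) =
      emeasure lborel ({l $ 1<..<u $ 1} \<times> {l $ 2<..<u $ 2} \<times> {l $ 3<..<u $ 3})"
    by (subst emeasure_distr) auto
  also have "\<dots> = emeasure lborel {l $ 1<..<u $ 1} * (emeasure lborel {l $ 2<..<u $ 2} * emeasure lborel {l $ 3<..<u $ 3})"
    by (simp only: emeasure_lborel_Times borel_open open_greaterThanLessThan open_Times)
  also have "\<dots> = ennreal ((u $ 1 - l $ 1) * ((u $ 2 - l $ 2) * (u $ 3 - l $ 3)))"
    using le' by (simp add: ennreal_mult)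
  also have "(u $ 1 - l $ 1) * ((u $ 2 - l $ 2) * (u $ 3 - l $ 3)) = prod ((\<bullet>) (u - l)) Basis"
  proof -
    have "prod ((\<bullet>) (u - l)) Basis = (\<Prod>i\<in>UNIV. (u - l) $ i)"
      unfolding Basis_vec_def
      by (subst prod.reindex_bij_betw[symmetric, where h="\<lambda>i. axis i 1" and S=UNIV])
         (auto simp: bij_betw_def inj_on_def axis_eq_axis inner_axis)
    also have "\<dots> = (u $ 1 - l $ 1) * ((u $ 2 - l $ 2) * (u $ 3 - l $ 3))"
      unfolding UNIV_3 by simp
    finally show ?thesis by simp
  qed
  finally show "emeasure (distr lborel borel coords3) (box l u) = ennreal (prod ((\<bullet>) (u - l)) Basis)" .
qed simp

lemma norm_coords3: "norm (coords3 (s, y)) = sqrt (s\<^sup>2 + (norm y)\<^sup>2)"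
  by (cases y) (simp add: coords3_def norm_vec_def L2_set_def sum_3 vector_3 norm_Pair)

text \<open>The spherical sector is sliced at height \<open>s\<close> along its axis. Up to
  \<open>s = t\<close> the cone bounds the slice, beyond it the sphere does, and the two volumes add
  up to an expression linear in \<open>t\<close>.\<close>

lemma emeasure_cap_cone:
  assumes t: "0 < t" "t < 1"
  shows "emeasure lborel {x::real^3. 0 < norm x \<and> norm x < 1 \<and> t < sgn x $ 1} = ennreal (2 * pi / 3 * (1 - t))"
proof -
  define S where "S = {x::real^3. 0 < norm x \<and> norm x < 1 \<and> t < sgn x $ 1}"
  \<comment> \<open>Squared radius of the disc at height \<open>s\<close>: the first bound is the
    unit ball, the second is the cone condition \<open>t * norm x < s\<close> solved for the
    distance to the axis. They agree exactly at \<open>s = t\<close>.\<close>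
  define m where "m s = min (1 - s\<^sup>2) (s\<^sup>2 * (1 / t\<^sup>2 - 1))" for s :: real
  have [measurable]: "S \<in> sets borel"
    unfolding S_def by measurable
  have mem: "coords3 (s, y) \<in> S \<longleftrightarrow> 0 < s \<and> s < 1 \<and> y \<in> ball 0 (sqrt (m s))" for s and y :: "real \<times> real"
  proof -
    let ?n = "sqrt (s\<^sup>2 + (norm y)\<^sup>2)"
    have "coords3 (s, y) \<in> S \<longleftrightarrow> 0 < norm (coords3 (s, y)) \<and> norm (coords3 (s, y)) < 1 \<and> t < s / norm (coords3 (s, y))"
      unfolding S_def by (simp add: sgn_div_norm field_simps)
    also have "\<dots> \<longleftrightarrow> 0 < ?n \<and> ?n < 1 \<and> t < s / ?n"
      by (simp only: norm_coords3)
    also have "\<dots> \<longleftrightarrow> 0 < s \<and> ?n < 1 \<and> t * ?n < s"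
    proof (cases "0 < s")
      case True
      then have "0 < ?n" by (simp add: add_pos_nonneg)
      with True show ?thesis by (simp add: field_simps)
    next
      case False
      have "s / ?n \<le> 0" using False by (intro divide_nonpos_nonneg) auto
      with False t show ?thesis by auto
    qed
    also have "\<dots> \<longleftrightarrow> 0 < s \<and> s\<^sup>2 + (norm y)\<^sup>2 < 1 \<and> t\<^sup>2 * (s\<^sup>2 + (norm y)\<^sup>2) < s\<^sup>2"
    proof -
      have "t * ?n < s \<longleftrightarrow> t\<^sup>2 * (s\<^sup>2 + (norm y)\<^sup>2) < s\<^sup>2" if "0 < s"
      proof -
        have "t * ?n < s \<longleftrightarrow> (t * ?n)\<^sup>2 < s\<^sup>2"
          using that t power_strict_mono[of "t * ?n" s 2] power2_less_imp_less[of "t * ?n" s] by auto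
        then show ?thesis by (simp add: power_mult_distrib)
      qed
      then show ?thesis by auto
    qed
    also have "\<dots> \<longleftrightarrow> 0 < s \<and> s < 1 \<and> (norm y)\<^sup>2 < m s"
    proof -
      have "t\<^sup>2 * (s\<^sup>2 + (norm y)\<^sup>2) < s\<^sup>2 \<longleftrightarrow> (norm y)\<^sup>2 < s\<^sup>2 * (1 / t\<^sup>2 - 1)"
      proof -
        have "(norm y)\<^sup>2 < s\<^sup>2 * (1 / t\<^sup>2 - 1) \<longleftrightarrow> t\<^sup>2 * (norm y)\<^sup>2 < t\<^sup>2 * (s\<^sup>2 * (1 / t\<^sup>2 - 1))"
          using t by simp
        also have "t\<^sup>2 * (s\<^sup>2 * (1 / t\<^sup>2 - 1)) = s\<^sup>2 - t\<^sup>2 * s\<^sup>2"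
          using t by (simp add: algebra_simps)
        finally show ?thesis by (auto simp: algebra_simps)
      qed
      moreover have "s < 1" if "0 < s" "s\<^sup>2 + (norm y)\<^sup>2 < 1"
      proof -
        have "s\<^sup>2 < 1\<^sup>2" using that by (smt (verit) one_power2 zero_le_power2)
        then show ?thesis using that power_less_imp_less_base[of s 2 1] by simp
      qed
      ultimately show ?thesis by (auto simp: m_def)
    qed
    also have "\<dots> \<longleftrightarrow> 0 < s \<and> s < 1 \<and> y \<in> ball 0 (sqrt (m s))"
      using real_sqrt_less_iff[of "(norm y)\<^sup>2" "m s"] by simp
    finally show ?thesis .
  qed
  have t2: "0 \<le> 1 / t\<^sup>2 - 1"
    using t by (simp add: le_divide_eq power_le_one)
  have m0: "0 \<le> m s" if "0 < s" "s < 1" for s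
    using that t2 by (simp add: m_def power_le_one)
  have "emeasure lborel S = emeasure lborel (coords3 -` S)"
    by (subst lborel_coords3, subst emeasure_distr) auto
  also have "\<dots> = (\<integral>\<^sup>+s. emeasure lborel (Pair s -` (coords3 -` S)) \<partial>lborel)"
    using measurable_sets_borel[OF coords3_measurable \<open>S \<in> sets borel\<close>]
      lborel.emeasure_pair_measure_alt[of "coords3 -` S" lborel]
    by (simp only: lborel_prod sets_lborel)
  also have "\<dots> = (\<integral>\<^sup>+s. ennreal (pi * m s) * indicator {0<..<1} s \<partial>lborel)"
  proof (rule nn_integral_cong)
    fix s :: real
    have e: "Pair s -` (coords3 -` S) = (if 0 < s \<and> s < 1 then ball 0 (sqrt (m s)) else {})"
      unfolding vimage_def mem_Collect_eq mem by (simp only: set_eq_iff mem_Collect_eq empty_iff split: if_split) blast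
    show "emeasure lborel (Pair s -` (coords3 -` S)) = ennreal (pi * m s) * indicator {0<..<1} s"
    proof (cases "0 < s \<and> s < 1")
      case True
      then have "emeasure lborel (ball (0 :: real \<times> real) (sqrt (m s))) = ennreal (pi * m s)"
        using m0[of s] by (simp add: emeasure_ball unit_ball_vol_2)
      with True show ?thesis by (simp add: e)
    next
      case False
      then show ?thesis unfolding e if_not_P[OF False] by (auto simp: indicator_def)
    qed
  qed
  also have "\<dots> = (\<integral>\<^sup>+s. ennreal (pi * (s\<^sup>2 * (1 / t\<^sup>2 - 1))) * indicator {0..t} s +
       ennreal (pi * (1 - s\<^sup>2)) * indicator {t..1} s \<partial>lborel)"
  proof (intro nn_integral_cong_AE)
    have *: "m s = (if s \<le> t then s\<^sup>2 * (1 / t\<^sup>2 - 1) else 1 - s\<^sup>2)" if "0 < s" for s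
    proof -
      have "s\<^sup>2 * (1 / t\<^sup>2 - 1) \<le> 1 - s\<^sup>2 \<longleftrightarrow> s\<^sup>2 / t\<^sup>2 \<le> 1"
        by (simp add: algebra_simps)
      also have "\<dots> \<longleftrightarrow> s\<^sup>2 \<le> t\<^sup>2"
        using t by simp
      also have "\<dots> \<longleftrightarrow> s \<le> t" using t that by simp
      finally show ?thesis by (auto simp: m_def)
    qed
    show "AE s in lborel. ennreal (pi * m s) * indicator {0<..<1} s = ennreal (pi * (s\<^sup>2 * (1 / t\<^sup>2 - 1))) * indicator {0..t} s +
       ennreal (pi * (1 - s\<^sup>2)) * indicator {t..1} s"
      using AE_lborel_singleton[of 0] AE_lborel_singleton[of t] AE_lborel_singleton[of 1]
    proof eventually_elim
      case (elim s)
      consider "s < 0" | "0 < s" "s < t" | "t < s" "s < 1" | "1 < s"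
        using elim by linarith
      then show ?case using t by cases (simp_all add: *)
    qed
  qed
  also have "\<dots> = (\<integral>\<^sup>+s. ennreal (pi * (s\<^sup>2 * (1 / t\<^sup>2 - 1))) * indicator {0..t} s \<partial>lborel) +
       (\<integral>\<^sup>+s. ennreal (pi * (1 - s\<^sup>2)) * indicator {t..1} s \<partial>lborel)"
    by (subst nn_integral_add) auto
  also have "(\<integral>\<^sup>+s. ennreal (pi * (s\<^sup>2 * (1 / t\<^sup>2 - 1))) * indicator {0..t} s \<partial>lborel) =
      ennreal (pi * (t ^ 3 / 3 * (1 / t\<^sup>2 - 1)) - pi * (0 ^ 3 / 3 * (1 / t\<^sup>2 - 1)))"
  proof (rule nn_integral_FTC_Icc[where F="\<lambda>s. pi * (s ^ 3 / 3 * (1 / t\<^sup>2 - 1))"])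
    fix s assume "s \<in> {0..t}"
    show "DERIV (\<lambda>s. pi * (s ^ 3 / 3 * (1 / t\<^sup>2 - 1))) s :> pi * (s\<^sup>2 * (1 / t\<^sup>2 - 1))"
      by (auto intro!: derivative_eq_intros)
    show "0 \<le> pi * (s\<^sup>2 * (1 / t\<^sup>2 - 1))"
      using t2 by (intro mult_nonneg_nonneg) auto
  qed (use t in auto)
  also have "(\<integral>\<^sup>+s. ennreal (pi * (1 - s\<^sup>2)) * indicator {t..1} s \<partial>lborel) =
      ennreal (pi * (1 - 1 ^ 3 / 3) - pi * (t - t ^ 3 / 3))"
  proof (rule nn_integral_FTC_Icc[where F="\<lambda>s. pi * (s - s ^ 3 / 3)"])
    fix s assume "s \<in> {t..1}"
    then show "0 \<le> pi * (1 - s\<^sup>2)" using t by (auto simp: power_le_one)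
    show "DERIV (\<lambda>s. pi * (s - s ^ 3 / 3)) s :> pi * (1 - s\<^sup>2)"
      by (auto intro!: derivative_eq_intros)
  qed (use t in auto)
  also have "ennreal (pi * (t ^ 3 / 3 * (1 / t\<^sup>2 - 1)) - pi * (0 ^ 3 / 3 * (1 / t\<^sup>2 - 1))) +
     ennreal (pi * (1 - 1 ^ 3 / 3) - pi * (t - t ^ 3 / 3)) = ennreal (2 * pi / 3 * (1 - t))"
  proof -
    have a: "0 \<le> pi * (t ^ 3 / 3 * (1 / t\<^sup>2 - 1)) - pi * (0 ^ 3 / 3 * (1 / t\<^sup>2 - 1))"
      using t2 t by (auto intro!: mult_nonneg_nonneg)
    have "t - t ^ 3 / 3 \<le> 1 - 1 ^ 3 / 3"
    proof -
      have "1 - 1 ^ 3 / 3 - (t - t ^ 3 / 3) = (1 - t)\<^sup>2 * (t + 2) / 3"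
        by (simp add: power2_eq_square power3_eq_cube algebra_simps diff_divide_distrib add_divide_distrib)
      also have "\<dots> \<ge> 0" using t by simp
      finally show ?thesis by simp
    qed
    then have b: "0 \<le> pi * (1 - 1 ^ 3 / 3) - pi * (t - t ^ 3 / 3)"
      using mult_left_mono[of "t - t ^ 3 / 3" "1 - 1 ^ 3 / 3" pi] by simp
    have eq: "pi * (t ^ 3 / 3 * (1 / t\<^sup>2 - 1)) - pi * (0 ^ 3 / 3 * (1 / t\<^sup>2 - 1)) +
      (pi * (1 - 1 ^ 3 / 3) - pi * (t - t ^ 3 / 3)) = 2 * pi / 3 * (1 - t)"
    proof -
      have e: "t ^ 3 / 3 * (1 / t\<^sup>2 - 1) = t / 3 - t ^ 3 / 3"
        using t by (simp add: right_diff_distrib power2_eq_square power3_eq_cube)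
      show ?thesis unfolding e by (simp add: algebra_simps)
    qed
    show ?thesis unfolding ennreal_plus[OF a b, symmetric] eq ..
  qed
  finally show ?thesis by (simp add: S_def)
qed

section \<open>Areas of spherical caps and the law of the height\<close>

lemma emeasure_sigma2_orthogonal:
  assumes "orthogonal_transformation f" and A: "A \<in> sets sigma2"
  shows "emeasure sigma2 (f ` A) = emeasure sigma2 A"
proof -
  have "A \<in> sets sphere_measure"
    using A by (simp add: sets_sigma2 sets_sphere_measure)
  then show ?thesis
    using emeasure_sphere_measure_orthogonal[OF assms(1)] by (simp add: sigma2_def)
qed

lemma emeasure_cap:
  fixes a :: "real^3"
  assumes a: "norm a = 1" and t: "0 < t" "t < 1"
  shows "emeasure sigma2 {w \<in> sphere 0 1. t < a \<bullet> w} = ennreal ((1 - t) / 2)"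
proof -
  define C where "C = {w::real^3. norm w = 1 \<and> t < w $ 1}"
  obtain f :: "real^3 \<Rightarrow> real^3" where f: "orthogonal_transformation f" "f (axis 1 1) = a"
    using orthogonal_transformation_exists[of "axis 1 1 :: real^3" a] a by auto
  have C: "C \<in> sets sigma2"
    unfolding C_def sets_sigma2_iff by auto
  have "ennreal (4 * pi / 3) * emeasure sigma2 C =
      emeasure lborel {x. 0 < norm x \<and> norm x < 1 \<and> sgn x \<in> C}"
    by (rule emeasure_sigma2[OF C])
  also have "{x. 0 < norm x \<and> norm x < 1 \<and> sgn x \<in> C} = {x::real^3. 0 < norm x \<and> norm x < 1 \<and> t < sgn x $ 1}"
    by (auto simp: C_def norm_sgn)
  also have "emeasure lborel \<dots> = ennreal (2 * pi / 3 * (1 - t))"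
    by (rule emeasure_cap_cone[OF t])
  also have "\<dots> = ennreal (4 * pi / 3) * ennreal ((1 - t) / 2)"
    using t by (subst ennreal_mult[symmetric]) auto
  finally have "emeasure sigma2 C = ennreal ((1 - t) / 2)"
    by (subst (asm) ennreal_mult_cancel_left) auto
  moreover have "f ` C = {w \<in> sphere 0 1. t < a \<bullet> w}"
  proof -
    have "a \<bullet> f x = x $ 1" for x
      using f(1) by (simp flip: f(2) add: orthogonal_transformation_def inner_axis')
    moreover have "norm (f x) = norm x" for x
      using f(1) by (simp add: orthogonal_transformation)
    ultimately have "f x \<in> {w \<in> sphere 0 1. t < a \<bullet> w} \<longleftrightarrow> x \<in> C" for x
      by (simp add: C_def)
    then have "f -` {w \<in> sphere 0 1. t < a \<bullet> w} = C"
      by (simp only: vimage_def) simp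
    then show ?thesis
      using surj_image_vimage_eq[OF orthogonal_transformation_surj[OF f(1)]] by metis
  qed
  ultimately show ?thesis
    using emeasure_sigma2_orthogonal[OF f(1) C] by simp
qed

lemma cap_measurable [measurable]:
  "{w \<in> sphere 0 1. t < a \<bullet> w} \<in> sets sigma2" "{w \<in> sphere 0 1. t \<le> a \<bullet> w} \<in> sets sigma2"
  by (auto simp: sets_sigma2_iff)

text \<open>The sector volume covers only \<open>0 < t < 1\<close>. The complement of an open cap is
  a closed cap about \<open>- a\<close>, which yields negative heights once closed caps are known;
  these are squeezed between the open cap of the same height and slightly larger open ones. The
  heights 0 and -1 follow by approximation.\<close>

lemma measure_cap:
  fixes a :: "real^3"
  assumes a: "norm a = 1" and t: "-1 \<le> t" "t \<le> 1"
  shows "measure sigma2 {w \<in> sphere 0 1. t < a \<bullet> w} = (1 - t) / 2"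
proof -
  define G where "G a t = measure sigma2 {w \<in> sphere 0 1. t < a \<bullet> w}" for a t
  define H where "H a t = measure sigma2 {w \<in> sphere 0 1. t \<le> a \<bullet> w}" for a t
  have G: "G a t = (1 - t) / 2" if "norm a = 1" "0 < t" "t < 1" for a t
    using emeasure_cap[OF that] that by (simp add: G_def sigma2.emeasure_eq_measure)
  have GH: "G a t \<le> H a t" "s < t \<Longrightarrow> H a t \<le> G a s" for a s t
    unfolding G_def H_def by (rule sigma2.finite_measure_mono; use cap_measurable in force)+
  have compl: "G a t = 1 - H (- a) (- t)" for a t
  proof -
    have "{w \<in> sphere 0 1. t < a \<bullet> w} = space sigma2 - {w \<in> sphere 0 1. - t \<le> (- a) \<bullet> w}"
      by auto
    then show ?thesis
      unfolding G_def H_def by (simp only: sigma2.prob_compl cap_measurable)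
  qed
  have H: "H a t = (1 - t) / 2" if "norm a = 1" "0 < t" "t < 1" for a t
  proof (rule antisym)
    show "H a t \<le> (1 - t) / 2"
    proof (rule field_le_epsilon)
      fix e :: real assume "e > 0"
      \<comment> \<open>The floor \<open>t / 2\<close> keeps \<open>s\<close> inside
        \<open>(0, 1)\<close>, where \<open>G\<close> is known; the gap of at most
        \<open>2 * e\<close> becomes \<open>e\<close> after halving.\<close>
      define s where "s = max (t / 2) (t - 2 * e)"
      have "H a t \<le> G a s" using that \<open>e > 0\<close> by (intro GH) (auto simp: s_def)
      also have "G a s = (1 - s) / 2" using that \<open>e > 0\<close> by (intro G) (auto simp: s_def)
      also have "\<dots> \<le> (1 - t) / 2 + e" by (auto simp: s_def max_def field_simps)
      finally show "H a t \<le> (1 - t) / 2 + e" .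
    qed
    show "(1 - t) / 2 \<le> H a t" using GH(1)[of a t] G[OF that] by simp
  qed
  have G0_ge: "1 / 2 \<le> G a 0" if "norm a = 1" for a
  proof (rule field_le_epsilon)
    fix e :: real assume "e > 0"
    define s where "s = min e (1 / 2)"
    have "(1 - s) / 2 = H a s" using that \<open>e > 0\<close> by (intro H[symmetric]) (auto simp: s_def)
    also have "\<dots> \<le> G a 0" using \<open>e > 0\<close> by (intro GH) (auto simp: s_def)
    finally show "1 / 2 \<le> G a 0 + e" using \<open>e > 0\<close> by (auto simp: s_def min_def field_simps split: if_splits)
  qed
  have G0: "G a 0 = 1 / 2"
    using compl[of a 0] GH(1)[of "- a" 0] G0_ge[of a] G0_ge[of "- a"] a by simp
  have G1: "G a 1 = 0"
  proof -
    have "\<not> 1 < a \<bullet> w" if "norm w = 1" for w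
      using norm_cauchy_schwarz[of a w] a that by simp
    then have e: "{w \<in> sphere 0 1. 1 < a \<bullet> w} = {}"
      by simp
    show ?thesis unfolding G_def e by simp
  qed
  have Hm: "G a t \<ge> G a s" if "t \<le> s" for a s t
    unfolding G_def using that by (intro sigma2.finite_measure_mono; use cap_measurable in force)
  have Gm1: "G a (- 1) = 1"
  proof (rule antisym)
    show "G a (- 1) \<le> 1" unfolding G_def by simp
    show "1 \<le> G a (- 1)"
    proof (rule field_le_epsilon)
      fix e :: real assume "e > 0"
      define s where "s = max (1 / 2) (1 - 2 * e)"
      have "(1 + s) / 2 = G a (- s)"
        using H[of "- a" s] a \<open>e > 0\<close> by (subst compl) (auto simp: s_def)
      also have "\<dots> \<le> G a (- 1)" using \<open>e > 0\<close> by (intro Hm) (auto simp: s_def)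
      finally show "1 \<le> G a (- 1) + e" using \<open>e > 0\<close> by (auto simp: s_def max_def field_simps split: if_splits)
    qed
  qed
  consider "t = -1" | "-1 < t" "t < 0" | "t = 0" | "0 < t" "t < 1" | "t = 1"
    using t by linarith
  then have "G a t = (1 - t) / 2"
  proof cases
    case 2
    then show ?thesis using H[of "- a" "- t"] a by (subst compl) auto
  qed (use Gm1 G0 G1 G a in auto)
  then show ?thesis by (simp add: G_def)
qed

lemma cap_eq_extremes:
  fixes a :: "real^3"
  assumes a: "norm a = 1"
  shows "t < -1 \<Longrightarrow> {w \<in> sphere 0 1. t < a \<bullet> w} = sphere 0 1"
    and "t > 1 \<Longrightarrow> {w \<in> sphere 0 1. t < a \<bullet> w} = {}"
proof -
  have "-1 \<le> a \<bullet> w" "a \<bullet> w \<le> 1" if "norm w = 1" for w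
    using Cauchy_Schwarz_ineq2[of a w] a that by simp_all
  then show "t < -1 \<Longrightarrow> {w \<in> sphere 0 1. t < a \<bullet> w} = sphere 0 1"
    and "t > 1 \<Longrightarrow> {w \<in> sphere 0 1. t < a \<bullet> w} = {}"
    by (fastforce simp: abs_le_iff)+
qed

lemma inner_measurable_sigma2 [measurable]: "(\<lambda>w. a \<bullet> w) \<in> borel_measurable sigma2"
  by (rule measurable_sigma2I) measurable

text \<open>Cap areas that are linear in the height mean a constant density; agreement on all
  half-lines then determines the law.\<close>

lemma distr_inner_sigma2:
  fixes a :: "real^3"
  assumes a: "norm a = 1"
  shows "distr sigma2 borel (\<lambda>w. a \<bullet> w) = density lborel (\<lambda>t. ennreal (indicator {-1..1} t / 2))"
proof (rule measure_eqI_lessThan)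
  have e: "emeasure (distr sigma2 borel (\<lambda>w. a \<bullet> w)) {t<..} = emeasure sigma2 {w \<in> sphere 0 1. t < a \<bullet> w}" for t
    by (subst emeasure_distr) (auto intro!: arg_cong[where f="emeasure sigma2"])
  fix t :: real
  show "emeasure (distr sigma2 borel (\<lambda>w. a \<bullet> w)) {t<..} < \<infinity>"
    by (simp add: e sigma2.emeasure_eq_measure)
  have "emeasure (density lborel (\<lambda>t. ennreal (indicator {-1..1} t / 2))) {t<..} =
      (\<integral>\<^sup>+x. ennreal (1 / 2) * indicator {max t (-1)..1} x \<partial>lborel)"
    by (subst emeasure_density, simp, simp, intro nn_integral_cong_AE)
       (use AE_lborel_singleton[of t] in \<open>eventually_elim, auto simp: indicator_def max_def\<close>)
  also have "\<dots> = ennreal (1 / 2) * emeasure lborel {max t (-1)..1}"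
    by (subst nn_integral_cmult_indicator) auto
  also have "\<dots> = ennreal (1 / 2) * ennreal (if t \<le> 1 then 1 - max t (-1) else 0)"
    by (simp add: emeasure_lborel_Icc_eq)
  also have "\<dots> = ennreal (if t \<le> 1 then (1 - max t (-1)) / 2 else 0)"
    by (subst ennreal_mult[symmetric]) auto
  also have "\<dots> = emeasure sigma2 {w \<in> sphere 0 1. t < a \<bullet> w}"
  proof (cases "-1 \<le> t \<and> t \<le> 1")
    case True
    then show ?thesis
      using measure_cap[OF a, of t] by (simp add: sigma2.emeasure_eq_measure)
  next
    case False
    then consider "t < -1" | "t > 1" by linarith
    then show ?thesis
    proof cases
      case 1
      then show ?thesis by (simp only: cap_eq_extremes(1)[OF a] emeasure_sigma2_space) auto
    next
      case 2
      then show ?thesis by (simp only: cap_eq_extremes(2)[OF a]) auto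
    qed
  qed
  finally show "emeasure (distr sigma2 borel (\<lambda>w. a \<bullet> w)) {t<..} =
     emeasure (density lborel (\<lambda>t. ennreal (indicator {-1..1} t / 2))) {t<..}"
    by (simp add: e)
qed simp_all

lemma norm_add_measurable_sigma2 [measurable]: "(\<lambda>w. norm (a + w)) \<in> borel_measurable sigma2"
  by (rule measurable_sigma2I) measurable

text \<open>From \<open>(norm (a + w))\<^sup>2 = 2 + 2 * (a \<bullet> w)\<close>: the height
  \<open>r\<^sup>2 / 2 - 1\<close> has density \<open>1 / 2\<close>, and its derivative in
  \<open>r\<close> is \<open>r\<close>. That this density vanishes linearly at 0 is what later makes
  \<open>1 / norm (a + b)\<close> integrable.\<close>

lemma distr_norm_add_sigma2:
  fixes a :: "real^3"
  assumes a: "norm a = 1"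
  shows "distr sigma2 borel (\<lambda>w. norm (a + w)) = density lborel (\<lambda>r. ennreal (indicator {0..2} r * (r / 2)))"
proof (rule measure_eqI_lessThan)
  have e: "emeasure (distr sigma2 borel (\<lambda>w. norm (a + w))) {t<..} = emeasure sigma2 {w \<in> sphere 0 1. t < norm (a + w)}" for t
    by (subst emeasure_distr) (auto intro!: arg_cong[where f="emeasure sigma2"])
  have nrm: "(norm (a + w))\<^sup>2 = 2 + 2 * (a \<bullet> w)" if "norm w = 1" for w
    using that a unfolding power2_norm_eq_inner by (simp add: inner_simps inner_commute norm_eq_1)
  fix t :: real
  show "emeasure (distr sigma2 borel (\<lambda>w. norm (a + w))) {t<..} < \<infinity>"
    by (simp add: e sigma2.emeasure_eq_measure)
  have "emeasure (density lborel (\<lambda>r. ennreal (indicator {0..2} r * (r / 2)))) {t<..} =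
      (\<integral>\<^sup>+x. ennreal (x / 2) * indicator {max t 0..2} x \<partial>lborel)"
    by (subst emeasure_density, simp, simp, intro nn_integral_cong_AE)
       (use AE_lborel_singleton[of t] in \<open>eventually_elim, auto simp: indicator_def max_def\<close>)
  also have "\<dots> = ennreal (if t \<le> 2 then 1 - (max t 0)\<^sup>2 / 4 else 0)"
  proof (cases "t \<le> 2")
    case True
    then have "(\<integral>\<^sup>+x. ennreal (x / 2) * indicator {max t 0..2} x \<partial>lborel) = ennreal (2\<^sup>2 / 4 - (max t 0)\<^sup>2 / 4)"
      by (intro nn_integral_FTC_Icc[where F="\<lambda>x. x\<^sup>2 / 4"]) (auto intro!: derivative_eq_intros)
    with True show ?thesis by simp
  qed simp
  also have "\<dots> = emeasure sigma2 {w \<in> sphere 0 1. t < norm (a + w)}"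
  proof -
    consider "t < 0" | "0 \<le> t" "t \<le> 2" | "t > 2" by linarith
    then show ?thesis
    proof cases
      case 1
      then have "{w \<in> sphere 0 1. t < norm (a + w)} = sphere 0 1"
        by (auto intro: less_le_trans)
      then show ?thesis using 1 by (simp add: emeasure_sigma2_space)
    next
      case 2
      have "t < norm (a + w) \<longleftrightarrow> t\<^sup>2 / 2 - 1 < a \<bullet> w" if "norm w = 1" for w
      proof -
        have "t < norm (a + w) \<longleftrightarrow> t\<^sup>2 < (norm (a + w))\<^sup>2"
          using 2 by (metis norm_ge_zero power2_less_imp_less power_strict_mono zero_less_numeral)
        then show ?thesis by (auto simp: nrm[OF that])
      qed
      then have "{w \<in> sphere 0 1. t < norm (a + w)} = {w \<in> sphere 0 1. t\<^sup>2 / 2 - 1 < a \<bullet> w}"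
        by auto
      moreover have "t\<^sup>2 \<le> 4"
        using 2 power_mono[of t 2 2] by simp
      ultimately show ?thesis
        using 2 measure_cap[OF a, of "t\<^sup>2 / 2 - 1"] by (simp add: sigma2.emeasure_eq_measure)
    next
      case 3
      then have "\<not> t < norm (a + w)" if "norm w = 1" for w
        using a norm_triangle_ineq[of a w] that by simp
      then have e: "{w \<in> sphere 0 1. t < norm (a + w)} = {}"
        by simp
      show ?thesis unfolding e using 3 by simp
    qed
  qed
  finally show "emeasure (distr sigma2 borel (\<lambda>w. norm (a + w))) {t<..} =
     emeasure (density lborel (\<lambda>r. ennreal (indicator {0..2} r * (r / 2)))) {t<..}"
    by (simp add: e)
qed simp_all

subsection \<open>Fourier transforms of radial functions\<close>

text \<open>The library's \<open>sinc\<close> is an abbreviation for a conditional, which the simplifier would split.\<close>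

definition snc :: "real \<Rightarrow> real" where
  "snc t = (if t = 0 then 1 else sin t / t)"

lemma snc_0 [simp]: "snc 0 = 1"
  by (simp add: snc_def)

lemma snc_mult: "t * snc t = sin t"
  by (simp add: snc_def)

lemma continuous_snc: "isCont snc t"
proof -
  have "snc = sinc" by (auto simp: snc_def)
  then show ?thesis using isCont_sinc by simp
qed

lemma continuous_on_snc [continuous_intros]: "continuous_on A f \<Longrightarrow> continuous_on A (\<lambda>x. snc (f x))"
  by (rule continuous_on_compose2[of UNIV snc]) (auto intro!: continuous_at_imp_continuous_on continuous_snc)

lemma snc_measurable [measurable]: "snc \<in> borel_measurable borel"
  by (intro borel_measurable_continuous_onI continuous_intros)

lemma abs_snc_le: "\<bar>snc t\<bar> \<le> 1"
  using abs_sin_x_le_abs_x[of t] by (simp add: snc_def)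

text \<open>By the uniform law of the height, the integral is the mean of \<open>cis (k * t)\<close>
  over \<open>-1 \<le> t \<le> 1\<close> with \<open>k = norm z\<close>.\<close>

lemma sigma2_fourier: "(LINT w|sigma2. cis (z \<bullet> w)) = complex_of_real (snc (norm z))"
proof (cases "z = 0")
  case True
  then show ?thesis using sigma2.prob_space by (simp add: complex_eq_iff)
next
  case False
  define a where "a = z /\<^sub>R norm z"
  define k where "k = norm z"
  have k: "k > 0" and a: "norm a = 1" and z: "z = k *\<^sub>R a"
    using False by (auto simp: a_def k_def)
  have "(LINT w|sigma2. cis (z \<bullet> w)) = (LINT t|distr sigma2 borel (\<lambda>w. a \<bullet> w). cis (k * t))"
    by (subst integral_distr) (auto simp: z intro!: borel_measurable_continuous_onI continuous_intros)
  also have "\<dots> = (LINT t|lborel. (indicator {-1..1} t / 2) *\<^sub>R cis (k * t))"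
    unfolding distr_inner_sigma2[OF a]
    by (subst integral_density) (auto intro!: borel_measurable_continuous_onI continuous_intros)
  also have "\<dots> = (LINT t|lborel. indicator {-1..1} t *\<^sub>R (cis (k * t) / 2))"
    by (intro Bochner_Integration.integral_cong) (auto simp: scaleR_conv_of_real)
  also have "\<dots> = cis (k * 1) / (2 * \<i> * k) - cis (k * (-1)) / (2 * \<i> * k)"
  proof (intro has_bochner_integral_integral_eq has_bochner_integral_FTC_Icc)
    fix t :: real assume "-1 \<le> t" "t \<le> 1"
    show "((\<lambda>t. cis (k * t) / (2 * \<i> * k)) has_vector_derivative cis (k * t) / 2) (at t within {-1..1})"
    proof -
      have "((\<lambda>t. Complex (sin (k * t) / (2 * k)) (- cos (k * t) / (2 * k))) has_vector_derivative
          Complex (cos (k * t) / 2) (sin (k * t) / 2)) (at t within {-1..1})"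
        unfolding has_vector_derivative_complex_iff
        using k by (auto intro!: derivative_eq_intros simp: field_simps)
      moreover have "Complex (sin (k * t) / (2 * k)) (- cos (k * t) / (2 * k)) = cis (k * t) / (2 * \<i> * k)" for t
        using k by (simp add: complex_eq_iff Re_divide Im_divide power2_eq_square)
      moreover have "Complex (cos (k * t) / 2) (sin (k * t) / 2) = cis (k * t) / 2"
        by (simp add: complex_eq_iff)
      ultimately show ?thesis by simp
    qed
  qed (auto intro!: continuous_intros)
  also have "\<dots> = complex_of_real (snc k)"
    using k by (simp add: complex_eq_iff snc_def Re_divide Im_divide power2_eq_square field_simps)
  finally show ?thesis by (simp add: k_def)
qed

lemma integrable_normI:
  fixes g :: "real \<Rightarrow> real"
  assumes [measurable]: "g \<in> borel_measurable borel"
    and "integrable lborel (\<lambda>r. indicator {0<..} r * (4 * pi * r\<^sup>2 * g r))"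
  shows "integrable lborel (\<lambda>p::real^3. g (norm p))"
proof (rule integrableI_bounded)
  have "(\<integral>\<^sup>+ p. ennreal (norm (g (norm (p::real^3)))) \<partial>lborel) =
    (\<integral>\<^sup>+r. ennreal (norm (indicator {0<..} r * (4 * pi * r\<^sup>2 * g r))) \<partial>lborel)"
    by (subst nn_integral_norm[where f="\<lambda>r. ennreal (norm (g r))"])
       (auto intro!: nn_integral_cong simp: indicator_def abs_mult ennreal_mult)
  also have "\<dots> < \<infinity>"
    using assms(2) unfolding integrable_iff_bounded by simp
  finally show "(\<integral>\<^sup>+ p. ennreal (norm (g (norm (p::real^3)))) \<partial>lborel) < \<infinity>" .
qed simp

text \<open>Averaging over each sphere replaces \<open>cis (z \<bullet> p)\<close> by
  \<open>snc (r * norm z)\<close>, so that the transforms of the ball, of \<open>rho\<close> and of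
  the exponential all become one-dimensional integrals.\<close>

lemma radial_fourier:
  fixes g :: "real \<Rightarrow> real" and z :: "real^3"
  assumes [measurable]: "g \<in> borel_measurable borel"
    and g: "integrable lborel (\<lambda>p::real^3. g (norm p))"
  shows "(LINT p|lborel. g (norm p) *\<^sub>R cis (z \<bullet> p)) =
    complex_of_real (LINT r|lborel. indicator {0<..} r * (4 * pi * r\<^sup>2 * g r * snc (r * norm z)))"
proof -
  have [measurable]: "cis \<in> borel_measurable borel"
    by (intro borel_measurable_continuous_onI continuous_intros)
  have "integrable lborel (\<lambda>p::real^3. g (norm p) *\<^sub>R cis (z \<bullet> p))"
    by (rule Bochner_Integration.integrable_bound[OF g]) auto
  then have "(LINT p|lborel. g (norm p) *\<^sub>R cis (z \<bullet> p)) =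
      (LINT r|radial_measure. LINT w|sigma2. g (norm (r *\<^sub>R w)) *\<^sub>R cis (z \<bullet> (r *\<^sub>R w)))"
    by (rule integral_polar(1))
  also have "\<dots> = (LINT r|radial_measure. complex_of_real (g \<bar>r\<bar> * snc (\<bar>r\<bar> * norm z)))"
  proof (intro Bochner_Integration.integral_cong refl)
    fix r
    have "(LINT w|sigma2. g (norm (r *\<^sub>R w)) *\<^sub>R cis (z \<bullet> (r *\<^sub>R w))) = (LINT w|sigma2. g \<bar>r\<bar> *\<^sub>R cis ((r *\<^sub>R z) \<bullet> w))"
      by (intro Bochner_Integration.integral_cong refl) simp
    also have "\<dots> = complex_of_real (g \<bar>r\<bar> * snc (\<bar>r\<bar> * norm z))"
      by (simp only: integral_scaleR_right sigma2_fourier norm_scaleR) (simp add: scaleR_conv_of_real)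
    finally show "(LINT w|sigma2. g (norm (r *\<^sub>R w)) *\<^sub>R cis (z \<bullet> (r *\<^sub>R w))) = complex_of_real (g \<bar>r\<bar> * snc (\<bar>r\<bar> * norm z))" .
  qed
  also have "\<dots> = complex_of_real (LINT r|radial_measure. g \<bar>r\<bar> * snc (\<bar>r\<bar> * norm z))"
    by (rule integral_complex_of_real)
  also have "(LINT r|radial_measure. g \<bar>r\<bar> * snc (\<bar>r\<bar> * norm z)) =
     (LINT r|lborel. indicator {0<..} r * (4 * pi * r\<^sup>2 * g r * snc (r * norm z)))"
    by (subst integral_radial_measure)
       (auto simp: set_lebesgue_integral_def intro!: Bochner_Integration.integral_cong split: split_indicator)
  finally show ?thesis .
qed

lemma integral_norm:
  fixes g :: "real \<Rightarrow> real"
  assumes "g \<in> borel_measurable borel" and "integrable lborel (\<lambda>p::real^3. g (norm p))"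
  shows "(LINT p|lborel. g (norm (p::real^3))) = (LINT r|lborel. indicator {0<..} r * (4 * pi * r\<^sup>2 * g r))"
proof -
  have "complex_of_real (LINT p|lborel. g (norm (p::real^3))) = (LINT p|lborel. g (norm p) *\<^sub>R cis (0 \<bullet> (p::real^3)))"
    by (simp flip: integral_complex_of_real add: scaleR_conv_of_real)
  also have "\<dots> = complex_of_real (LINT r|lborel. indicator {0<..} r * (4 * pi * r\<^sup>2 * g r))"
    by (subst radial_fourier[OF assms]) simp
  finally show ?thesis by simp
qed

text \<open>For \<open>k > 0\<close> this is the Bessel profile
  \<open>(2 pi R / k)^(3/2) J_(3/2)(R k)\<close> in elementary form; the value at 0 is the volume of
  the ball.\<close>

definition ball_ft :: "real \<Rightarrow> real \<Rightarrow> real" where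
  "ball_ft R k = (if k = 0 then 4 / 3 * pi * R ^ 3 else 4 * pi * (sin (R * k) - R * k * cos (R * k)) / k ^ 3)"

lemma Q_ball_eq:
  assumes R: "R > 0"
  shows "Q_ball R \<xi> = complex_of_real (ball_ft R (norm \<xi>))"
proof -
  let ?k = "norm \<xi>"
  define g where "g = (indicator {..<R} :: real \<Rightarrow> real)"
  have [measurable]: "g \<in> borel_measurable borel" by (simp add: g_def)
  have int: "integrable lborel (\<lambda>p::real^3. g (norm p))"
  proof -
    have "(\<lambda>p::real^3. g (norm p)) = indicator (ball 0 R)"
      by (auto simp: g_def indicator_def)
    then show ?thesis
      using emeasure_lborel_ball_finite[of "0::real^3" R] by (simp only:) (intro integrable_real_indicator; simp)
  qed
  have "Q_ball R \<xi> = (LINT p|lborel. g (norm p) *\<^sub>R cis (\<xi> \<bullet> p))"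
    unfolding Q_ball_def set_lebesgue_integral_def cis_conv_exp
    by (intro Bochner_Integration.integral_cong) (auto simp: g_def indicator_def)
  also have "\<dots> = complex_of_real (LINT r|lborel. indicator {0<..} r * (4 * pi * r\<^sup>2 * g r * snc (r * ?k)))"
    by (rule radial_fourier[OF _ int]) simp
  also have "(LINT r|lborel. indicator {0<..} r * (4 * pi * r\<^sup>2 * g r * snc (r * ?k))) =
      (LINT r|lborel. indicator {0..R} r *\<^sub>R (4 * pi * r\<^sup>2 * snc (r * ?k)))"
    by (intro integral_cong_AE, simp, simp)
       (use AE_lborel_singleton[of R] in \<open>eventually_elim, auto simp: g_def indicator_def\<close>)
  also have "\<dots> = ball_ft R ?k"
  proof (cases "?k = 0")
    case True
    have "(LINT r|lborel. indicator {0..R} r *\<^sub>R (4 * pi * r\<^sup>2)) = 4 / 3 * pi * R ^ 3 - 4 / 3 * pi * 0 ^ 3"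
      using R by (intro has_bochner_integral_integral_eq has_bochner_integral_FTC_Icc)
       (auto intro!: derivative_eq_intros continuous_intros simp: has_real_derivative_iff_has_vector_derivative[symmetric])
    with True show ?thesis by (simp add: ball_ft_def)
  next
    case False
    then have k: "?k > 0" by simp
    have "(LINT r|lborel. indicator {0..R} r *\<^sub>R (4 * pi * r\<^sup>2 * snc (r * ?k))) =
       4 * pi * (sin (R * ?k) - R * ?k * cos (R * ?k)) / ?k ^ 3 - 4 * pi * (sin (0 * ?k) - 0 * ?k * cos (0 * ?k)) / ?k ^ 3"
    proof (intro has_bochner_integral_integral_eq has_bochner_integral_FTC_Icc)
      fix r assume "0 \<le> r" "r \<le> R"
      have e: "4 * pi * r\<^sup>2 * snc (r * ?k) = 4 * pi * (r * sin (r * ?k)) / ?k"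
        using k snc_mult[of "r * ?k"] by (simp add: field_simps power2_eq_square)
      show "((\<lambda>r. 4 * pi * (sin (r * ?k) - r * ?k * cos (r * ?k)) / ?k ^ 3) has_vector_derivative
          4 * pi * r\<^sup>2 * snc (r * ?k)) (at r within {0..R})"
        unfolding has_real_derivative_iff_has_vector_derivative[symmetric] e
        using k by (auto intro!: derivative_eq_intros simp: field_simps power2_eq_square power3_eq_cube)
    qed (use R in \<open>auto intro!: continuous_intros\<close>)
    with False show ?thesis by (simp add: ball_ft_def)
  qed
  finally show ?thesis .
qed

text \<open>The norm of a sum of two independent uniform points has density \<open>r / 2\<close> on
  \<open>[0, 2]\<close>; dividing by the area \<open>4 * pi * r\<^sup>2\<close> of the sphere gives
  \<open>1 / (8 * pi * r)\<close>.\<close>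

definition rho :: "real^3 \<Rightarrow> real" where
  "rho p = (if norm p < 2 then 1 / (8 * pi * norm p) else 0)"

lemma rho_measurable [measurable]: "rho \<in> borel_measurable borel"
  unfolding rho_def by measurable

lemma rho_nonneg: "0 \<le> rho p"
  by (simp add: rho_def)

text \<open>What ties \<open>rho\<close> to the sum of two independent uniform points is its
  transform, the square of the one in \<open>sigma2_fourier\<close>. Radially it is the integral of
  \<open>sin (r * k) / (2 * k)\<close> over \<open>[0, 2]\<close>, that is
  \<open>(1 - cos (2 * k)) / (2 * k\<^sup>2)\<close>.\<close>

lemma integrable_rho: "integrable lborel rho"
  and rho_fourier: "(LINT p|lborel. rho p *\<^sub>R cis (z \<bullet> p)) = complex_of_real ((snc (norm z))\<^sup>2)"
proof -
  let ?k = "norm z"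
  define g where "g r = (if r < 2 then 1 / (8 * pi * r) else 0)" for r :: real
  have [measurable]: "g \<in> borel_measurable borel" unfolding g_def by measurable
  have rho: "rho = (\<lambda>p. g (norm p))" by (auto simp: g_def rho_def)
  have e: "(LINT r|lborel. indicator {0<..} r * (4 * pi * r\<^sup>2 * g r * h r)) =
       (LINT r|lborel. indicator {0..2} r *\<^sub>R (r / 2 * h r))" if [measurable]: "h \<in> borel_measurable borel" for h
    by (intro integral_cong_AE, simp, simp)
       (use AE_lborel_singleton[of 2] in \<open>eventually_elim, auto simp: g_def indicator_def power2_eq_square\<close>)
  have "integrable lborel (\<lambda>r::real. indicator {0..2} r *\<^sub>R (r / 2))"
    by (rule borel_integrable_compact[of "{0..2}" "\<lambda>r::real. r / 2", unfolded real_scaleR_def[symmetric]])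
       (auto intro!: continuous_intros)
  then have "integrable lborel (\<lambda>r. indicator {0<..} r * (4 * pi * r\<^sup>2 * g r))"
    by (rule integrable_cong_AE_imp, simp)
       (use AE_lborel_singleton[of 2] in \<open>eventually_elim, auto simp: g_def indicator_def power2_eq_square\<close>)
  then show int: "integrable lborel rho"
    unfolding rho by (intro integrable_normI) auto
  have "(LINT p|lborel. rho p *\<^sub>R cis (z \<bullet> p)) =
      complex_of_real (LINT r|lborel. indicator {0<..} r * (4 * pi * r\<^sup>2 * g r * snc (r * ?k)))"
    using int unfolding rho by (intro radial_fourier) auto
  also have "(LINT r|lborel. indicator {0<..} r * (4 * pi * r\<^sup>2 * g r * snc (r * ?k))) =
      (LINT r|lborel. indicator {0..2} r *\<^sub>R (r / 2 * snc (r * ?k)))"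
    by (rule e) simp
  also have "\<dots> = (snc ?k)\<^sup>2"
  proof (cases "?k = 0")
    case True
    have "(LINT r|lborel. indicator {0..2} r *\<^sub>R (r / 2)) = 2\<^sup>2 / 4 - 0\<^sup>2 / (4::real)"
      by (intro has_bochner_integral_integral_eq has_bochner_integral_FTC_Icc)
       (auto intro!: derivative_eq_intros continuous_intros simp: has_real_derivative_iff_has_vector_derivative[symmetric])
    with True show ?thesis by simp
  next
    case False
    then have k: "?k > 0" by simp
    have "(LINT r|lborel. indicator {0..2} r *\<^sub>R (r / 2 * snc (r * ?k))) =
       - cos (2 * ?k) / (2 * ?k\<^sup>2) - (- cos (0 * ?k) / (2 * ?k\<^sup>2))"
    proof (intro has_bochner_integral_integral_eq has_bochner_integral_FTC_Icc)
      fix r :: real assume "0 \<le> r" "r \<le> 2"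
      have e: "r / 2 * snc (r * ?k) = sin (r * ?k) / (2 * ?k)"
        using k snc_mult[of "r * ?k"] by (simp add: field_simps)
      show "((\<lambda>r. - cos (r * ?k) / (2 * ?k\<^sup>2)) has_vector_derivative r / 2 * snc (r * ?k)) (at r within {0..2})"
        unfolding has_real_derivative_iff_has_vector_derivative[symmetric] e
        using k by (auto intro!: derivative_eq_intros simp: field_simps power2_eq_square)
    qed (auto intro!: continuous_intros)
    also have "\<dots> = (snc ?k)\<^sup>2"
    proof -
      have "cos (2 * ?k) = 1 - 2 * (sin ?k)\<^sup>2" by (rule cos_double_sin)
      then show ?thesis
        using k by (simp add: snc_def power_divide diff_divide_distrib)
    qed
    finally show ?thesis .
  qed
  finally show "(LINT p|lborel. rho p *\<^sub>R cis (z \<bullet> p)) = complex_of_real ((snc (norm z))\<^sup>2)" .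
qed

lemma cis_measurable [measurable]: "cis \<in> borel_measurable borel"
  by (intro borel_measurable_continuous_onI continuous_intros)

lemma ball_ft_measurable [measurable]: "ball_ft R \<in> borel_measurable borel"
  unfolding ball_ft_def [abs_def] by measurable

subsection \<open>The kernel as an integral against the density of the convolution square\<close>

text \<open>As a finite measure, the ball makes every bounded measurable integrand integrable, so
  that exchanging integrals of \<open>cis\<close> needs no estimates.\<close>

definition ball_measure :: "real \<Rightarrow> (real^3) measure" where
  "ball_measure R = density lborel (indicator (ball 0 R))"

lemma sets_ball_measure [simp, measurable_cong]: "sets (ball_measure R) = sets borel"
  and space_ball_measure [simp]: "space (ball_measure R) = UNIV"
  by (simp_all add: ball_measure_def)

lemma emeasure_ball_measure: "emeasure (ball_measure R) UNIV = emeasure lborel (ball (0::real^3) R)"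
  unfolding ball_measure_def
  by (subst emeasure_density) (auto intro!: borel_measurable_indicator)

lemma finite_ball_measure: "finite_measure (ball_measure R)"
  using emeasure_lborel_ball_finite[of "0::real^3" R]
  by (intro finite_measureI) (simp add: emeasure_ball_measure)

interpretation ball: finite_measure "ball_measure R" for R
  by (rule finite_ball_measure)

interpretation ball_pair: pair_sigma_finite "ball_measure R" "ball_measure R" for R
  by (intro pair_sigma_finite.intro ball.sigma_finite_measure_axioms)

lemma finite_ball_pair: "finite_measure (ball_measure R \<Otimes>\<^sub>M ball_measure R)"
  by (rule finite_measure_pair_measure) (rule finite_ball_measure)+

lemma integral_ball_measure:
  fixes f :: "real^3 \<Rightarrow> 'b::{banach, second_countable_topology}"
  assumes [measurable]: "f \<in> borel_measurable borel"
  shows "(LINT x|ball_measure R. f x) = (LINT x|lborel. indicator (ball 0 R) x *\<^sub>R f x)"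
proof -
  have "ball_measure R = density lborel (\<lambda>x. ennreal (indicator (ball 0 R) x))"
    by (simp add: ball_measure_def ennreal_indicator)
  then show ?thesis
    by (simp only:) (subst integral_density, auto intro!: borel_measurable_indicator)
qed

lemma Q_ball_cis: "Q_ball R \<xi> = (LINT x|ball_measure R. cis (\<xi> \<bullet> x))"
  unfolding Q_ball_def set_lebesgue_integral_def cis_conv_exp[symmetric]
  by (rule integral_ball_measure[symmetric]) measurable

lemma integrable_cis:
  assumes "finite_measure M" and [measurable]: "f \<in> borel_measurable M"
  shows "integrable M (\<lambda>x. cis (f x))"
  by (rule finite_measure.integrable_const_bound[OF assms(1), of _ 1]) auto

lemma Q_ball_mult:
  "Q_ball R \<xi> * Q_ball R \<eta> =
    (LINT z|(ball_measure R \<Otimes>\<^sub>M ball_measure R). cis (\<xi> \<bullet> fst z + \<eta> \<bullet> snd z))"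
proof -
  have "(LINT z|(ball_measure R \<Otimes>\<^sub>M ball_measure R). cis (\<xi> \<bullet> fst z + \<eta> \<bullet> snd z)) =
     (LINT x|ball_measure R. LINT y|ball_measure R. cis (\<xi> \<bullet> x + \<eta> \<bullet> y))"
    by (subst ball_pair.integral_fst'[symmetric]) (auto intro!: integrable_cis finite_ball_pair)
  also have "\<dots> = Q_ball R \<xi> * Q_ball R \<eta>"
    by (simp add: Q_ball_cis cis_mult[symmetric])
  finally show ?thesis ..
qed

text \<open>Fubini moves the average over \<open>P\<close> innermost, so that \<open>P\<close>
  enters only through its Fourier transform at \<open>fst z - snd z\<close>. Two measures with the
  same transform therefore give the same integral, and a known transform turns an integral over
  frequencies into one over pairs of points of the ball.\<close>

lemma integral_Q_ball_mult:
  fixes m :: "'a \<Rightarrow> real^3"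
  assumes P: "finite_measure P" and [measurable]: "m \<in> borel_measurable P"
  shows "(LINT s|P. Q_ball R (a + m s) * Q_ball R (b - m s)) =
    (LINT z|(ball_measure R \<Otimes>\<^sub>M ball_measure R). cis (a \<bullet> fst z + b \<bullet> snd z) * (LINT s|P. cis ((fst z - snd z) \<bullet> m s)))"
proof -
  let ?N = "ball_measure R \<Otimes>\<^sub>M ball_measure R"
  interpret P: finite_measure P by (rule P)
  interpret N: finite_measure ?N by (rule finite_ball_pair)
  interpret PN: pair_sigma_finite P ?N ..
  have fin: "finite_measure (P \<Otimes>\<^sub>M ?N)"
    by (intro finite_measure_pair_measure P finite_ball_pair)
  have "(LINT s|P. Q_ball R (a + m s) * Q_ball R (b - m s)) =
     (LINT s|P. LINT z|?N. cis ((a + m s) \<bullet> fst z + (b - m s) \<bullet> snd z))"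
    by (simp add: Q_ball_mult)
  also have "\<dots> = (LINT z|?N. LINT s|P. cis ((a + m s) \<bullet> fst z + (b - m s) \<bullet> snd z))"
    by (rule PN.Fubini_integral[symmetric])
       (use integrable_cis[OF fin, of "\<lambda>(s, z). (a + m s) \<bullet> fst z + (b - m s) \<bullet> snd z"] in \<open>simp add: case_prod_unfold\<close>)
  also have "\<dots> = (LINT z|?N. cis (a \<bullet> fst z + b \<bullet> snd z) * (LINT s|P. cis ((fst z - snd z) \<bullet> m s)))"
  proof (intro Bochner_Integration.integral_cong refl)
    fix z
    have "(a + m s) \<bullet> fst z + (b - m s) \<bullet> snd z = (a \<bullet> fst z + b \<bullet> snd z) + (fst z - snd z) \<bullet> m s" for s
      by (simp add: inner_simps inner_commute)
    then show "(LINT s|P. cis ((a + m s) \<bullet> fst z + (b - m s) \<bullet> snd z)) =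
        cis (a \<bullet> fst z + b \<bullet> snd z) * (LINT s|P. cis ((fst z - snd z) \<bullet> m s))"
      by (simp add: cis_mult[symmetric])
  qed
  finally show ?thesis .
qed

interpretation sigma2_pair: pair_prob_space sigma2 sigma2 ..

lemma Q_ball_measurable:
  assumes "R > 0"
  shows "Q_ball R \<in> borel_measurable borel"
proof -
  have "Q_ball R = (\<lambda>\<xi>. complex_of_real (ball_ft R (norm \<xi>)))"
    using Q_ball_eq[OF assms] by (intro ext)
  then show ?thesis by simp
qed

lemma norm_Q_ball_le: "norm (Q_ball R \<xi>) \<le> measure lborel (ball (0::real^3) R)"
proof -
  have "norm (Q_ball R \<xi>) \<le> (LINT x|ball_measure R. norm (cis (\<xi> \<bullet> x)))"
    unfolding Q_ball_cis by (rule integral_norm_bound)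
  also have "\<dots> = measure lborel (ball (0::real^3) R)"
    using emeasure_ball_measure[of R] by (simp add: measure_def)
  finally show ?thesis .
qed

text \<open>The sum of the coordinates under \<open>sigma2 \<Otimes>\<^sub>M sigma2\<close> and the
  density \<open>rho\<close> have the same transform \<open>(snc (norm y))\<^sup>2\<close>, so
  \<open>integral_Q_ball_mult\<close>, applied forwards and then backwards, exchanges one for the
  other.\<close>

lemma K_ball_eq_rho:
  assumes R: "R > 0"
  shows "K_ball R a b = (LINT p|lborel. rho p *\<^sub>R (Q_ball R (a + p) * Q_ball R (b - p)))"
proof -
  let ?S = "sigma2 \<Otimes>\<^sub>M sigma2"
  let ?N = "ball_measure R \<Otimes>\<^sub>M ball_measure R"
  let ?D = "density lborel (\<lambda>p. ennreal (rho p))"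
  note [measurable] = Q_ball_measurable[OF R]
    measurable_compose[OF measurable_fst id_measurable_sigma2] measurable_compose[OF measurable_snd id_measurable_sigma2]
  have finS: "finite_measure ?S" by unfold_locales
  have finD: "finite_measure ?D"
    using integrable_rho by (intro finite_measureI)
      (auto simp: emeasure_density integrable_iff_bounded rho_nonneg)
  have "K_ball R a b = (LINT s|?S. Q_ball R (a + (fst s + snd s)) * Q_ball R (b - (fst s + snd s)))"
  proof -
    have "integrable ?S (\<lambda>s. Q_ball R (a + (fst s + snd s)) * Q_ball R (b - (fst s + snd s)))"
      by (rule finite_measure.integrable_const_bound[OF finS,
            of _ "measure lborel (ball (0::real^3) R) * measure lborel (ball (0::real^3) R)"])
         (auto simp: norm_mult intro!: AE_I2 mult_mono norm_Q_ball_le)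
    then show ?thesis
      unfolding K_ball_def
      by (subst sigma2_pair.integral_fst'[symmetric]) (simp_all add: add.assoc diff_diff_eq)
  qed
  also have "\<dots> = (LINT z|?N. cis (a \<bullet> fst z + b \<bullet> snd z) * (LINT s|?S. cis ((fst z - snd z) \<bullet> (fst s + snd s))))"
    by (rule integral_Q_ball_mult[OF finS]) measurable
  also have "\<dots> = (LINT z|?N. cis (a \<bullet> fst z + b \<bullet> snd z) * (LINT p|?D. cis ((fst z - snd z) \<bullet> p)))"
  proof (intro Bochner_Integration.integral_cong refl arg_cong2[where f="(*)"])
    fix z :: "(real^3) \<times> (real^3)"
    define y where "y = fst z - snd z"
    have "(LINT s|?S. cis (y \<bullet> (fst s + snd s))) = (LINT s|sigma2. LINT t|sigma2. cis (y \<bullet> (s + t)))"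
      by (subst sigma2_pair.integral_fst'[symmetric]) (auto intro!: integrable_cis finS)
    also have "\<dots> = complex_of_real ((snc (norm y))\<^sup>2)"
      by (simp add: inner_add_right cis_mult[symmetric] sigma2_fourier power2_eq_square)
    also have "\<dots> = (LINT p|?D. cis (y \<bullet> p))"
      by (subst integral_density) (auto simp: rho_fourier rho_nonneg)
    finally show "(LINT s|?S. cis ((fst z - snd z) \<bullet> (fst s + snd s))) = (LINT p|?D. cis ((fst z - snd z) \<bullet> p))"
      by (simp add: y_def)
  qed
  also have "\<dots> = (LINT p|?D. Q_ball R (a + p) * Q_ball R (b - p))"
    by (rule integral_Q_ball_mult[OF finD, symmetric]) simp
  also have "\<dots> = (LINT p|lborel. rho p *\<^sub>R (Q_ball R (a + p) * Q_ball R (b - p)))"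
    by (subst integral_density) (auto simp: rho_nonneg)
  finally show ?thesis .
qed

lemma integral_lborel_translate:
  fixes f :: "'a::euclidean_space \<Rightarrow> 'b::{banach, second_countable_topology}"
  assumes [measurable]: "f \<in> borel_measurable borel"
  shows "(LINT x|lborel. f (c + x)) = (LINT x|lborel. f x)"
  by (subst (2) lborel_distr_plus[of c, symmetric], subst integral_distr) auto

text \<open>The shift \<open>q = a + p\<close> puts the peaks of the two transforms at 0 and at
  \<open>a + b\<close>, which makes their product a convolution integrand, and leaves the
  singularity of \<open>rho\<close> at \<open>a\<close>.\<close>

definition K_real :: "real \<Rightarrow> real^3 \<Rightarrow> real^3 \<Rightarrow> real" where
  "K_real R a b = (LINT q|lborel. rho (q - a) * (ball_ft R (norm q) * ball_ft R (norm (a + b - q))))"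

lemma K_ball_eq:
  assumes R: "R > 0"
  shows "K_ball R a b = complex_of_real (K_real R a b)"
proof -
  have "K_ball R a b = (LINT p|lborel. complex_of_real (rho p * (ball_ft R (norm (a + p)) * ball_ft R (norm (b - p)))))"
    unfolding K_ball_eq_rho[OF R] Q_ball_eq[OF R] by (simp add: scaleR_conv_of_real)
  also have "\<dots> = complex_of_real (LINT p|lborel. rho p * (ball_ft R (norm (a + p)) * ball_ft R (norm (b - p))))"
    by (rule integral_complex_of_real)
  also have "(LINT p|lborel. rho p * (ball_ft R (norm (a + p)) * ball_ft R (norm (b - p)))) =
      (LINT p|lborel. rho ((a + p) - a) * (ball_ft R (norm (a + p)) * ball_ft R (norm (a + b - (a + p)))))"
    by simp
  also have "\<dots> = K_real R a b"
    unfolding K_real_def by (rule integral_lborel_translate) measurable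
  finally show ?thesis .
qed

text \<open>The transform of a finite measure is bounded by its mass; an auxiliary vector of length
  \<open>k\<close> carries this bound from \<open>Q_ball\<close> to the radial profile.\<close>

lemma abs_ball_ft_le_ball:
  assumes "R > 0" "k \<ge> 0"
  shows "\<bar>ball_ft R k\<bar> \<le> 4 / 3 * pi * R ^ 3"
proof -
  define \<xi> where "\<xi> = k *\<^sub>R (axis 1 1 :: real^3)"
  have "norm \<xi> = k" using assms by (simp add: \<xi>_def)
  then have "\<bar>ball_ft R k\<bar> = norm (Q_ball R \<xi>)"
    using Q_ball_eq[OF assms(1), of \<xi>] by simp
  also have "\<dots> \<le> measure lborel (ball (0::real^3) R)" by (rule norm_Q_ball_le)
  also have "\<dots> = 4 / 3 * pi * R ^ 3"
    using assms by (simp add: measure_def emeasure_ball unit_ball_vol_3)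
  finally show ?thesis .
qed

lemma abs_ball_ft_le:
  assumes "R > 0" "k > 0"
  shows "\<bar>ball_ft R k\<bar> \<le> 8 * pi * R / k\<^sup>2"
proof -
  have "\<bar>sin (R * k) - R * k * cos (R * k)\<bar> \<le> \<bar>sin (R * k)\<bar> + \<bar>R * k * cos (R * k)\<bar>"
    by (rule abs_triangle_ineq4)
  also have "\<dots> \<le> R * k + R * k * 1"
    using assms abs_sin_x_le_abs_x[of "R * k"] by (intro add_mono) (auto simp: abs_mult intro!: mult_left_le)
  finally have "4 * pi * \<bar>sin (R * k) - R * k * cos (R * k)\<bar> / k ^ 3 \<le> 4 * pi * (2 * (R * k)) / k ^ 3"
    using assms by (intro divide_right_mono mult_left_mono) auto
  also have "\<dots> = 8 * pi * R / k\<^sup>2"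
    using assms by (simp add: power2_eq_square power3_eq_cube)
  finally show ?thesis using assms by (simp add: ball_ft_def abs_mult)
qed

subsection \<open>The self-convolution of the transform of a ball\<close>

lemma set_integrable_lborelI:
  fixes f :: "real \<Rightarrow> real"
  assumes [measurable]: "f \<in> borel_measurable borel" "S \<in> sets borel"
    and "f integrable_on S" and "\<And>x. x \<in> S \<Longrightarrow> 0 \<le> f x"
  shows "set_integrable lborel S f"
proof -
  have "f absolutely_integrable_on S"
    using assms(3,4) by (rule nonnegative_absolutely_integrable_1)
  then show ?thesis
    unfolding set_integrable_def by (subst (asm) integrable_completion) auto
qed

text \<open>The two powers make \<open>decay\<close> radially integrable on \<open>\<real>\<^sup>3\<close> both at the origin and at infinity.\<close>

definition decay :: "real \<Rightarrow> real" where
  "decay x = (if x \<le> 1 then 1 / (x\<^sup>2 * sqrt x) else 1 / x ^ 4)"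

lemma decay_measurable [measurable]: "decay \<in> borel_measurable borel"
  unfolding decay_def [abs_def] by measurable

lemma decay_nonneg: "0 \<le> x \<Longrightarrow> 0 \<le> decay x"
  by (simp add: decay_def)

lemma integrable_decay: "integrable lborel (\<lambda>p::real^3. decay (norm p))"
proof (rule integrable_normI)
  have "set_integrable lborel {0..1} (\<lambda>r::real. r powr (- 1 / 2))"
    by (rule set_integrable_lborelI) (auto intro!: integrable_on_powr_from_0)
  then have 1: "integrable lborel (\<lambda>r::real. indicator {0..1} r * r powr (- 1 / 2))"
    by (simp add: set_integrable_def)
  have "set_integrable lborel {1..} (\<lambda>r::real. r powr (- 2))"
    using has_integral_powr_to_inf[of "- 2" 1] by (intro set_integrable_lborelI) (auto simp: integrable_on_def)
  then have 2: "integrable lborel (\<lambda>r::real. indicator {1..} r * r powr (- 2))"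
    by (simp add: set_integrable_def)
  have "integrable lborel (\<lambda>r::real. 4 * pi * (indicator {0..1} r * r powr (- 1 / 2) + indicator {1..} r * r powr (- 2)))"
    by (rule integrable_mult_right, rule Bochner_Integration.integrable_add, rule 1, rule 2)
  then show "integrable lborel (\<lambda>r. indicator {0<..} r * (4 * pi * r\<^sup>2 * decay r))"
  proof (rule integrable_cong_AE_imp)
    show "AE r in lborel. 4 * pi * (indicator {0..1} r * r powr (- 1 / 2) + indicator {1..} r * r powr (- 2)) =
       indicator {0<..} r * (4 * pi * r\<^sup>2 * decay r)"
      using AE_lborel_singleton[of 0] AE_lborel_singleton[of 1]
    proof eventually_elim
      case (elim r)
      consider "r < 0" | "0 < r" "r < 1" | "1 < r" using elim by linarith
      then show ?case
      proof cases
        case 2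
        then have "r powr (- 1 / 2) = 1 / sqrt r"
        proof -
          have "r powr (- (1 / 2)) = inverse (r powr (1 / 2))" by (rule powr_minus)
          also have "r powr (1 / 2) = sqrt r" using 2 by (intro powr_half_sqrt) simp
          finally show ?thesis by (simp add: inverse_eq_divide)
        qed
        with 2 show ?thesis by (simp add: decay_def)
      next
        case 3
        then have "r powr (- 2) = 1 / r\<^sup>2"
        proof -
          have "r powr (- 2) = inverse (r powr 2)" by (rule powr_minus)
          also have "r powr 2 = r\<^sup>2" using 3 powr_realpow[of r 2] by simp
          finally show ?thesis by (simp add: inverse_eq_divide)
        qed
        moreover have "4 * pi * r\<^sup>2 / r ^ 4 = 4 * pi / r\<^sup>2"
          using 3 by (simp add: power2_eq_square power4_eq_xxxx)
        ultimately show ?thesis using 3 by (simp add: decay_def)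
      qed simp
    qed
  qed simp
qed simp

lemma decay_ge_1: "0 < x \<Longrightarrow> x \<le> 1 \<Longrightarrow> 1 \<le> decay x"
  by (simp add: decay_def power_le_one mult_le_one le_divide_eq)

lemma integrable_translate:
  fixes f :: "'a::euclidean_space \<Rightarrow> 'b::{banach, second_countable_topology}"
  assumes "integrable lborel f"
  shows "integrable lborel (\<lambda>x. f (c + x))" "integrable lborel (\<lambda>x. f (x - c))"
proof -
  have *: "integrable lborel (\<lambda>x. f (c + x))" for c
    using assms by (subst (asm) lborel_distr_plus[of c, symmetric], subst (asm) integrable_distr_eq) auto
  from *[of c] *[of "- c"] show "integrable lborel (\<lambda>x. f (c + x))" "integrable lborel (\<lambda>x. f (x - c))"
    by simp_all
qed

lemma ball_ft_square_le_decay: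
  assumes R: "R > 0"
  obtains C where "\<And>k. k > 0 \<Longrightarrow> (ball_ft R k)\<^sup>2 \<le> C * decay k"
proof
  define C1 where "C1 = 4 / 3 * pi * R ^ 3"
  define C2 where "C2 = 8 * pi * R"
  fix k :: real assume k: "k > 0"
  show "(ball_ft R k)\<^sup>2 \<le> (C1\<^sup>2 + C2\<^sup>2) * decay k"
  proof (cases "k \<le> 1")
    case True
    have "(ball_ft R k)\<^sup>2 \<le> C1\<^sup>2"
      using abs_ball_ft_le_ball[OF R, of k] k R by (intro abs_le_square_iff[THEN iffD1]) (simp add: C1_def)
    also have "\<dots> \<le> (C1\<^sup>2 + C2\<^sup>2) * 1" by simp
    also have "\<dots> \<le> (C1\<^sup>2 + C2\<^sup>2) * decay k"
      using decay_ge_1[OF k True] by (intro mult_left_mono) auto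
    finally show ?thesis .
  next
    case False
    have "(ball_ft R k)\<^sup>2 \<le> (C2 / k\<^sup>2)\<^sup>2"
      using abs_ball_ft_le[OF R k] R by (intro abs_le_square_iff[THEN iffD1]) (simp add: C2_def)
    also have "\<dots> = C2\<^sup>2 * decay k"
      using False by (simp add: decay_def power_divide flip: power_mult)
    also have "\<dots> \<le> (C1\<^sup>2 + C2\<^sup>2) * decay k"
      using k by (intro mult_right_mono decay_nonneg) auto
    finally show ?thesis .
  qed
qed

lemma integrable_ball_ft_square:
  assumes R: "R > 0"
  shows "integrable lborel (\<lambda>q::real^3. (ball_ft R (norm q))\<^sup>2)"
proof -
  obtain C where C: "\<And>k. k > 0 \<Longrightarrow> (ball_ft R k)\<^sup>2 \<le> C * decay k"
    using ball_ft_square_le_decay[OF R] by blast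
  show ?thesis
  proof (rule Bochner_Integration.integrable_bound)
    show "integrable lborel (\<lambda>q::real^3. C * decay (norm q))"
      using integrable_decay by simp
    show "AE q::real^3 in lborel. norm ((ball_ft R (norm q))\<^sup>2) \<le> norm (C * decay (norm q))"
      using AE_lborel_singleton[of 0]
    proof eventually_elim
      case (elim q)
      then show ?case
        using C[of "norm q"] abs_ge_self[of "C * decay (norm q)"] by simp
    qed
  qed simp
qed

lemma integrable_reflect:
  fixes g :: "real \<Rightarrow> real"
  assumes "integrable lborel (\<lambda>q::real^3. g (norm q))"
  shows "integrable lborel (\<lambda>q::real^3. g (norm (\<xi> - q)))"
  using integrable_translate(2)[OF assms, of \<xi>] by (simp add: norm_minus_commute)

lemma integrable_ball_ft_mult:
  assumes R: "R > 0"
  shows "integrable lborel (\<lambda>q::real^3. ball_ft R (norm q) * ball_ft R (norm (\<xi> - q)))"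
proof (rule Bochner_Integration.integrable_bound)
  show "integrable lborel (\<lambda>q::real^3. (ball_ft R (norm q))\<^sup>2 + (ball_ft R (norm (\<xi> - q)))\<^sup>2)"
    by (intro Bochner_Integration.integrable_add integrable_ball_ft_square[OF R]
        integrable_reflect[of "\<lambda>k. (ball_ft R k)\<^sup>2"])
  have "\<bar>x * y\<bar> \<le> x\<^sup>2 + y\<^sup>2" for x y :: real
  proof -
    have "2 * \<bar>x * y\<bar> \<le> x\<^sup>2 + y\<^sup>2"
      using sum_squares_bound[of "\<bar>x\<bar>" "\<bar>y\<bar>"] by (simp add: abs_mult)
    then show ?thesis using abs_ge_zero[of "x * y"] by linarith
  qed
  then show "AE q::real^3 in lborel. norm (ball_ft R (norm q) * ball_ft R (norm (\<xi> - q))) \<le>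
      norm ((ball_ft R (norm q))\<^sup>2 + (ball_ft R (norm (\<xi> - q)))\<^sup>2)"
    by (intro AE_I2) simp
qed simp

section \<open>Exponential damping and the resulting approximate identity\<close>

definition poisson3 :: "real \<Rightarrow> real \<Rightarrow> real" where
  "poisson3 e s = 8 * pi * e / (e\<^sup>2 + s\<^sup>2)\<^sup>2"

lemma poisson3_measurable [measurable]: "poisson3 e \<in> borel_measurable borel"
  unfolding poisson3_def [abs_def] by measurable

lemma integrable_exp_norm:
  assumes e: "e > 0"
  shows "integrable lborel (\<lambda>p::real^3. exp (- e * norm p))"
    and "(LINT r|lborel. indicator {0<..} r * (4 * pi * r\<^sup>2 * exp (- e * r))) = poisson3 e 0"
proof -
  define F where "F r = - 4 * pi * exp (- e * r) * (r\<^sup>2 / e + 2 * r / e\<^sup>2 + 2 / e ^ 3)" for r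
  have nn: "(\<integral>\<^sup>+r. ennreal (4 * pi * r\<^sup>2 * exp (- e * r)) * indicator {0..} r \<partial>lborel) = ennreal (0 - F 0)"
  proof (rule nn_integral_FTC_atLeast)
    fix r :: real
    have "(F has_real_derivative - 4 * pi * ((- e) * exp (- e * r) * (r\<^sup>2 / e + 2 * r / e\<^sup>2 + 2 / e ^ 3)
        + exp (- e * r) * (2 * r / e + 2 / e\<^sup>2))) (at r)"
      unfolding F_def [abs_def] by (rule derivative_eq_intros refl | simp add: less_imp_neq[OF e, symmetric])+
        (use e in \<open>simp add: field_simps power2_eq_square power3_eq_cube power4_eq_xxxx\<close>)
    also have "- 4 * pi * ((- e) * exp (- e * r) * (r\<^sup>2 / e + 2 * r / e\<^sup>2 + 2 / e ^ 3)
        + exp (- e * r) * (2 * r / e + 2 / e\<^sup>2)) = 4 * pi * r\<^sup>2 * exp (- e * r)"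
      using e by (simp add: field_simps power2_eq_square power3_eq_cube)
    finally show "DERIV F r :> 4 * pi * r\<^sup>2 * exp (- e * r)" .
    show "(F \<longlongrightarrow> 0) at_top"
      unfolding F_def [abs_def] using e by real_asymp
  qed auto
  have eq: "(\<integral>\<^sup>+r. ennreal (indicator {0<..} r * (4 * pi * r\<^sup>2 * exp (- e * r))) \<partial>lborel) = ennreal (poisson3 e 0)"
  proof -
    have "(\<integral>\<^sup>+r. ennreal (indicator {0<..} r * (4 * pi * r\<^sup>2 * exp (- e * r))) \<partial>lborel) =
        (\<integral>\<^sup>+r. ennreal (4 * pi * r\<^sup>2 * exp (- e * r)) * indicator {0..} r \<partial>lborel)"
      by (intro nn_integral_cong) (auto simp: indicator_def)
    also note nn
    also have "0 - F 0 = poisson3 e 0"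
      using e by (simp add: F_def poisson3_def power2_eq_square power3_eq_cube)
    finally show ?thesis .
  qed
  have hb: "has_bochner_integral lborel (\<lambda>r. indicator {0<..} r * (4 * pi * r\<^sup>2 * exp (- e * r))) (poisson3 e 0)"
    using e by (intro has_bochner_integral_nn_integral eq) (auto simp: poisson3_def)
  then show "(LINT r|lborel. indicator {0<..} r * (4 * pi * r\<^sup>2 * exp (- e * r))) = poisson3 e 0"
    by (rule has_bochner_integral_integral_eq)
  show "integrable lborel (\<lambda>p::real^3. exp (- e * norm p))"
    using hb by (intro integrable_normI[of "\<lambda>r. exp (- e * r)"]) (auto simp: has_bochner_integral_iff)
qed

text \<open>Up to normalisation, \<open>poisson3\<close> is the Poisson kernel of the half space over \<open>\<real>\<^sup>3\<close>.
  It serves as an explicit approximate identity in place of a Plancherel theorem.\<close>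

lemma exp_norm_fourier:
  fixes z :: "real^3"
  assumes e: "e > 0"
  shows "(LINT p|lborel. exp (- e * norm p) *\<^sub>R cis (z \<bullet> p)) = complex_of_real (poisson3 e (norm z))"
proof -
  define s where "s = norm z"
  define f where "f r = indicator {0<..} r * (4 * pi * r\<^sup>2 * exp (- e * r) * snc (r * s))" for r
  have "(LINT p|lborel. exp (- e * norm p) *\<^sub>R cis (z \<bullet> p)) = complex_of_real (LINT r|lborel. f r)"
    unfolding f_def s_def by (rule radial_fourier[OF _ integrable_exp_norm(1)[OF e]]) simp
  also have "(LINT r|lborel. f r) = poisson3 e s"
  proof (cases "s = 0")
    case True
    then show ?thesis using integrable_exp_norm(2)[OF e] by (simp add: f_def)
  next
    case False
    then have s: "s > 0" by (simp add: s_def)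
    define D where "D = e\<^sup>2 + s\<^sup>2"
    have D: "D > 0" using s by (simp add: D_def add_nonneg_pos)
    define c where "c = 1 / D"
    define K where "K = - (4 * pi / s)"
    have c: "c > 0" using D by (simp add: c_def)
    \<comment> \<open>With \<open>\<lambda> = e - i s\<close>, a primitive of
      \<open>r exp (- \<lambda> r)\<close> is
      \<open>- exp (- \<lambda> r) (r / \<lambda> + 1 / \<lambda>^2)\<close>, and
      \<open>1 / \<lambda> = (e + i s) / D\<close>. The imaginary part, with the decaying factor and
      the sign taken out, is \<open>P\<close>.\<close>
    define P where "P r = r * (e * sin (r * s) + s * cos (r * s)) * c +
        ((e\<^sup>2 - s\<^sup>2) * sin (r * s) + 2 * e * s * cos (r * s)) * c\<^sup>2" for r
    define F where "F r = K * exp (- e * r) * P r" for r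
    have int: "integrable lborel f"
    proof (rule Bochner_Integration.integrable_bound)
      \<comment> \<open>The integral of a non-integrable function is 0 by convention, so a nonzero
        value certifies integrability.\<close>
      have "poisson3 e 0 \<noteq> 0" using e by (simp add: poisson3_def)
      then show "integrable lborel (\<lambda>r. indicator {0<..} r * (4 * pi * r\<^sup>2 * exp (- e * r)))"
        using integrable_exp_norm(2)[OF e] not_integrable_integral_eq by metis
      show "AE r in lborel. norm (f r) \<le> norm (indicator {0<..} r * (4 * pi * r\<^sup>2 * exp (- e * r)))"
        using abs_snc_le by (intro AE_I2) (auto simp: f_def abs_mult indicator_def intro!: mult_left_le)
    qed (simp add: f_def [abs_def])
    have "((\<lambda>y. LINT r|lborel. indicator {..y} r *\<^sub>R f r) \<longlongrightarrow> (LINT r|lborel. f r)) at_top"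
      using int by (intro tendsto_integral_at_top) auto
    moreover have "eventually (\<lambda>y. (LINT r|lborel. indicator {..y} r *\<^sub>R f r) = F y - F 0) at_top"
      using eventually_ge_at_top[of 0]
    proof eventually_elim
      case (elim y)
      have "(LINT r|lborel. indicator {..y} r *\<^sub>R f r) =
          (LINT r|lborel. indicator {0..y} r *\<^sub>R (4 * pi * r\<^sup>2 * exp (- e * r) * snc (r * s)))"
        by (intro Bochner_Integration.integral_cong) (auto simp: f_def indicator_def)
      also have "\<dots> = F y - F 0"
      proof (intro has_bochner_integral_integral_eq has_bochner_integral_FTC_Icc elim)
        fix r assume "0 \<le> r" "r \<le> y"
        have "4 * pi * r\<^sup>2 * exp (- e * r) * snc (r * s) = 4 * pi / s * exp (- e * r) * r * (r * s * snc (r * s))"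
          using s by (simp add: power2_eq_square)
        then have eq: "4 * pi * r\<^sup>2 * exp (- e * r) * snc (r * s) = 4 * pi / s * exp (- e * r) * r * sin (r * s)"
          by (simp only: snc_mult)
        define S where "S = sin (r * s)"
        define C where "C = cos (r * s)"
        define A where "A = r * (e * S + s * C) * c + ((e\<^sup>2 - s\<^sup>2) * S + 2 * e * s * C) * c\<^sup>2"
        define B where "B = (e * S + s * C + r * (e * s * C - s * s * S)) * c +
          ((e\<^sup>2 - s\<^sup>2) * s * C - 2 * e * s * s * S) * c\<^sup>2"
        have P: "(P has_real_derivative B) (at r within {0..y})"
          unfolding P_def [abs_def] B_def S_def C_def
          by (auto intro!: derivative_eq_intros simp: algebra_simps)
        have "P r = A" by (simp add: P_def A_def S_def C_def)
        have E: "((\<lambda>r. K * exp (- e * r)) has_real_derivative K * ((- e) * exp (- e * r))) (at r within {0..y})"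
          by (auto intro!: derivative_eq_intros)
        have "(F has_real_derivative K * ((- e) * exp (- e * r)) * P r + B * (K * exp (- e * r))) (at r within {0..y})"
          unfolding F_def [abs_def] by (rule DERIV_mult[OF E P])
        also have "K * ((- e) * exp (- e * r)) * P r + B * (K * exp (- e * r)) = K * exp (- e * r) * (B - e * A)"
          unfolding \<open>P r = A\<close> by (simp add: algebra_simps)
        finally have "(F has_real_derivative K * exp (- e * r) * (B - e * A)) (at r within {0..y})" .
        moreover have "B - e * A = - r * S"
        proof -
          have eq: "D\<^sup>2 * (B - e * A) = D\<^sup>2 * (- r * S)"
          proof -
            have d: "D\<^sup>2 * (x * c) = D * x" "D\<^sup>2 * (x * c\<^sup>2) = x" for x
              using D by (simp_all add: c_def power2_eq_square)
            have "D\<^sup>2 * (B - e * A) = D * (e * S + s * C + r * (e * s * C - s * s * S)) + ((e\<^sup>2 - s\<^sup>2) * s * C - 2 * e * s * s * S)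
              - e * (D * (r * (e * S + s * C)) + ((e\<^sup>2 - s\<^sup>2) * S + 2 * e * s * C))"
              unfolding A_def B_def by (simp only: right_diff_distrib distrib_left mult.left_commute[of "D\<^sup>2" e] d)
            also have "\<dots> = D\<^sup>2 * (- r * S)"
              unfolding D_def by (simp add: algebra_simps power2_eq_square)
            finally show ?thesis .
          qed
          show ?thesis
            using mult_cancel_left[THEN iffD1, OF eq] D by auto
        qed
        ultimately show "(F has_vector_derivative 4 * pi * r\<^sup>2 * exp (- e * r) * snc (r * s)) (at r within {0..y})"
          unfolding eq by (simp add: has_real_derivative_iff_has_vector_derivative[symmetric] S_def K_def mult.assoc)
      qed (auto intro!: continuous_intros)
      finally show ?case .
    qed
    ultimately have "((\<lambda>y. F y - F 0) \<longlongrightarrow> (LINT r|lborel. f r)) at_top"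
      using filterlim_cong[OF refl refl] by fast
    moreover have "((\<lambda>y. F y - F 0) \<longlongrightarrow> 0 - F 0) at_top"
    proof -
      have "(F \<longlongrightarrow> 0) at_top"
      proof (rule Lim_null_comparison)
        define m where "m = (e + s) * c"
        define n where "n = (\<bar>e\<^sup>2 - s\<^sup>2\<bar> + 2 * e * s) * c\<^sup>2"
        have "((\<lambda>r. exp (- e * r)) \<longlongrightarrow> 0) at_top" "((\<lambda>r. exp (- e * r) * r) \<longlongrightarrow> 0) at_top"
          using e by real_asymp+
        then have "((\<lambda>r. \<bar>K\<bar> * (exp (- e * r) * r * m + exp (- e * r) * n)) \<longlongrightarrow> \<bar>K\<bar> * (0 * m + 0 * n)) at_top"
          by (intro tendsto_intros)
        then show "((\<lambda>r. \<bar>K\<bar> * (exp (- e * r) * (r * m + n))) \<longlongrightarrow> 0) at_top"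
          by (simp add: algebra_simps)
        show "eventually (\<lambda>r. norm (F r) \<le> \<bar>K\<bar> * (exp (- e * r) * (r * m + n))) at_top"
          using eventually_ge_at_top[of 0]
        proof eventually_elim
          case (elim r)
          have "\<bar>e * sin (r * s) + s * cos (r * s)\<bar> \<le> e * 1 + s * 1"
            using e s by (intro order_trans[OF abs_triangle_ineq] add_mono) (auto simp: abs_mult)
          then have 1: "\<bar>r * (e * sin (r * s) + s * cos (r * s)) * c\<bar> \<le> r * m"
            using elim c unfolding abs_mult m_def mult.assoc by (intro mult_mono) auto
          have "\<bar>(e\<^sup>2 - s\<^sup>2) * sin (r * s) + 2 * e * s * cos (r * s)\<bar> \<le> \<bar>e\<^sup>2 - s\<^sup>2\<bar> * 1 + 2 * e * s * 1"
            using e s by (intro order_trans[OF abs_triangle_ineq] add_mono) (auto simp: abs_mult intro!: mult_left_le)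
          then have 2: "\<bar>((e\<^sup>2 - s\<^sup>2) * sin (r * s) + 2 * e * s * cos (r * s)) * c\<^sup>2\<bar> \<le> n"
            by (auto simp: abs_mult n_def intro!: mult_right_mono)
          have "\<bar>P r\<bar> \<le> r * m + n"
            unfolding P_def by (intro order_trans[OF abs_triangle_ineq] add_mono 1 2)
          then show ?case
            by (auto simp: F_def abs_mult mult.assoc intro!: mult_left_mono)
        qed
      qed
      then show ?thesis by (intro tendsto_intros)
    qed
    ultimately have "(LINT r|lborel. f r) = 0 - F 0"
      using tendsto_unique trivial_limit_at_top_linorder by blast
    also have "\<dots> = poisson3 e s"
    proof -
      have "P 0 = 2 * e * s * c\<^sup>2" by (simp add: P_def)
      then have "0 - F 0 = 8 * pi * e * c\<^sup>2" using s by (simp add: F_def K_def)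
      also have "c\<^sup>2 = 1 / D\<^sup>2" by (simp add: c_def power_divide)
      finally show ?thesis by (simp add: poisson3_def D_def)
    qed
    finally show ?thesis .
  qed
  finally show ?thesis by (simp add: s_def)
qed

text \<open>The mass \<open>(2 pi)^3\<close> is the constant of Fourier inversion; it becomes the
  factor in the self-convolution of the transform of the ball.\<close>

lemma poisson3_total: "integrable lborel (\<lambda>p::real^3. poisson3 1 (norm p))"
  "(LINT p|lborel. poisson3 1 (norm (p::real^3))) = 8 * pi ^ 3"
proof -
  define F where "F r = 16 * pi\<^sup>2 * (arctan r - r / (1 + r\<^sup>2))" for r
  have nn: "(\<integral>\<^sup>+r. ennreal (4 * pi * r\<^sup>2 * poisson3 1 r) * indicator {0..} r \<partial>lborel) = ennreal (8 * pi ^ 3 - F 0)"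
  proof (rule nn_integral_FTC_atLeast)
    fix r :: real
    have p: "1 + r\<^sup>2 > 0" by (simp add: add_pos_nonneg)
    have "(F has_real_derivative 16 * pi\<^sup>2 * (1 / (1 + r\<^sup>2) - (1 * (1 + r\<^sup>2) - r * (2 * r)) / (1 + r\<^sup>2)\<^sup>2)) (at r)"
      unfolding F_def [abs_def] using p
      by (auto intro!: derivative_eq_intros simp: inverse_eq_divide power2_eq_square)
    also have "1 / (1 + r\<^sup>2) - (1 * (1 + r\<^sup>2) - r * (2 * r)) / (1 + r\<^sup>2)\<^sup>2 = 2 * r\<^sup>2 / (1 + r\<^sup>2)\<^sup>2"
    proof -
      have "1 / d - x / d\<^sup>2 = (d - x) / d\<^sup>2" if "d > 0" for d x :: real
        using that by (simp add: power2_eq_square diff_divide_distrib)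
      from this[OF p] show ?thesis by (simp add: power2_eq_square)
    qed
    finally show "DERIV F r :> 4 * pi * r\<^sup>2 * poisson3 1 r"
      by (simp add: poisson3_def power2_eq_square mult_ac)
    show "0 \<le> 4 * pi * r\<^sup>2 * poisson3 1 r" by (simp add: poisson3_def)
    have "((\<lambda>r. 16 * pi\<^sup>2 * (arctan r - r / (1 + r\<^sup>2))) \<longlongrightarrow> 16 * pi\<^sup>2 * (pi / 2 - 0)) at_top"
    proof (intro tendsto_intros tendsto_arctan_at_top)
      show "((\<lambda>r::real. r / (1 + r\<^sup>2)) \<longlongrightarrow> 0) at_top" by real_asymp
    qed
    then show "(F \<longlongrightarrow> 8 * pi ^ 3) at_top"
      by (simp add: F_def [abs_def] power2_eq_square power3_eq_cube mult.assoc)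
  qed auto
  have eq: "(\<integral>\<^sup>+r. ennreal (indicator {0<..} r * (4 * pi * r\<^sup>2 * poisson3 1 r)) \<partial>lborel) = ennreal (8 * pi ^ 3)"
  proof -
    have "(\<integral>\<^sup>+r. ennreal (indicator {0<..} r * (4 * pi * r\<^sup>2 * poisson3 1 r)) \<partial>lborel) =
        (\<integral>\<^sup>+r. ennreal (4 * pi * r\<^sup>2 * poisson3 1 r) * indicator {0..} r \<partial>lborel)"
      by (intro nn_integral_cong) (auto simp: indicator_def)
    then show ?thesis using nn by (simp add: F_def)
  qed
  have hb: "has_bochner_integral lborel (\<lambda>r. indicator {0<..} r * (4 * pi * r\<^sup>2 * poisson3 1 r)) (8 * pi ^ 3)"
    by (intro has_bochner_integral_nn_integral eq) (auto simp: poisson3_def)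
  show 1: "integrable lborel (\<lambda>p::real^3. poisson3 1 (norm p))"
    using hb by (intro integrable_normI) (auto simp: has_bochner_integral_iff)
  show "(LINT p|lborel. poisson3 1 (norm (p::real^3))) = 8 * pi ^ 3"
    using has_bochner_integral_integral_eq[OF hb] by (subst integral_norm[OF _ 1]) auto
qed

lemma integral_lborel_affine:
  fixes f :: "'a::euclidean_space \<Rightarrow> real"
  assumes [measurable]: "f \<in> borel_measurable borel" and e: "e > 0"
  shows "(LINT x|lborel. f x) = (LINT z|lborel. e ^ DIM('a) * f (y + e *\<^sub>R z))"
proof -
  have "(LINT x|lborel. f x) =
      (LINT x|density (distr lborel borel (\<lambda>x. y + e *\<^sub>R x)) (\<lambda>_. ennreal (\<bar>e\<bar> ^ DIM('a))). f x)"
    using e by (subst lborel_affine[of e y]) auto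
  also have "\<dots> = (LINT x|distr lborel borel (\<lambda>x. y + e *\<^sub>R x). \<bar>e\<bar> ^ DIM('a) *\<^sub>R f x)"
    by (subst integral_density) auto
  also have "\<dots> = (LINT z|lborel. e ^ DIM('a) * f (y + e *\<^sub>R z))"
    using e by (subst integral_distr) auto
  finally show ?thesis .
qed

lemma AE_ball_measure: "AE y in ball_measure R. y \<in> ball 0 R"
  unfolding ball_measure_def
  by (subst AE_density) (auto intro!: AE_I2 borel_measurable_indicator simp: indicator_def)

lemma poisson3_nonneg: "0 \<le> e \<Longrightarrow> 0 \<le> poisson3 e s"
  by (simp add: poisson3_def)

lemma poisson3_le: "0 < e \<Longrightarrow> poisson3 e s \<le> poisson3 e 0"
proof -
  assume e: "0 < e"
  have "(e\<^sup>2 + 0\<^sup>2)\<^sup>2 \<le> (e\<^sup>2 + s\<^sup>2)\<^sup>2"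
    by (rule power_mono) auto
  then show ?thesis
    unfolding poisson3_def using e by (intro divide_left_mono) (auto simp: add_pos_nonneg)
qed

lemma poisson3_scale: "e > 0 \<Longrightarrow> e ^ 3 * poisson3 e (e * s) = poisson3 1 s"
proof -
  assume e: "e > 0"
  have "(e\<^sup>2 + (e * s)\<^sup>2)\<^sup>2 = e ^ 4 * (1\<^sup>2 + s\<^sup>2)\<^sup>2"
    by (simp add: power2_eq_square power4_eq_xxxx algebra_simps)
  then show ?thesis
    using e by (simp add: poisson3_def power3_eq_cube power4_eq_xxxx)
qed

text \<open>The substitution \<open>x = y + e *\<^sub>R z\<close> fixes the kernel and dilates the
  ball instead, which provides a majorant independent of \<open>e\<close>.\<close>

lemma ball_poisson3:
  fixes y :: "real^3"
  assumes e: "e > 0"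
  shows "(LINT x|ball_measure R. poisson3 e (norm (x - y))) =
    (LINT z|lborel. indicator (ball 0 R) (y + e *\<^sub>R z) * poisson3 1 (norm z))"
proof -
  have m: "(\<lambda>x. indicator (ball 0 R) x * poisson3 e (norm (x - y))) \<in> borel_measurable borel"
    by (intro borel_measurable_times borel_measurable_indicator) auto
  have "(LINT x|ball_measure R. poisson3 e (norm (x - y))) =
      (LINT x|lborel. indicator (ball 0 R) x * poisson3 e (norm (x - y)))"
    by (subst integral_ball_measure) auto
  also have "\<dots> = (LINT z|lborel. e ^ 3 * (indicator (ball 0 R) (y + e *\<^sub>R z) * poisson3 e (norm (y + e *\<^sub>R z - y))))"
    by (subst integral_lborel_affine[OF m e, of y]) simp
  also have "\<dots> = (LINT z|lborel. indicator (ball 0 R) (y + e *\<^sub>R z) * poisson3 1 (norm z))"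
    using e by (intro Bochner_Integration.integral_cong refl) (simp add: poisson3_scale[symmetric])
  finally show ?thesis .
qed

lemma ball_poisson3_bounds:
  fixes y :: "real^3"
  assumes e: "e > 0"
  shows "\<bar>LINT x|ball_measure R. poisson3 e (norm (x - y))\<bar> \<le> 8 * pi ^ 3"
proof -
  have "\<bar>LINT x|ball_measure R. poisson3 e (norm (x - y))\<bar> \<le>
    (LINT z|lborel. \<bar>indicator (ball 0 R) (y + e *\<^sub>R z) * poisson3 1 (norm z)\<bar>)"
    unfolding ball_poisson3[OF e] by (rule integral_norm_bound[where 'a=real, unfolded real_norm_def])
  also have "\<dots> \<le> (LINT z|lborel. poisson3 1 (norm (z::real^3)))"
    by (rule integral_mono_AE'[OF poisson3_total(1)])
      (auto simp: abs_mult poisson3_nonneg indicator_def)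
  finally show ?thesis by (simp add: poisson3_total)
qed

text \<open>Seen from an interior point, the dilated balls exhaust the space, so the full mass of
  the kernel is recovered. The measure \<open>ball_measure R\<close> is carried by such
  points.\<close>

lemma ball_poisson3_limit:
  fixes y :: "real^3"
  assumes y: "norm y < R"
  shows "(\<lambda>n. LINT x|ball_measure R. poisson3 (1 / Suc n) (norm (x - y))) \<longlonglongrightarrow> 8 * pi ^ 3"
proof -
  have "(\<lambda>n. LINT z|lborel. indicator (ball 0 R) (y + (1 / Suc n) *\<^sub>R z) * poisson3 1 (norm z)) \<longlonglongrightarrow>
      (LINT z|lborel. poisson3 1 (norm (z::real^3)))"
  proof (rule integral_dominated_convergence[where w="\<lambda>z. poisson3 1 (norm z)"])
    have "(\<lambda>z. indicator (ball 0 R) (y + (1 / Suc n) *\<^sub>R z) :: real) \<in> borel_measurable borel" for n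
      by (rule measurable_compose[where f="\<lambda>z. y + (1 / Suc n) *\<^sub>R z" and N=borel])
         (auto intro!: borel_measurable_indicator)
    then show "(\<lambda>z. indicator (ball 0 R) (y + (1 / Suc n) *\<^sub>R z) * poisson3 1 (norm z)) \<in> borel_measurable lborel" for n
      by simp
    show "AE z in lborel. (\<lambda>n. indicator (ball 0 R) (y + (1 / Suc n) *\<^sub>R z) * poisson3 1 (norm z)) \<longlonglongrightarrow> poisson3 1 (norm z)"
    proof (rule AE_I2)
      fix z :: "real^3"
      have "(\<lambda>n. norm (y + (1 / Suc n) *\<^sub>R z)) \<longlonglongrightarrow> norm (y + 0 *\<^sub>R z)"
        using LIMSEQ_inverse_real_of_nat by (intro tendsto_intros) (simp add: inverse_eq_divide)
      then have "eventually (\<lambda>n. norm (y + (1 / Suc n) *\<^sub>R z) < R) sequentially"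
        using y by (intro order_tendstoD(2)) auto
      then have "eventually (\<lambda>n. indicator (ball 0 R) (y + (1 / Suc n) *\<^sub>R z) * poisson3 1 (norm z) = poisson3 1 (norm z)) sequentially"
        by eventually_elim (simp add: indicator_def)
      then show "(\<lambda>n. indicator (ball 0 R) (y + (1 / Suc n) *\<^sub>R z) * poisson3 1 (norm z)) \<longlonglongrightarrow> poisson3 1 (norm z)"
        by (rule tendsto_eventually)
    qed
    show "AE z in lborel. norm (indicator (ball 0 R) (y + (1 / Suc n) *\<^sub>R z) * poisson3 1 (norm z)) \<le> poisson3 1 (norm z)" for n
      by (auto simp: abs_mult poisson3_nonneg indicator_def)
  qed (use poisson3_total in auto)
  then show ?thesis by (subst ball_poisson3) (simp_all add: poisson3_total)
qed

text \<open>The factor \<open>exp (- norm q / (n + 1))\<close> makes the frequency side a finite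
  measure, to which \<open>integral_Q_ball_mult\<close> applies. Its transform is an approximate
  identity in \<open>x - y\<close>, so the integral over \<open>x\<close> tends to
  \<open>(2 pi)^3\<close> for each \<open>y\<close> in the ball and the integral over
  \<open>y\<close> reproduces the transform. On the frequency side the damping is removed by
  dominated convergence, since the product of the two transforms is integrable.\<close>

lemma ball_ft_convolution:
  fixes \<xi> :: "real^3"
  assumes R: "R > 0"
  shows "(LINT q|lborel. ball_ft R (norm q) * ball_ft R (norm (\<xi> - q))) = 8 * pi ^ 3 * ball_ft R (norm \<xi>)"
proof -
  let ?N = "ball_measure R"
  define A where "A n = (LINT q|lborel. exp (- (1 / Suc n) * norm q) * (ball_ft R (norm q) * ball_ft R (norm (\<xi> - q))))" for n
  define J where "J n y = (LINT x|?N. poisson3 (1 / Suc n) (norm (x - y)))" for n y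
  have "A \<longlonglongrightarrow> (LINT q|lborel. ball_ft R (norm q) * ball_ft R (norm (\<xi> - q)))"
    unfolding A_def
  proof (rule integral_dominated_convergence[where w="\<lambda>q. \<bar>ball_ft R (norm q) * ball_ft R (norm (\<xi> - q))\<bar>"])
    show "integrable lborel (\<lambda>q. \<bar>ball_ft R (norm q) * ball_ft R (norm (\<xi> - q))\<bar>)"
      by (rule integrable_abs[OF integrable_ball_ft_mult[OF R]])
    show "AE q in lborel. (\<lambda>n. exp (- (1 / Suc n) * norm q) * (ball_ft R (norm q) * ball_ft R (norm (\<xi> - q))))
        \<longlonglongrightarrow> ball_ft R (norm q) * ball_ft R (norm (\<xi> - q))"
    proof (rule AE_I2)
      fix q :: "real^3"
      have "(\<lambda>n. exp (- (1 / Suc n) * norm q) * (ball_ft R (norm q) * ball_ft R (norm (\<xi> - q)))) \<longlonglongrightarrow>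
          exp (- 0 * norm q) * (ball_ft R (norm q) * ball_ft R (norm (\<xi> - q)))"
        using LIMSEQ_inverse_real_of_nat by (intro tendsto_intros) (simp add: inverse_eq_divide)
      then show "(\<lambda>n. exp (- (1 / Suc n) * norm q) * (ball_ft R (norm q) * ball_ft R (norm (\<xi> - q))))
        \<longlonglongrightarrow> ball_ft R (norm q) * ball_ft R (norm (\<xi> - q))" by simp
    qed
    show "AE q in lborel. norm (exp (- (1 / Suc n) * norm q) * (ball_ft R (norm q) * ball_ft R (norm (\<xi> - q))))
        \<le> \<bar>ball_ft R (norm q) * ball_ft R (norm (\<xi> - q))\<bar>" for n
      by (rule AE_I2) (auto simp: abs_mult intro!: mult_left_le_one_le)
  qed measurable
  then have 1: "(\<lambda>n. complex_of_real (A n)) \<longlonglongrightarrow> complex_of_real (LINT q|lborel. ball_ft R (norm q) * ball_ft R (norm (\<xi> - q)))"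
    by (rule tendsto_of_real)
  have A: "complex_of_real (A n) = (LINT y|?N. cis (\<xi> \<bullet> y) * complex_of_real (J n y))" for n
  proof -
    define e where "e = 1 / real (Suc n)"
    have e: "e > 0" by (simp add: e_def)
    let ?P = "density lborel (\<lambda>p::real^3. ennreal (exp (- e * norm p)))"
    have P: "finite_measure ?P"
      using integrable_exp_norm(1)[OF e] by (intro finite_measureI)
        (auto simp: emeasure_density integrable_iff_bounded)
    have "complex_of_real (A n) = (LINT p|lborel. exp (- e * norm p) *\<^sub>R (Q_ball R (0 + p) * Q_ball R (\<xi> - p)))"
      unfolding A_def e_def[symmetric] Q_ball_eq[OF R]
      by (subst integral_complex_of_real[symmetric]) (simp add: scaleR_conv_of_real)
    also have "\<dots> = (LINT p|?P. Q_ball R (0 + p) * Q_ball R (\<xi> - p))"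
      using Q_ball_measurable[OF R] by (subst integral_density) auto
    also have "\<dots> = (LINT z|(?N \<Otimes>\<^sub>M ?N). cis (0 \<bullet> fst z + \<xi> \<bullet> snd z) * (LINT p|?P. cis ((fst z - snd z) \<bullet> p)))"
      by (rule integral_Q_ball_mult[OF P]) simp
    also have "\<dots> = (LINT z|(?N \<Otimes>\<^sub>M ?N). cis (\<xi> \<bullet> snd z) * complex_of_real (poisson3 e (norm (fst z - snd z))))"
      by (intro Bochner_Integration.integral_cong refl, subst integral_density)
         (simp_all add: exp_norm_fourier[OF e, simplified])
    also have "\<dots> = (LINT y|?N. LINT x|?N. cis (\<xi> \<bullet> y) * complex_of_real (poisson3 e (norm (x - y))))"
    proof -
      have "integrable (?N \<Otimes>\<^sub>M ?N) (\<lambda>(x, y). cis (\<xi> \<bullet> y) * complex_of_real (poisson3 e (norm (x - y))))"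
        by (rule finite_measure.integrable_const_bound[OF finite_ball_pair, of _ "poisson3 e 0"])
           (use e in \<open>auto intro!: AE_I2 simp: norm_mult poisson3_nonneg poisson3_le\<close>)
      from ball_pair.integral_snd[OF this] show ?thesis by (simp add: case_prod_unfold)
    qed
    also have "\<dots> = (LINT y|?N. cis (\<xi> \<bullet> y) * complex_of_real (J n y))"
      by (simp add: J_def e_def)
    finally show ?thesis .
  qed
  have Jm [measurable]: "J n \<in> borel_measurable borel" for n
  proof -
    have "(\<lambda>y. LINT x|?N. poisson3 (1 / Suc n) (norm (x - y))) \<in> borel_measurable ?N"
      by (rule ball.borel_measurable_lebesgue_integral) measurable
    then show ?thesis by (simp add: J_def [abs_def])
  qed
  have "(\<lambda>n. LINT y|?N. cis (\<xi> \<bullet> y) * complex_of_real (J n y)) \<longlonglongrightarrow>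
     (LINT y|?N. cis (\<xi> \<bullet> y) * complex_of_real (8 * pi ^ 3))"
  proof (rule integral_dominated_convergence[where w="\<lambda>_. 8 * pi ^ 3"])
    show "AE y in ?N. (\<lambda>n. cis (\<xi> \<bullet> y) * complex_of_real (J n y)) \<longlonglongrightarrow> cis (\<xi> \<bullet> y) * complex_of_real (8 * pi ^ 3)"
      using AE_ball_measure
    proof eventually_elim
      case (elim y)
      then show ?case
        unfolding J_def by (intro tendsto_mult tendsto_const tendsto_of_real ball_poisson3_limit) simp
    qed
    show "AE y in ?N. norm (cis (\<xi> \<bullet> y) * complex_of_real (J n y)) \<le> 8 * pi ^ 3" for n
      using ball_poisson3_bounds[of "1 / Suc n"] by (intro AE_I2) (simp add: norm_mult J_def)
  qed auto
  also have "(LINT y|?N. cis (\<xi> \<bullet> y) * complex_of_real (8 * pi ^ 3)) = complex_of_real (8 * pi ^ 3 * ball_ft R (norm \<xi>))"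
    by (simp only: integral_mult_left_zero Q_ball_cis[symmetric] Q_ball_eq[OF R]) simp
  finally have "complex_of_real (LINT q|lborel. ball_ft R (norm q) * ball_ft R (norm (\<xi> - q))) =
      complex_of_real (8 * pi ^ 3 * ball_ft R (norm \<xi>))"
    using 1 LIMSEQ_unique unfolding A by blast
  then show ?thesis by (simp only: of_real_eq_iff)
qed

lemma rho_diff_measurable [measurable]: "(\<lambda>q. rho (q - a)) \<in> borel_measurable borel"
  by (rule measurable_compose[OF _ rho_measurable]) simp

lemma ball_ft_mult_measurable [measurable]:
  fixes \<xi> :: "real^3"
  shows "(\<lambda>q. ball_ft R (norm q) * ball_ft R (norm (\<xi> - q))) \<in> borel_measurable borel"
  by measurable

definition err :: "real \<Rightarrow> real^3 \<Rightarrow> real^3 \<Rightarrow> real" where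
  "err R a b = (LINT q|lborel. (rho (q - a) - 1 / (8 * pi)) * (ball_ft R (norm q) * ball_ft R (norm (a + b - q))))"

lemma K_real_eq:
  assumes R: "R > 0"
  shows "K_real R a b = pi\<^sup>2 * ball_ft R (norm (a + b)) + err R a b"
proof -
  let ?f = "\<lambda>q. ball_ft R (norm q) * ball_ft R (norm (a + b - q))"
  define C where "C = 4 / 3 * pi * R ^ 3"
  have 1: "integrable lborel (\<lambda>q. rho (q - a) * ?f q)"
  proof (rule Bochner_Integration.integrable_bound)
    show "integrable lborel (\<lambda>q. rho (q - a) * (C * C))"
      using integrable_translate(2)[OF integrable_rho, of a] by simp
    have "\<bar>?f q\<bar> \<le> C * C" for q
      unfolding abs_mult C_def using R by (intro mult_mono abs_ball_ft_le_ball) auto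
    then show "AE q in lborel. norm (rho (q - a) * ?f q) \<le> norm (rho (q - a) * (C * C))"
      by (intro AE_I2) (auto simp: abs_mult intro!: mult_left_mono)
    show "(\<lambda>q. rho (q - a) * ?f q) \<in> borel_measurable lborel"
      using borel_measurable_times[OF rho_diff_measurable ball_ft_mult_measurable] by simp
  qed
  have 2: "integrable lborel (\<lambda>q. 1 / (8 * pi) * ?f q)"
    using integrable_ball_ft_mult[OF R] by (intro integrable_mult_right)
  have "err R a b = (LINT q|lborel. rho (q - a) * ?f q - 1 / (8 * pi) * ?f q)"
    unfolding err_def by (simp only: left_diff_distrib)
  also have "\<dots> = K_real R a b - 1 / (8 * pi) * (8 * pi ^ 3 * ball_ft R (norm (a + b)))"
    using Bochner_Integration.integral_diff[OF 1 2]
    by (simp only: K_real_def integral_mult_right_zero ball_ft_convolution[OF R])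
  also have "1 / (8 * pi) * (8 * pi ^ 3 * ball_ft R (norm (a + b))) = pi\<^sup>2 * ball_ft R (norm (a + b))"
    by (simp add: power2_eq_square power3_eq_cube)
  finally show ?thesis by simp
qed

subsection \<open>The error kernel\<close>

lemma decay_ge_inverse: "0 < s \<Longrightarrow> s \<le> 1 \<Longrightarrow> 1 / s \<le> decay s"
proof -
  assume s: "0 < s" "s \<le> 1"
  have "s\<^sup>2 * sqrt s \<le> s * 1 * 1"
    unfolding power2_eq_square using s by (intro mult_mono) auto
  then show ?thesis
    using s by (simp add: decay_def divide_left_mono)
qed

text \<open>Here \<open>x\<close> is the smaller of the distances to the two singular points. For
  \<open>x \<le> 1\<close> the assumption \<open>le\<close> cancels \<open>y\<^sup>2\<close> at the
  price of \<open>1 / sqrt x\<close>, which is the origin of the power -5/2 in \<open>decay\<close>;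
  for \<open>x > 1\<close> crude bounds leave the power -4.\<close>

lemma decay_pair_aux:
  assumes x: "0 < x" and xy: "x \<le> y" and g: "0 \<le> g" "g \<le> 1"
    and le: "sqrt t * g * sqrt x \<le> 4 * y\<^sup>2" and t: "0 \<le> t" "t \<le> 2"
  shows "sqrt t * g / (x\<^sup>2 * y\<^sup>2) \<le> 4 * decay x"
proof (cases "x \<le> 1")
  case True
  have "sqrt t * g \<le> 4 * y\<^sup>2 / sqrt x"
    using le x by (simp add: pos_le_divide_eq)
  then have "sqrt t * g / (x\<^sup>2 * y\<^sup>2) \<le> 4 * y\<^sup>2 / sqrt x / (x\<^sup>2 * y\<^sup>2)"
    by (intro divide_right_mono) auto
  also have "\<dots> = 4 * decay x"
    using True x xy by (simp add: decay_def)
  finally show ?thesis .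
next
  case False
  have "sqrt t \<le> sqrt (2\<^sup>2)" using t by (intro real_sqrt_le_mono) auto
  then have "sqrt t * g \<le> 4 * 1" using g t by (intro mult_mono) auto
  then have "sqrt t * g / (x\<^sup>2 * y\<^sup>2) \<le> 4 / (x\<^sup>2 * y\<^sup>2)"
    by (intro divide_right_mono) auto
  also have "\<dots> \<le> 4 / (x\<^sup>2 * x\<^sup>2)"
    using x xy by (intro divide_left_mono mult_left_mono power_mono) auto
  also have "\<dots> = 4 * decay x"
    using False by (simp add: decay_def power4_eq_xxxx power2_eq_square mult.assoc)
  finally show ?thesis .
qed

text \<open>Let \<open>M\<close> be the larger and \<open>m\<close> the smaller of the two
  distances. Then \<open>t \<le> 2 * M\<close> and \<open>g \<le> 2 * M\<close> give
  \<open>sqrt t * g * sqrt m \<le> 4 * M\<^sup>2\<close>, which cancels the larger squared distance.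
  A bound of \<open>g\<close> by just one of the distances suffices, since only \<open>M\<close>
  enters.\<close>

lemma decay_pair:
  assumes x: "0 < x" and y: "0 < y" and g: "0 \<le> g" "g \<le> 1" "g \<le> 2 * x" and t: "0 \<le> t" "t \<le> x + y" "t \<le> 2"
  shows "sqrt t * g / (x\<^sup>2 * y\<^sup>2) \<le> 4 * (decay x + decay y)"
proof -
  have d: "0 \<le> decay x" "0 \<le> decay y" using x y by (auto intro: decay_nonneg)
  have le: "sqrt t * g * sqrt m \<le> 4 * M\<^sup>2" if "t \<le> 2 * M" "x \<le> M" "m \<le> M" "0 < m" for m M
  proof -
    have M: "0 < M" using that by simp
    have "sqrt t \<le> sqrt (2\<^sup>2 * M)" using that M by (intro real_sqrt_le_mono) auto
    then have "sqrt t \<le> 2 * sqrt M" by (simp add: real_sqrt_mult)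
    then have "sqrt t * g \<le> (2 * sqrt M) * (2 * M)"
      using that M t g by (intro mult_mono) auto
    then have "sqrt t * g * sqrt m \<le> (2 * sqrt M) * (2 * M) * sqrt M"
      by (rule mult_mono) (use that M in auto)
    also have "\<dots> = 4 * M * (sqrt M * sqrt M)" by (simp only: mult_ac)
    also have "\<dots> = 4 * M\<^sup>2" using M by (simp add: power2_eq_square)
    finally show ?thesis .
  qed
  show ?thesis
  proof (cases "x \<le> y")
    case True
    have "sqrt t * g / (x\<^sup>2 * y\<^sup>2) \<le> 4 * decay x"
      using True x g t by (intro decay_pair_aux le) auto
    then show ?thesis using d by simp
  next
    case False
    have "sqrt t * g / (y\<^sup>2 * x\<^sup>2) \<le> 4 * decay y"
      using False y g t by (intro decay_pair_aux le) auto
    then show ?thesis using d by (simp add: mult.commute)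
  qed
qed

text \<open>The part of the integrand of \<open>err\<close> that does not depend on
  \<open>R\<close>: from each \<open>ball_ft\<close> the factor \<open>R\<close> and a bounded
  oscillating factor have been split off, leaving an inverse square.\<close>

definition err_kernel :: "real^3 \<Rightarrow> real^3 \<Rightarrow> real^3 \<Rightarrow> real" where
  "err_kernel a b q = (rho (q - a) - 1 / (8 * pi)) / ((norm q)\<^sup>2 * (norm (a + b - q))\<^sup>2)"

lemma err_kernel_measurable [measurable]: "err_kernel a b \<in> borel_measurable borel"
  unfolding err_kernel_def [abs_def] by (intro borel_measurable_divide borel_measurable_diff) auto

text \<open>Since \<open>a\<close> is a unit vector, \<open>rho (q - a)\<close> takes the value \<open>1 / (8 * pi)\<close> at \<open>q = 0\<close>. This
  cancellation improves the bound by \<open>1 / norm (a + b)\<close>, whose square is not integrable on the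
  product of the spheres, to \<open>1 / sqrt (norm (a + b))\<close>.\<close>

lemma err_kernel_bound:
  assumes a: "norm a = 1" and b: "norm b = 1" and q: "q \<noteq> 0" "q \<noteq> a" "q \<noteq> a + b"
  shows "sqrt (norm (a + b)) * \<bar>err_kernel a b q\<bar> \<le>
    64 * (decay (norm q) + decay (norm (a + b - q)) + decay (norm (q - a)))"
proof -
  define x where "x = norm q"
  define y where "y = norm (a + b - q)"
  define s where "s = norm (q - a)"
  define t where "t = norm (a + b)"
  define G where "G = \<bar>(if s < 2 then 1 / s else 0) - 1\<bar>"
  have pos: "0 < x" "0 < y" "0 < s" using q by (auto simp: x_def y_def s_def)
  have t: "0 \<le> t" "t \<le> x + y" "t \<le> 2"
    using norm_triangle_ineq[of q "a + b - q"] norm_triangle_ineq[of a b] a b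
    by (auto simp: t_def x_def y_def)
  have d: "0 \<le> decay x" "0 \<le> decay y" "0 \<le> decay s"
    using pos by (auto intro: decay_nonneg)
  have "rho (q - a) - 1 / (8 * pi) = 1 / (8 * pi) * ((if s < 2 then 1 / s else 0) - 1)"
    by (simp add: rho_def s_def right_diff_distrib)
  then have "\<bar>rho (q - a) - 1 / (8 * pi)\<bar> = 1 / (8 * pi) * G"
    by (simp only: abs_mult G_def) simp
  also have "\<dots> \<le> 1 * G"
    using pi_gt3 by (intro mult_right_mono) (auto simp: G_def)
  finally have rho: "\<bar>rho (q - a) - 1 / (8 * pi)\<bar> \<le> G" by simp
  have "sqrt t * \<bar>err_kernel a b q\<bar> = sqrt t * \<bar>rho (q - a) - 1 / (8 * pi)\<bar> / (x\<^sup>2 * y\<^sup>2)"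
    by (simp add: err_kernel_def abs_mult x_def y_def)
  also have "\<dots> \<le> sqrt t * G / (x\<^sup>2 * y\<^sup>2)"
    using rho t by (intro divide_right_mono mult_left_mono) auto
  also have "\<dots> \<le> 64 * (decay x + decay y + decay s)"
  proof (cases "s < 1 / 2")
    case True
    \<comment> \<open>Near \<open>a\<close>, where \<open>rho\<close> is singular, both other
      distances are at least \<open>1 / 2\<close> because \<open>a\<close> and \<open>b\<close> are
      unit vectors. The bound \<open>4 / s\<close> for the numerator, divided by
      \<open>(1 / 2) ^ 4\<close>, gives the constant 64.\<close>
    have "x \<ge> 1 / 2"
      using norm_triangle_ineq2[of a "a - q"] a True by (simp add: x_def s_def norm_minus_commute)
    have "y \<ge> 1 / 2"
      using norm_triangle_ineq2[of b "q - a"] b True by (simp add: y_def s_def algebra_simps)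
    have "(1 / 2)\<^sup>2 * (1 / 2)\<^sup>2 \<le> x\<^sup>2 * y\<^sup>2"
      using \<open>x \<ge> 1 / 2\<close> \<open>y \<ge> 1 / 2\<close> by (intro mult_mono power_mono) auto
    moreover have "sqrt t * G \<le> 2 * (2 * (1 / s))"
    proof (intro mult_mono)
      have "sqrt t \<le> sqrt (2\<^sup>2)" using t by (intro real_sqrt_le_mono) auto
      then show "sqrt t \<le> 2" by simp
      have "1 \<le> 1 / s" using True pos by (simp add: le_divide_eq)
      then show "G \<le> 2 * (1 / s)" using True by (simp add: G_def)
    qed (auto simp: G_def t)
    ultimately have "sqrt t * G / (x\<^sup>2 * y\<^sup>2) \<le> 2 * (2 * (1 / s)) / ((1 / 2)\<^sup>2 * (1 / 2)\<^sup>2)"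
      using pos t by (intro frac_le) (auto simp: G_def)
    also have "\<dots> = 64 * (1 / s)" by (simp add: power2_eq_square)
    also have "\<dots> \<le> 64 * decay s"
      using decay_ge_inverse[of s] pos True by simp
    finally show ?thesis using d by simp
  next
    case False
    \<comment> \<open>The distance \<open>s\<close> from \<open>a\<close> equals 1 at the origin, so
      it deviates from 1 by at most \<open>norm q\<close>. For \<open>1 / 2 \<le> s < 2\<close> this
      yields \<open>G \<le> 2 * x\<close>; for \<open>s \<ge> 2\<close>, where \<open>rho\<close> is
      cut off and \<open>G = 1\<close>, it yields \<open>x \<ge> 1\<close>.\<close>
    have x_ge: "\<bar>s - 1\<bar> \<le> x"
      using norm_triangle_ineq3[of "q - a" "- a"] a by (simp add: s_def x_def)
    have "G \<le> 1"
    proof (cases "s < 2")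
      case True
      have "1 / s \<le> 2" using False pos by (simp add: divide_le_eq)
      moreover have "0 \<le> 1 / s" using pos by simp
      ultimately show ?thesis using True by (auto simp: G_def abs_le_iff)
    qed (simp add: G_def)
    moreover have "G \<le> 2 * x"
    proof (cases "s < 2")
      case True
      have "G = \<bar>s - 1\<bar> / s"
      proof -
        have "1 / s - 1 = (1 - s) / s" using pos by (simp add: diff_divide_distrib)
        then show ?thesis using True pos by (simp add: G_def abs_minus_commute)
      qed
      also have "\<dots> \<le> x / (1 / 2)"
        using x_ge False pos by (intro frac_le) auto
      finally show ?thesis by simp
    next
      case False
      then show ?thesis using x_ge by (simp add: G_def)
    qed
    ultimately have "sqrt t * G / (x\<^sup>2 * y\<^sup>2) \<le> 4 * (decay x + decay y)"
      using pos t by (intro decay_pair) (auto simp: G_def)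
    then show ?thesis using d by simp
  qed
  finally show ?thesis by (simp add: x_def y_def s_def t_def)
qed

text \<open>The three copies of \<open>decay\<close> centred at 0, \<open>a + b\<close> and
  \<open>a\<close> have the same integral, and \<open>192 = 3 * 64\<close>.\<close>

definition err_const :: real where
  "err_const = 192 * (LINT p|lborel. decay (norm (p::real^3)))"

lemma err_kernel_integrable:
  assumes a: "norm a = 1" and b: "norm b = 1" and ab: "a + b \<noteq> 0"
  shows "integrable lborel (err_kernel a b)"
    and "sqrt (norm (a + b)) * (LINT q|lborel. \<bar>err_kernel a b q\<bar>) \<le> err_const"
proof -
  define W where "W q = 64 * (decay (norm q) + decay (norm (a + b - q)) + decay (norm (q - a)))" for q
  note 1 = integrable_decay
  note 2 = integrable_reflect[of decay "a + b", OF integrable_decay]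
  note 3 = integrable_translate(2)[OF integrable_decay, of a]
  have W: "integrable lborel W"
    unfolding W_def [abs_def] using 1 2 3 by (intro integrable_mult_right Bochner_Integration.integrable_add)
  have tr: "(LINT q|lborel. decay (norm (c + q))) = (LINT q|lborel. decay (norm (q :: real^3)))" for c :: "real^3"
    by (rule integral_lborel_translate[where f="\<lambda>q. decay (norm q)"]) measurable
  have "(LINT q|lborel. W q) = 64 * ((LINT q|lborel. decay (norm (q::real^3))) + (LINT q|lborel. decay (norm (a + b - q))) + (LINT q|lborel. decay (norm (q - a))))"
    unfolding W_def using 1 2 3 by (simp add: Bochner_Integration.integral_add)
  also have "(LINT q|lborel. decay (norm (a + b - q))) = (LINT q|lborel. decay (norm (- (a + b) + q)))"
    by (intro Bochner_Integration.integral_cong refl) (metis add.commute diff_conv_add_uminus norm_minus_commute)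
  also have "(LINT q|lborel. decay (norm (q - a))) = (LINT q|lborel. decay (norm (- a + q)))"
    by simp
  finally have intW: "(LINT q|lborel. W q) = err_const"
    by (simp only: tr err_const_def) simp
  have le: "AE q in lborel. sqrt (norm (a + b)) * \<bar>err_kernel a b q\<bar> \<le> W q"
    using AE_lborel_singleton[of 0] AE_lborel_singleton[of a] AE_lborel_singleton[of "a + b"]
    by eventually_elim (use err_kernel_bound[OF a b] in \<open>simp add: W_def\<close>)
  have pos: "0 < sqrt (norm (a + b))" using ab by simp
  have int: "integrable lborel (\<lambda>q. sqrt (norm (a + b)) * \<bar>err_kernel a b q\<bar>)"
  proof (rule Bochner_Integration.integrable_bound[OF W])
    show "AE q in lborel. norm (sqrt (norm (a + b)) * \<bar>err_kernel a b q\<bar>) \<le> norm (W q)"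
      using le by eventually_elim (simp add: abs_mult)
  qed measurable
  then show "integrable lborel (err_kernel a b)"
    using ab by (simp add: integrable_abs_iff)
  have "sqrt (norm (a + b)) * (LINT q|lborel. \<bar>err_kernel a b q\<bar>) = (LINT q|lborel. sqrt (norm (a + b)) * \<bar>err_kernel a b q\<bar>)"
    by simp
  also have "\<dots> \<le> (LINT q|lborel. W q)"
    by (rule integral_mono_AE[OF int W le])
  finally show "sqrt (norm (a + b)) * (LINT q|lborel. \<bar>err_kernel a b q\<bar>) \<le> err_const"
    by (simp add: intW)
qed

text \<open>The bounded profile of the transform: \<open>ball_ft R k\<close> is
  \<open>R / k\<^sup>2\<close> times \<open>osc (R * k)\<close>. The \<open>snc\<close> part decays,
  whereas the \<open>cos\<close> part does not and has to be averaged out by oscillation.\<close>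

definition osc :: "real \<Rightarrow> real" where
  "osc t = 4 * pi * (snc t - cos t)"

lemma osc_measurable [measurable]: "osc \<in> borel_measurable borel"
  unfolding osc_def [abs_def] by measurable

lemma abs_osc_le: "\<bar>osc t\<bar> \<le> 8 * pi"
proof -
  have "\<bar>snc t - cos t\<bar> \<le> 1 + 1"
    using abs_snc_le[of t] abs_cos_le_one[of t] by linarith
  then have "4 * pi * \<bar>snc t - cos t\<bar> \<le> 4 * pi * (1 + 1)" by (intro mult_left_mono) auto
  then show ?thesis by (simp add: osc_def abs_mult)
qed

lemma ball_ft_osc:
  assumes "R > 0" "k > 0"
  shows "ball_ft R k = R * osc (R * k) / k\<^sup>2"
  using assms by (simp add: ball_ft_def osc_def snc_def field_simps power2_eq_square power3_eq_cube)

lemma err_eq: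
  assumes R: "R > 0"
  shows "err R a b = R\<^sup>2 * (LINT q|lborel. err_kernel a b q * (osc (R * norm q) * osc (R * norm (a + b - q))))"
proof -
  have "err R a b = (LINT q|lborel. R\<^sup>2 * (err_kernel a b q * (osc (R * norm q) * osc (R * norm (a + b - q)))))"
    unfolding err_def
  proof (rule integral_cong_AE)
    show "AE q in lborel. (rho (q - a) - 1 / (8 * pi)) * (ball_ft R (norm q) * ball_ft R (norm (a + b - q))) =
       R\<^sup>2 * (err_kernel a b q * (osc (R * norm q) * osc (R * norm (a + b - q))))"
      using AE_lborel_singleton[of 0] AE_lborel_singleton[of "a + b"]
      by eventually_elim (use R in \<open>simp add: ball_ft_osc err_kernel_def power2_eq_square\<close>)
  qed measurable
  then show ?thesis by simp
qed

lemma abs_err_le: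
  assumes a: "norm a = 1" and b: "norm b = 1" and ab: "a + b \<noteq> 0" and R: "R > 0"
  shows "\<bar>err R a b\<bar> \<le> R\<^sup>2 * (64 * pi\<^sup>2 * err_const / sqrt (norm (a + b)))"
proof -
  note int = err_kernel_integrable[OF a b ab]
  have pos: "0 < sqrt (norm (a + b))" using ab by simp
  have "\<bar>LINT q|lborel. err_kernel a b q * (osc (R * norm q) * osc (R * norm (a + b - q)))\<bar> \<le>
     (LINT q|lborel. 64 * pi\<^sup>2 * \<bar>err_kernel a b q\<bar>)"
  proof (rule integral_abs_bound[THEN order_trans], rule integral_mono_AE')
    show "integrable lborel (\<lambda>q. 64 * pi\<^sup>2 * \<bar>err_kernel a b q\<bar>)"
      using int(1) by simp
    have "\<bar>osc s * osc t\<bar> \<le> 64 * pi\<^sup>2" for s t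
    proof -
      have "\<bar>osc s * osc t\<bar> \<le> (8 * pi) * (8 * pi)"
        unfolding abs_mult by (intro mult_mono abs_osc_le) auto
      then show ?thesis by (simp add: power2_eq_square)
    qed
    then show "AE q in lborel. \<bar>err_kernel a b q * (osc (R * norm q) * osc (R * norm (a + b - q)))\<bar> \<le> 64 * pi\<^sup>2 * \<bar>err_kernel a b q\<bar>"
      by (intro AE_I2) (subst abs_mult, subst mult.commute, intro mult_right_mono, auto)
  qed auto
  also have "\<dots> \<le> 64 * pi\<^sup>2 * (err_const / sqrt (norm (a + b)))"
    using int(2) pos by (simp add: pos_le_divide_eq mult.commute)
  finally show ?thesis
    unfolding err_eq[OF R] abs_mult abs_power2 times_divide_eq_right[symmetric]
    by (intro mult_left_mono) (simp_all add: mult.assoc)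
qed

subsection \<open>Oscillatory integrals\<close>

text \<open>Since \<open>\<bar>k R x\<bar> \<le> 1\<close>, replacing \<open>f\<close> by
  \<open>s i\<close> changes the integral by at most their L1 distance, uniformly in
  \<open>R\<close>. This closes the Riemann-Lebesgue property under dominated limits.\<close>

lemma tendsto_integral_kernel_limit:
  fixes k :: "real \<Rightarrow> 'a \<Rightarrow> real" and f :: "'a \<Rightarrow> real"
  assumes [measurable]: "\<And>R. k R \<in> borel_measurable M" and k: "\<And>R x. \<bar>k R x\<bar> \<le> 1"
    and w: "integrable M w" and s: "\<And>i. s i \<in> borel_measurable M" and f: "f \<in> borel_measurable M"
    and lim: "AE x in M. (\<lambda>i. s i x) \<longlonglongrightarrow> f x" and bound: "\<And>i. AE x in M. norm (s i x) \<le> w x"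
    and s0: "\<And>i. ((\<lambda>R. LINT x|M. s i x * k R x) \<longlongrightarrow> 0) at_top"
  shows "((\<lambda>R. LINT x|M. f x * k R x) \<longlongrightarrow> 0) at_top"
proof (rule tendstoI)
  fix e :: real assume e: "e > 0"
  have fi: "integrable M f"
    by (rule integrable_dominated_convergence[OF f s w lim bound])
  have si: "integrable M (s i)" for i
    by (rule integrable_dominated_convergence2[OF f s w lim bound])
  have "(\<lambda>i. LINT x|M. \<bar>s i x - f x\<bar>) \<longlonglongrightarrow> (LINT x|M. 0)"
  proof (rule integral_dominated_convergence[where w="\<lambda>x. w x + \<bar>f x\<bar>"])
    show "AE x in M. (\<lambda>i. \<bar>s i x - f x\<bar>) \<longlonglongrightarrow> 0"
      using lim
    proof eventually_elim
      case (elim x)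
      then have "(\<lambda>i. \<bar>s i x - f x\<bar>) \<longlonglongrightarrow> \<bar>f x - f x\<bar>" by (intro tendsto_intros)
      then show ?case by simp
    qed
    show "AE x in M. norm \<bar>s i x - f x\<bar> \<le> w x + \<bar>f x\<bar>" for i
      using bound[of i] by eventually_elim auto
  qed (use s f w fi in auto)
  then have "eventually (\<lambda>i. (LINT x|M. \<bar>s i x - f x\<bar>) < e / 2) sequentially"
    using e by (intro order_tendstoD(2)) auto
  then obtain i where i: "(LINT x|M. \<bar>s i x - f x\<bar>) < e / 2"
    using eventually_happens'[OF sequentially_bot] by blast
  have ik: "integrable M (\<lambda>x. g x * k R x)" if g: "integrable M g" for g R
  proof (rule Bochner_Integration.integrable_bound[OF g])
    show "AE x in M. norm (g x * k R x) \<le> norm (g x)"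
      using k by (intro AE_I2) (auto simp: abs_mult intro!: mult_left_le)
  qed (use g in auto)
  have "eventually (\<lambda>R. dist (LINT x|M. s i x * k R x) 0 < e / 2) at_top"
    using e by (intro tendstoD[OF s0]) auto
  then show "eventually (\<lambda>R. dist (LINT x|M. f x * k R x) 0 < e) at_top"
  proof eventually_elim
    case (elim R)
    have "\<bar>(LINT x|M. s i x * k R x) - (LINT x|M. f x * k R x)\<bar> = \<bar>LINT x|M. (s i x - f x) * k R x\<bar>"
      using ik[OF si, of i R] ik[OF fi, of R] by (simp add: left_diff_distrib)
    also have "\<dots> \<le> (LINT x|M. \<bar>s i x - f x\<bar>)"
    proof (rule integral_abs_bound[THEN order_trans], rule integral_mono_AE')
      show "AE x in M. \<bar>(s i x - f x) * k R x\<bar> \<le> \<bar>s i x - f x\<bar>"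
        using k by (intro AE_I2) (auto simp: abs_mult intro!: mult_left_le)
    qed (use si fi in auto)
    finally show ?case using elim i by simp
  qed
qed

text \<open>Sets whose indicators are averaged to 0 by the kernel form a Dynkin system that contains
  the half-lines, at least inside a bounded window. Removing the window and passing to simple
  functions and their limits gives a Riemann-Lebesgue lemma for any bounded kernel, of which only
  the averages over intervals have to be computed.\<close>

lemma tendsto_integral_kernel:
  fixes k :: "real \<Rightarrow> real \<Rightarrow> real" and f :: "real \<Rightarrow> real"
  assumes km [measurable]: "\<And>R. k R \<in> borel_measurable borel" and k: "\<And>R x. \<bar>k R x\<bar> \<le> 1"
    and intervals: "\<And>a b. ((\<lambda>R. LINT x|lborel. indicator {a..b} x * k R x) \<longlongrightarrow> 0) at_top"
    and f: "integrable lborel f"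
  shows "((\<lambda>R. LINT x|lborel. f x * k R x) \<longlongrightarrow> 0) at_top"
proof -
  define rl where "rl f \<longleftrightarrow> ((\<lambda>R. LINT x|lborel. f x * k R x) \<longlongrightarrow> 0) at_top" for f :: "real \<Rightarrow> real"
  have ik: "integrable lborel (\<lambda>x. g x * k R x)" if g: "integrable lborel g" for g R
  proof (rule Bochner_Integration.integrable_bound[OF g])
    show "AE x in lborel. norm (g x * k R x) \<le> norm (g x)"
      using k by (intro AE_I2) (auto simp: abs_mult intro!: mult_left_le)
  qed (use g in auto)
  have add: "rl (\<lambda>x. f x + g x)" if "integrable lborel f" "integrable lborel g" "rl f" "rl g" for f g
    using tendsto_add[OF that(3,4)[unfolded rl_def]] ik[OF that(1)] ik[OF that(2)]
    by (simp add: rl_def distrib_right)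
  have cmult: "rl (\<lambda>x. f x * c)" if "rl f" for f and c :: real
  proof -
    have "((\<lambda>R. c * (LINT x|lborel. f x * k R x)) \<longlongrightarrow> c * 0) at_top"
      using that unfolding rl_def by (intro tendsto_intros)
    moreover have "(LINT x|lborel. f x * c * k R x) = c * (LINT x|lborel. f x * k R x)" for R
      by (subst integral_mult_right_zero[symmetric]) (simp add: mult_ac)
    ultimately show ?thesis by (simp add: rl_def)
  qed
  have lim: "rl f" if "integrable lborel w" "\<And>i::nat. s i \<in> borel_measurable lborel" "f \<in> borel_measurable lborel"
    "AE x in lborel. (\<lambda>i. s i x) \<longlonglongrightarrow> f x" "\<And>i. AE x in lborel. norm (s i x) \<le> w x" "\<And>i. rl (s i)" for f s w
    unfolding rl_def
    by (rule tendsto_integral_kernel_limit[where s=s and w=w]) (use that k in \<open>auto simp: rl_def\<close>)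
  \<comment> \<open>Cutting to \<open>[-n, n]\<close> keeps all indicators integrable, those of
    complements included, and turns a half-line into an interval.\<close>
  have bdd: "rl (indicator ({-real n..real n} \<inter> A))" if "A \<in> sets borel" for n A
  proof -
    let ?I = "{-real n..real n}"
    have inds: "integrable lborel (indicator (?I \<inter> A) :: real \<Rightarrow> real)" if "A \<in> sets borel" for A
    proof (rule integrable_real_indicator)
      have "emeasure lborel (?I \<inter> A) \<le> emeasure lborel ?I" using that by (intro emeasure_mono) auto
      then show "emeasure lborel (?I \<inter> A) < \<infinity>" by (simp add: top_unique less_top emeasure_lborel_Icc_eq)
         (use le_less_trans ennreal_less_top in blast)
    qed (use that in auto)
    have "Int_stable (range atMost :: real set set)"
    proof (rule Int_stableI)
      fix a b :: "real set" assume "a \<in> range atMost" "b \<in> range atMost"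
      then obtain s t where "a = {..s}" "b = {..t}" by auto
      then have "a \<inter> b = {..min s t}" by auto
      then show "a \<inter> b \<in> range atMost" by blast
    qed
    moreover have "range atMost \<subseteq> Pow (UNIV :: real set)" by simp
    moreover have "A \<in> sigma_sets UNIV (range atMost)"
      using that by (simp add: borel_eq_atMost)
    ultimately show ?thesis
    proof (induction rule: sigma_sets_induct_disjoint)
      case (basic A)
      then obtain t where "A = {..t}" by auto
      then have "?I \<inter> A = {- real n..min (real n) t}" by auto
      then show ?case using intervals[of "- real n" "min (real n) t"] by (simp add: rl_def)
    next
      case empty
      show ?case by (simp add: rl_def)
    next
      case (compl A)
      then have A: "A \<in> sets borel" by (simp add: borel_eq_atMost)
      have "rl (\<lambda>x. indicator (?I \<inter> UNIV) x + indicator (?I \<inter> A) x * (-1))"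
        using intervals[of "- real n" "real n"] inds[OF A] inds[of UNIV] compl(2)
        by (intro add cmult) (auto simp: rl_def)
      moreover have "(\<lambda>x. indicator (?I \<inter> UNIV) x + indicator (?I \<inter> A) x * (-1)) = (indicator (?I \<inter> (UNIV - A)) :: real \<Rightarrow> real)"
        by (auto simp: indicator_def)
      ultimately show ?case by simp
    next
      case (union A)
      have A: "A i \<in> sets borel" for i using union(2) by (auto simp: borel_eq_atMost)
      define s where "s m x = (\<Sum>i<m. indicator (?I \<inter> A i) x :: real)" for m x
      have sI: "s m x = indicator (?I \<inter> (\<Union>i<m. A i)) x" for m x
      proof -
        have "s m x = indicator (\<Union>i<m. ?I \<inter> A i) x"
          unfolding s_def using union(1)
          by (intro indicator_UN_disjoint[symmetric]) (auto simp: disjoint_family_on_def)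
        also have "(\<Union>i<m. ?I \<inter> A i) = ?I \<inter> (\<Union>i<m. A i)" by auto
        finally show ?thesis .
      qed
      have rls: "rl (s m)" for m
      proof (induction m)
        case 0
        then show ?case by (simp add: rl_def s_def)
      next
        case (Suc m)
        have "rl (\<lambda>x. s m x + indicator (?I \<inter> A m) x)"
          using Suc union(3) inds[OF A] inds[of "\<Union>i<m. A i"] A by (intro add) (auto simp: sI [abs_def])
        then show ?case by (simp add: s_def [abs_def])
      qed
      show ?case
      proof (rule lim[where s=s and w="indicator (?I \<inter> UNIV)"])
        show "integrable lborel (indicator (?I \<inter> UNIV) :: real \<Rightarrow> real)" by (rule inds) simp
        show "s m \<in> borel_measurable lborel" for m using A by (auto simp: sI [abs_def])
        show "indicator (?I \<inter> (\<Union>i. A i)) \<in> borel_measurable lborel" using A by auto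
        show "AE x in lborel. (\<lambda>m. s m x) \<longlonglongrightarrow> indicator (?I \<inter> (\<Union>i. A i)) x"
        proof (rule AE_I2)
          fix x
          show "(\<lambda>m. s m x) \<longlonglongrightarrow> indicator (?I \<inter> (\<Union>i. A i)) x"
          proof (cases "x \<in> ?I \<inter> (\<Union>i. A i)")
            case True
            then obtain i where "x \<in> A i" by auto
            have "eventually (\<lambda>m. s m x = indicator (?I \<inter> (\<Union>i. A i)) x) sequentially"
              using eventually_gt_at_top[of i]
            proof eventually_elim
              case (elim m)
              with \<open>x \<in> A i\<close> have "x \<in> (\<Union>i<m. A i)" by auto
              then show ?case using True by (simp add: sI indicator_def)
            qed
            then show ?thesis by (rule tendsto_eventually)
          next
            case False
            then have "s m x = 0" for m by (auto simp: sI indicator_def)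
            moreover have "indicator (?I \<inter> (\<Union>i. A i)) x = (0 :: real)"
              using False by (rule indicator_simps(2))
            ultimately show ?thesis by (simp only: tendsto_const)
          qed
        qed
        show "AE x in lborel. norm (s m x) \<le> indicator (?I \<inter> UNIV) x" for m
          by (intro AE_I2) (auto simp: sI indicator_def)
      qed (rule rls)
    qed
  qed
  have "rl f"
    using f
  proof (induction rule: integrable_induct)
    case (base A c)
    then have [measurable]: "A \<in> sets borel" by simp
    have "rl (indicator A)"
    proof (rule lim[where s="\<lambda>n. indicator ({-real n..real n} \<inter> A)" and w="indicator A"])
      show "integrable lborel (indicator A :: real \<Rightarrow> real)"
        using base by (intro integrable_real_indicator) auto
      show "AE x in lborel. (\<lambda>n. indicator ({-real n..real n} \<inter> A) x) \<longlonglongrightarrow> (indicator A x :: real)"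
      proof (rule AE_I2)
        fix x :: real
        obtain n where n: "\<bar>x\<bar> \<le> real n" using real_arch_simple by blast
        have "eventually (\<lambda>n. indicator ({-real n..real n} \<inter> A) x = (indicator A x :: real)) sequentially"
          using eventually_ge_at_top[of n]
        proof eventually_elim
          case (elim m)
          then have "real n \<le> real m" by simp
          then have "x \<in> {-real m..real m}" using n by auto
          then show ?case by (simp add: indicator_def)
        qed
        then show "(\<lambda>n. indicator ({-real n..real n} \<inter> A) x) \<longlonglongrightarrow> (indicator A x :: real)"
          by (rule tendsto_eventually)
      qed
      show "AE x in lborel. norm (indicator ({-real n..real n} \<inter> A) x :: real) \<le> indicator A x" for n
        by (intro AE_I2) (auto simp: indicator_def)
      show "rl (indicator ({-real n..real n} \<inter> A))" for n by (rule bdd) simp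
    qed auto
    then show ?case using cmult by simp
  next
    case (add f g)
    show ?case by (rule \<open>\<And>f g. integrable lborel f \<Longrightarrow> integrable lborel g \<Longrightarrow> rl f \<Longrightarrow> rl g \<Longrightarrow> rl (\<lambda>x. f x + g x)\<close>) (rule add)+
  next
    case (lim f s)
    show ?case
      by (rule \<open>\<And>f s w. integrable lborel w \<Longrightarrow> (\<And>i::nat. s i \<in> borel_measurable lborel) \<Longrightarrow> f \<in> borel_measurable lborel \<Longrightarrow>
          AE x in lborel. (\<lambda>i. s i x) \<longlonglongrightarrow> f x \<Longrightarrow> (\<And>i. AE x in lborel. norm (s i x) \<le> w x) \<Longrightarrow> (\<And>i. rl (s i)) \<Longrightarrow> rl f\<close>
          [where s=s and w="\<lambda>x. 2 * norm (f x)"]) (use lim in auto)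
  qed
  then show ?thesis by (simp add: rl_def)
qed

text \<open>Integration by parts against \<open>sin (R * p x) / (R * p1 x)\<close>.\<close>

lemma oscillatory_interval:
  fixes p p1 p2 :: "real \<Rightarrow> real"
  assumes p: "\<And>x. (p has_real_derivative p1 x) (at x)" and p1: "\<And>x. (p1 has_real_derivative p2 x) (at x)"
    and p2: "continuous_on UNIV p2" and pos: "\<And>x. p1 x > 0"
  shows "((\<lambda>R. LINT x|lborel. indicator {a..b} x * cos (R * p x)) \<longlongrightarrow> 0) at_top"
proof (cases "a \<le> b")
  case False
  then show ?thesis by simp
next
  case True
  have cp: "continuous_on A p" and cp1: "continuous_on A p1" for A
    using p p1 by (meson DERIV_continuous_on has_field_derivative_at_within)+
  have cp2: "continuous_on A p2" for A using p2 continuous_on_subset by blast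
  define E where "E = (LINT x|lborel. indicator {a..b} x *\<^sub>R \<bar>p2 x / (p1 x)\<^sup>2\<bar>)"
  have "norm (LINT x|lborel. indicator {a..b} x * cos (R * p x)) \<le> (1 / p1 b + 1 / p1 a + E) / R"
    if R: "R > 0" for R
  proof -
    have p1n: "p1 x \<noteq> 0" for x using pos[of x] by simp
    \<comment> \<open>\<open>H\<close> is the boundary term and \<open>k\<close> the remainder of
      the integration by parts: the derivative of \<open>H\<close> is
      \<open>cos (R * p x) - k x\<close>, and both carry a factor \<open>1 / R\<close>.\<close>
    define H where "H x = sin (R * p x) / (R * p1 x)" for x
    define k where "k x = sin (R * p x) * (p2 x / (p1 x)\<^sup>2) / R" for x
    have 1: "has_bochner_integral lborel (\<lambda>x. indicator {a..b} x *\<^sub>R (cos (R * p x) - k x)) (H b - H a)"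
    proof (rule has_bochner_integral_FTC_Icc[OF True])
      fix x
      have "(H has_real_derivative ((cos (R * p x) * (R * p1 x)) * (R * p1 x) - sin (R * p x) * (R * p2 x)) / ((R * p1 x) * (R * p1 x))) (at x)"
        unfolding H_def [abs_def] using R p1n[of x]
        by (intro DERIV_divide) (auto intro!: derivative_eq_intros p p1)
      also have "((cos (R * p x) * (R * p1 x)) * (R * p1 x) - sin (R * p x) * (R * p2 x)) / ((R * p1 x) * (R * p1 x)) = cos (R * p x) - k x"
        using R p1n[of x] by (simp add: k_def diff_divide_distrib power2_eq_square)
      finally show "(H has_vector_derivative cos (R * p x) - k x) (at x within {a..b})"
        by (simp add: has_real_derivative_iff_has_vector_derivative[symmetric] has_field_derivative_at_within)
    next
      show "continuous_on {a..b} (\<lambda>x. cos (R * p x) - k x)"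
        unfolding k_def using R p1n by (intro continuous_intros cp cp1 cp2) auto
    qed
    have ik: "integrable lborel (\<lambda>x. indicator {a..b} x *\<^sub>R k x)"
      unfolding k_def using R p1n
      by (intro borel_integrable_compact continuous_intros cp cp1 cp2) auto
    have iE: "integrable lborel (\<lambda>x. indicator {a..b} x *\<^sub>R \<bar>p2 x / (p1 x)\<^sup>2\<bar>)"
      using p1n by (intro borel_integrable_compact continuous_intros cp cp1 cp2) auto
    have "(LINT x|lborel. indicator {a..b} x * cos (R * p x)) =
        (LINT x|lborel. indicator {a..b} x *\<^sub>R (cos (R * p x) - k x) + indicator {a..b} x *\<^sub>R k x)"
      by (intro Bochner_Integration.integral_cong) (auto simp: algebra_simps)
    also have "\<dots> = (H b - H a) + (LINT x|lborel. indicator {a..b} x *\<^sub>R k x)"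
      using 1 ik by (subst Bochner_Integration.integral_add) (auto simp: has_bochner_integral_iff)
    finally have eq: "(LINT x|lborel. indicator {a..b} x * cos (R * p x)) =
       (H b - H a) + (LINT x|lborel. indicator {a..b} x *\<^sub>R k x)" .
    have H: "\<bar>H x\<bar> \<le> 1 / p1 x / R" for x
      using R pos[of x] by (simp add: H_def abs_mult field_simps)
    have "\<bar>LINT x|lborel. indicator {a..b} x *\<^sub>R k x\<bar> \<le> (LINT x|lborel. indicator {a..b} x *\<^sub>R \<bar>p2 x / (p1 x)\<^sup>2\<bar> / R)"
    proof (rule integral_abs_bound[THEN order_trans], rule integral_mono)
      show "integrable lborel (\<lambda>x. \<bar>indicator {a..b} x *\<^sub>R k x\<bar>)" using ik by (rule integrable_abs)
      show "integrable lborel (\<lambda>x. indicator {a..b} x *\<^sub>R \<bar>p2 x / (p1 x)\<^sup>2\<bar> / R)" by (intro integrable_divide iE)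
      fix x
      have "\<bar>sin (R * p x)\<bar> * \<bar>p2 x / (p1 x)\<^sup>2\<bar> / R \<le> 1 * \<bar>p2 x / (p1 x)\<^sup>2\<bar> / R"
        using R by (intro divide_right_mono mult_right_mono) auto
      then show "\<bar>indicator {a..b} x *\<^sub>R k x\<bar> \<le> indicator {a..b} x *\<^sub>R \<bar>p2 x / (p1 x)\<^sup>2\<bar> / R"
        using R by (auto simp: k_def indicator_def abs_mult)
    qed
    also have "\<dots> = E / R" by (simp only: E_def integral_divide_zero)
    finally have "\<bar>LINT x|lborel. indicator {a..b} x *\<^sub>R k x\<bar> \<le> E / R" .
    then show ?thesis
      unfolding eq using H[of a] H[of b] by (simp add: add_divide_distrib)
  qed
  then have "eventually (\<lambda>R. norm (LINT x|lborel. indicator {a..b} x * cos (R * p x)) \<le> (1 / p1 b + 1 / p1 a + E) / R) at_top"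
    by (intro eventually_mono[OF eventually_gt_at_top[of 0]])
  moreover have "((\<lambda>R::real. (1 / p1 b + 1 / p1 a + E) / R) \<longlongrightarrow> 0) at_top"
    by (intro real_tendsto_divide_at_top[OF tendsto_const] filterlim_ident)
  ultimately show ?thesis by (rule Lim_null_comparison)
qed

lemma oscillatory_integral:
  fixes p p1 p2 f :: "real \<Rightarrow> real"
  assumes p: "\<And>x. (p has_real_derivative p1 x) (at x)" and p1: "\<And>x. (p1 has_real_derivative p2 x) (at x)"
    and p2: "continuous_on UNIV p2" and pos: "\<And>x. p1 x > 0" and f: "integrable lborel f"
  shows "((\<lambda>R. LINT x|lborel. f x * cos (R * p x)) \<longlongrightarrow> 0) at_top"
proof (rule tendsto_integral_kernel[OF _ _ _ f])
  have "continuous_on UNIV p"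
    using p by (meson DERIV_continuous_on has_field_derivative_at_within)
  then have "p \<in> borel_measurable borel" by (rule borel_measurable_continuous_onI)
  then show "(\<lambda>x. cos (R * p x)) \<in> borel_measurable borel" for R by simp
  show "((\<lambda>R. LINT x|lborel. indicator {a..b} x * cos (R * p x)) \<longlongrightarrow> 0) at_top" for a b
    by (rule oscillatory_interval[OF p p1 p2 pos])
qed simp

section \<open>Phases along rays and the two-centre integral\<close>

lemma norm_diff_ray:
  fixes w \<xi> :: "'a::real_inner"
  assumes "norm w = 1"
  shows "norm (\<xi> - r *\<^sub>R w) = sqrt ((r - w \<bullet> \<xi>)\<^sup>2 + ((norm \<xi>)\<^sup>2 - (w \<bullet> \<xi>)\<^sup>2))"
proof -
  have "(norm (\<xi> - r *\<^sub>R w))\<^sup>2 = (r - w \<bullet> \<xi>)\<^sup>2 + ((norm \<xi>)\<^sup>2 - (w \<bullet> \<xi>)\<^sup>2)"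
    using assms unfolding power2_norm_eq_inner norm_eq_1
    by (simp add: inner_simps inner_commute power2_eq_square algebra_simps)
  then show ?thesis by (metis norm_ge_zero real_sqrt_abs abs_of_nonneg)
qed

text \<open>The distance from a point at squared distance \<open>D\<close> from the line is
  \<open>sqrt ((r - c)\<^sup>2 + D)\<close>, a branch of a hyperbola. With \<open>D > 0\<close> its
  slope lies strictly between -1 and 1, so the phase increases strictly for either sign and has no
  stationary point.\<close>

lemma oscillatory_ray:
  fixes f :: "real \<Rightarrow> real" and c D s :: real
  assumes f: "integrable lborel f" and D: "D > 0" and s: "\<bar>s\<bar> = 1"
  shows "((\<lambda>R. LINT r|lborel. f r * cos (R * (r + s * sqrt ((r - c)\<^sup>2 + D)))) \<longlongrightarrow> 0) at_top"
proof (rule oscillatory_integral[OF _ _ _ _ f,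
      where ?p1.0="\<lambda>r. 1 + s * ((r - c) / sqrt ((r - c)\<^sup>2 + D))" and ?p2.0="\<lambda>r. s * (D / sqrt ((r - c)\<^sup>2 + D) ^ 3)"])
  fix r
  let ?N = "sqrt ((r - c)\<^sup>2 + D)"
  have pos: "(r - c)\<^sup>2 + D > 0" using D by (simp add: add_nonneg_pos)
  have N: "?N > 0" "?N\<^sup>2 = (r - c)\<^sup>2 + D" using pos by auto
  have dN: "((\<lambda>r. sqrt ((r - c)\<^sup>2 + D)) has_real_derivative (r - c) / ?N) (at r)"
    using pos by (auto intro!: derivative_eq_intros simp: field_simps)
  show "((\<lambda>r. r + s * sqrt ((r - c)\<^sup>2 + D)) has_real_derivative 1 + s * ((r - c) / ?N)) (at r)"
    by (intro DERIV_add DERIV_ident DERIV_cmult dN)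
  have "((\<lambda>r. (r - c) / sqrt ((r - c)\<^sup>2 + D)) has_real_derivative (1 * ?N - (r - c) * ((r - c) / ?N)) / (?N * ?N)) (at r)"
    using N by (intro DERIV_divide dN) (auto intro!: derivative_eq_intros)
  also have "(1 * ?N - (r - c) * ((r - c) / ?N)) / (?N * ?N) = D / ?N ^ 3"
  proof -
    have "(1 * n - x * (x / n)) / (n * n) = (n\<^sup>2 - x\<^sup>2) / n ^ 3" if "n > 0" for n x :: real
      using that by (simp add: power2_eq_square power3_eq_cube diff_divide_distrib)
    from this[OF N(1), of "r - c"] show ?thesis unfolding N(2) by simp
  qed
  finally have "((\<lambda>r. (r - c) / sqrt ((r - c)\<^sup>2 + D)) has_real_derivative D / ?N ^ 3) (at r)" .
  from DERIV_add[OF DERIV_const DERIV_cmult[OF this, of s]]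
  show "((\<lambda>r. 1 + s * ((r - c) / sqrt ((r - c)\<^sup>2 + D))) has_real_derivative s * (D / ?N ^ 3)) (at r)"
    by simp
  have "\<bar>r - c\<bar> < ?N"
  proof (rule power2_less_imp_less)
    show "\<bar>r - c\<bar>\<^sup>2 < ?N\<^sup>2" unfolding N(2) using D by simp
  qed (use N in auto)
  then have "\<bar>s * ((r - c) / ?N)\<bar> < 1"
    using N s by (simp add: abs_mult)
  moreover have "0 < 1 + y" if "\<bar>y\<bar> < 1" for y :: real using that by linarith
  ultimately show "0 < 1 + s * ((r - c) / ?N)" by blast
next
  have "(r - c)\<^sup>2 + D > 0" for r using D by (simp add: add_nonneg_pos)
  then have "sqrt ((r - c)\<^sup>2 + D) ^ 3 \<noteq> 0" for r by (simp add: less_imp_neq[symmetric])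
  then show "continuous_on UNIV (\<lambda>r. s * (D / sqrt ((r - c)\<^sup>2 + D) ^ 3))"
    by (intro continuous_intros) auto
qed

text \<open>The product-to-sum formula for cosines produces the two phases of
  \<open>oscillatory_ray\<close>, with \<open>s = 1\<close> and \<open>s = -1\<close>; that
  \<open>w\<close> and \<open>\<xi>\<close> are not parallel is the condition
  \<open>D > 0\<close>.\<close>

lemma oscillatory_ray2:
  fixes f :: "real \<Rightarrow> real" and w \<xi> :: "'a::real_inner"
  assumes f: "integrable lborel f" and w: "norm w = 1" and nonpar: "(w \<bullet> \<xi>)\<^sup>2 < (norm \<xi>)\<^sup>2"
  shows "((\<lambda>R. LINT r|lborel. f r * (cos (R * r) * cos (R * norm (\<xi> - r *\<^sub>R w)))) \<longlongrightarrow> 0) at_top"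
proof -
  define c where "c = w \<bullet> \<xi>"
  define D where "D = (norm \<xi>)\<^sup>2 - (w \<bullet> \<xi>)\<^sup>2"
  have D: "D > 0" using nonpar by (simp add: D_def)
  define N where "N r = sqrt ((r - c)\<^sup>2 + D)" for r
  define A where "A s R = (LINT r|lborel. f r * cos (R * (r + s * N r)))" for s R
  have A: "(A s \<longlongrightarrow> 0) at_top" if "\<bar>s\<bar> = 1" for s
    using oscillatory_ray[OF f D that, of c] by (simp add: A_def [abs_def] N_def)
  have [measurable]: "N \<in> borel_measurable borel" unfolding N_def [abs_def] by measurable
  have int: "integrable lborel (\<lambda>r. f r * cos (R * (r + s * N r)))" for s R
  proof (rule Bochner_Integration.integrable_bound[OF f])
    show "AE r in lborel. norm (f r * cos (R * (r + s * N r))) \<le> norm (f r)"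
      by (intro AE_I2) (auto simp: abs_mult intro!: mult_left_le)
  qed (use f in measurable)
  have "(LINT r|lborel. f r * (cos (R * r) * cos (R * norm (\<xi> - r *\<^sub>R w)))) = (A 1 R + A (- 1) R) / 2" for R
  proof -
    have "(LINT r|lborel. f r * (cos (R * r) * cos (R * norm (\<xi> - r *\<^sub>R w)))) =
      (LINT r|lborel. (f r * cos (R * (r + 1 * N r)) + f r * cos (R * (r + (- 1) * N r))) / 2)"
    proof (intro Bochner_Integration.integral_cong refl)
      fix r
      have "norm (\<xi> - r *\<^sub>R w) = N r" by (simp add: norm_diff_ray[OF w] N_def c_def D_def)
      moreover have "cos (R * r) * cos (R * N r) = (cos (R * (r + 1 * N r)) + cos (R * (r + (- 1) * N r))) / 2"
        by (simp add: distrib_left right_diff_distrib cos_add cos_diff)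
      ultimately show "f r * (cos (R * r) * cos (R * norm (\<xi> - r *\<^sub>R w))) =
          (f r * cos (R * (r + 1 * N r)) + f r * cos (R * (r + (- 1) * N r))) / 2"
        by (simp only: times_divide_eq_right distrib_left)
    qed
    also have "\<dots> = (A 1 R + A (- 1) R) / 2"
      unfolding A_def by (simp only: integral_divide_zero Bochner_Integration.integral_add[OF int int])
    finally show ?thesis .
  qed
  then have "(\<lambda>R. LINT r|lborel. f r * (cos (R * r) * cos (R * norm (\<xi> - r *\<^sub>R w)))) =
      (\<lambda>R. (A 1 R + A (- 1) R) / 2)" by (rule ext)
  moreover have "((\<lambda>R. (A 1 R + A (- 1) R) / 2) \<longlongrightarrow> (0 + 0) / 2) at_top"
    by (intro tendsto_intros A) auto
  ultimately show ?thesis by (simp only:) simp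
qed

text \<open>Equality in the Cauchy-Schwarz inequality means height 1 or -1 over the direction of
  \<open>\<xi>\<close>, and the law of the height has no atoms.\<close>

lemma AE_sigma2_nonparallel:
  assumes "\<xi> \<noteq> 0"
  shows "AE w in sigma2. (w \<bullet> \<xi>)\<^sup>2 < (norm \<xi>)\<^sup>2"
proof -
  define a where "a = \<xi> /\<^sub>R norm \<xi>"
  have a: "norm a = 1" and \<xi>: "\<xi> = norm \<xi> *\<^sub>R a" using assms by (auto simp: a_def)
  have "AE t::real in density lborel (\<lambda>t. ennreal (indicator {-1..1} t / 2)). t \<noteq> 1 \<and> t \<noteq> -1"
  proof -
    have "AE t::real in lborel. t \<noteq> 1 \<and> t \<noteq> -1"
      using AE_lborel_singleton[of "1::real"] AE_lborel_singleton[of "-1::real"] by eventually_elim simp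
    then have ae: "AE t::real in lborel. 0 < ennreal (indicator {-1..1} t / 2) \<longrightarrow> t \<noteq> 1 \<and> t \<noteq> -1"
      by eventually_elim simp
    have f: "(\<lambda>t. ennreal (indicator {-1..1} t / 2)) \<in> borel_measurable (lborel :: real measure)"
      by measurable
    show ?thesis by (rule iffD2[OF AE_density[OF f] ae])
  qed
  then have "AE w in sigma2. a \<bullet> w \<noteq> 1 \<and> a \<bullet> w \<noteq> -1"
    unfolding distr_inner_sigma2[OF a, symmetric] by (subst (asm) AE_distr_iff) auto
  then show ?thesis
    using AE_space
  proof eventually_elim
    case (elim w)
    then have "norm w = 1" by simp
    then have "\<bar>a \<bullet> w\<bar> \<le> 1" using Cauchy_Schwarz_ineq2[of a w] a by simp
    then have "\<bar>a \<bullet> w\<bar> < 1" using elim by (auto simp: abs_if split: if_splits)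
    then have "(a \<bullet> w)\<^sup>2 < 1" by (simp add: abs_square_less_1)
    then have "(norm \<xi>)\<^sup>2 * (a \<bullet> w)\<^sup>2 < (norm \<xi>)\<^sup>2 * 1" using assms by (intro mult_strict_left_mono) auto
    moreover have "w \<bullet> \<xi> = norm \<xi> * (a \<bullet> w)" by (subst \<xi>) (simp add: inner_commute)
    ultimately show ?case by (simp add: power_mult_distrib)
  qed
qed

text \<open>On a ray from the origin not parallel to \<open>\<xi>\<close>, both phases \<open>norm q + norm (\<xi> - q)\<close> and
  \<open>norm q - norm (\<xi> - q)\<close> have positive derivative.\<close>

lemma oscillatory_two_centres:
  fixes h :: "real^3 \<Rightarrow> real"
  assumes h: "integrable lborel h" and \<xi>: "\<xi> \<noteq> 0"
  shows "((\<lambda>R. LINT q|lborel. h q * (cos (R * norm q) * cos (R * norm (\<xi> - q)))) \<longlongrightarrow> 0) at_top"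
proof -
  define k where "k R q = cos (R * norm q) * cos (R * norm (\<xi> - q))" for R q
  have [measurable]: "k R \<in> borel_measurable borel" for R unfolding k_def [abs_def] by measurable
  have [measurable]: "h \<in> borel_measurable borel" using h by auto
  have k: "\<bar>k R q\<bar> \<le> 1" for R q
    unfolding k_def abs_mult by (intro mult_le_one) auto
  have hk: "integrable lborel (\<lambda>q. h q * k R q)" for R
  proof (rule Bochner_Integration.integrable_bound[OF h])
    show "AE q in lborel. norm (h q * k R q) \<le> norm (h q)"
      using k by (intro AE_I2) (auto simp: abs_mult intro!: mult_left_le)
  qed measurable
  define J where "J R w = (LINT r|radial_measure. h (r *\<^sub>R w) * k R (r *\<^sub>R w))" for R w
  have eq: "(LINT q|lborel. h q * k R q) = (LINT w|sigma2. J R w)" for R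
    unfolding J_def by (rule integral_polar(2)[OF hk])
  \<comment> \<open>Directions are the outer variable: for almost every \<open>w\<close> the radial
    integral vanishes in the limit by \<open>oscillatory_ray2\<close>, with the Jacobian absorbed
    into the amplitude, and the radial integrals of \<open>\<bar>h\<bar>\<close> dominate.\<close>
  have "((\<lambda>R. LINT w|sigma2. J R w) \<longlongrightarrow> (LINT w|sigma2. 0)) at_top"
  proof (rule integral_dominated_convergence_at_top[where w="\<lambda>w. LINT r|radial_measure. \<bar>h (r *\<^sub>R w)\<bar>"])
    show "J R \<in> borel_measurable sigma2" for R
      using radial_sigma2.integrable_snd[OF integrable_polar[OF hk[of R]]]
      unfolding J_def [abs_def] by (rule borel_measurable_integrable)
    show "integrable sigma2 (\<lambda>w. LINT r|radial_measure. \<bar>h (r *\<^sub>R w)\<bar>)"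
      by (rule radial_sigma2.integrable_snd[OF integrable_polar[OF integrable_abs[OF h]]])
    have ae: "AE w in sigma2. integrable radial_measure (\<lambda>r. h (r *\<^sub>R w))"
      by (rule radial_sigma2.AE_integrable_snd[OF integrable_polar[OF h]])
    show "\<forall>\<^sub>F R in at_top. AE w in sigma2. norm (J R w) \<le> (LINT r|radial_measure. \<bar>h (r *\<^sub>R w)\<bar>)"
    proof (rule always_eventually, rule allI)
      fix R
      show "AE w in sigma2. norm (J R w) \<le> (LINT r|radial_measure. \<bar>h (r *\<^sub>R w)\<bar>)"
        using ae
      proof eventually_elim
        case (elim w)
        show ?case
          unfolding J_def real_norm_def
        proof (rule integral_abs_bound[THEN order_trans], rule integral_mono_AE')
          show "AE r in radial_measure. \<bar>h (r *\<^sub>R w) * k R (r *\<^sub>R w)\<bar> \<le> \<bar>h (r *\<^sub>R w)\<bar>"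
            using k by (intro AE_I2) (auto simp: abs_mult intro!: mult_left_le)
        qed (use elim in auto)
      qed
    qed
    show "AE w in sigma2. ((\<lambda>R. J R w) \<longlongrightarrow> 0) at_top"
      using ae AE_sigma2_nonparallel[OF \<xi>] AE_space
    proof eventually_elim
      case (elim w)
      then have w: "norm w = 1" by simp
      define f where "f r = indicator {0<..} r * (4 * pi * r\<^sup>2 * h (r *\<^sub>R w))" for r
      have "set_integrable lborel {0<..} (\<lambda>r. (4 * pi * r\<^sup>2) *\<^sub>R h (r *\<^sub>R w))"
        using elim(1) by (subst (asm) integrable_radial_measure) auto
      then have f: "integrable lborel f"
        by (simp add: set_integrable_def f_def [abs_def])
      have "J R w = (LINT r|lborel. f r * (cos (R * r) * cos (R * norm (\<xi> - r *\<^sub>R w))))" for R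
        unfolding J_def by (subst integral_radial_measure)
          (auto simp: set_lebesgue_integral_def f_def k_def w indicator_def intro!: Bochner_Integration.integral_cong)
      then show ?case using oscillatory_ray2[OF f w elim(2)] by simp
    qed
  qed auto
  then show ?thesis unfolding k_def[symmetric] eq by simp
qed

lemma snc_tendsto_0: "k > 0 \<Longrightarrow> ((\<lambda>R. snc (R * k)) \<longlongrightarrow> 0) at_top"
proof -
  assume k: "k > 0"
  show ?thesis
  proof (rule Lim_null_comparison)
    show "eventually (\<lambda>R. norm (snc (R * k)) \<le> 1 / (R * k)) at_top"
      using eventually_gt_at_top[of 0]
      by eventually_elim (use k in \<open>auto simp: snc_def abs_mult field_simps\<close>)
    show "((\<lambda>R. 1 / (R * k)) \<longlongrightarrow> 0) at_top" using k by real_asymp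
  qed
qed

text \<open>Expanding the product of the two \<open>osc\<close> factors leaves three terms with a
  factor \<open>snc\<close>, collected in \<open>D\<close>, which tend to 0 pointwise and are
  handled by dominated convergence, and one product of cosines, \<open>C\<close>, which does not
  decay and needs the two-centre oscillation.\<close>

lemma err_tendsto:
  assumes a: "norm a = 1" and b: "norm b = 1" and ab: "a + b \<noteq> 0"
  shows "((\<lambda>R. err R a b / R\<^sup>2) \<longlongrightarrow> 0) at_top"
proof -
  define h where "h = err_kernel a b"
  define \<xi> where "\<xi> = a + b"
  have h: "integrable lborel h" unfolding h_def by (rule err_kernel_integrable[OF a b ab])
  have [measurable]: "h \<in> borel_measurable borel" using h by auto
  define D where "D R q = 16 * pi\<^sup>2 * (snc (R * norm q) * snc (R * norm (\<xi> - q)) - snc (R * norm q) * cos (R * norm (\<xi> - q))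
    - cos (R * norm q) * snc (R * norm (\<xi> - q)))" for R q
  define C where "C R q = 16 * pi\<^sup>2 * (cos (R * norm q) * cos (R * norm (\<xi> - q)))" for R q
  have [measurable]: "D R \<in> borel_measurable borel" "C R \<in> borel_measurable borel" for R
    unfolding D_def [abs_def] C_def [abs_def] by measurable
  have osc: "osc (R * norm q) * osc (R * norm (\<xi> - q)) = D R q + C R q" for R q
    by (simp add: osc_def D_def C_def algebra_simps power2_eq_square)
  have D: "\<bar>D R q\<bar> \<le> 48 * pi\<^sup>2" for R q
  proof -
    have "\<bar>x * y\<bar> \<le> 1" if "\<bar>x\<bar> \<le> 1" "\<bar>y\<bar> \<le> 1" for x y :: real
      unfolding abs_mult using that by (intro mult_le_one) auto
    then have "\<bar>snc (R * norm q) * snc (R * norm (\<xi> - q))\<bar> \<le> 1" "\<bar>snc (R * norm q) * cos (R * norm (\<xi> - q))\<bar> \<le> 1"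
      "\<bar>cos (R * norm q) * snc (R * norm (\<xi> - q))\<bar> \<le> 1"
      by (simp_all add: abs_snc_le)
    then have "\<bar>snc (R * norm q) * snc (R * norm (\<xi> - q)) - snc (R * norm q) * cos (R * norm (\<xi> - q))
      - cos (R * norm q) * snc (R * norm (\<xi> - q))\<bar> \<le> 3" by linarith
    then have "16 * pi\<^sup>2 * \<bar>snc (R * norm q) * snc (R * norm (\<xi> - q)) - snc (R * norm q) * cos (R * norm (\<xi> - q))
      - cos (R * norm q) * snc (R * norm (\<xi> - q))\<bar> \<le> 16 * pi\<^sup>2 * 3" by (intro mult_left_mono) auto
    then show ?thesis by (simp add: D_def abs_mult)
  qed
  have C: "\<bar>C R q\<bar> \<le> 16 * pi\<^sup>2" for R q
  proof -
    have "\<bar>cos (R * norm q)\<bar> * \<bar>cos (R * norm (\<xi> - q))\<bar> \<le> 1" by (intro mult_le_one) auto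
    then have "16 * pi\<^sup>2 * (\<bar>cos (R * norm q)\<bar> * \<bar>cos (R * norm (\<xi> - q))\<bar>) \<le> 16 * pi\<^sup>2 * 1" by (intro mult_left_mono) auto
    then show ?thesis by (simp add: C_def abs_mult)
  qed
  have int: "integrable lborel (\<lambda>q. h q * u q)" if [measurable]: "u \<in> borel_measurable borel" and u: "\<And>q. \<bar>u q\<bar> \<le> c" for u c
  proof (rule Bochner_Integration.integrable_bound)
    show "integrable lborel (\<lambda>q. h q * c)" using h by (rule integrable_mult_left)
    show "AE q in lborel. norm (h q * u q) \<le> norm (h q * c)"
    proof (rule AE_I2)
      fix q
      have "\<bar>u q\<bar> \<le> \<bar>c\<bar>" using u[of q] by linarith
      then show "norm (h q * u q) \<le> norm (h q * c)" by (simp add: abs_mult mult_left_mono)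
    qed
  qed measurable
  have "((\<lambda>R. LINT q|lborel. h q * D R q) \<longlongrightarrow> (LINT q::real^3|lborel. 0)) at_top"
  proof (rule integral_dominated_convergence_at_top[where w="\<lambda>q. 48 * pi\<^sup>2 * \<bar>h q\<bar>"])
    show "AE q in lborel. ((\<lambda>R. h q * D R q) \<longlongrightarrow> 0) at_top"
      using AE_lborel_singleton[of 0] AE_lborel_singleton[of \<xi>]
    proof eventually_elim
      case (elim q)
      have 1: "((\<lambda>R. snc (R * norm q)) \<longlongrightarrow> 0) at_top" "((\<lambda>R. snc (R * norm (\<xi> - q))) \<longlongrightarrow> 0) at_top"
        using elim by (auto intro!: snc_tendsto_0)
      have bounded0: "((\<lambda>R. f R * cos (g R)) \<longlongrightarrow> 0) at_top" if "(f \<longlongrightarrow> 0) at_top" for f g :: "real \<Rightarrow> real"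
      proof (rule Lim_null_comparison[OF _ tendsto_rabs_zero[OF that]])
        show "\<forall>\<^sub>F R in at_top. norm (f R * cos (g R)) \<le> \<bar>f R\<bar>"
          by (intro always_eventually allI) (auto simp: abs_mult intro!: mult_left_le)
      qed
      have "((\<lambda>R. snc (R * norm q) * snc (R * norm (\<xi> - q)) - snc (R * norm q) * cos (R * norm (\<xi> - q))
          - snc (R * norm (\<xi> - q)) * cos (R * norm q)) \<longlongrightarrow> 0 * 0 - 0 - 0) at_top"
        by (intro tendsto_diff tendsto_mult 1 bounded0)
      then have "((\<lambda>R. h q * (16 * pi\<^sup>2 * (snc (R * norm q) * snc (R * norm (\<xi> - q)) - snc (R * norm q) * cos (R * norm (\<xi> - q))
          - snc (R * norm (\<xi> - q)) * cos (R * norm q)))) \<longlongrightarrow> h q * (16 * pi\<^sup>2 * (0 * 0 - 0 - 0))) at_top"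
        by (intro tendsto_mult tendsto_const)
      then show ?case by (simp add: D_def mult.commute[of "cos _" "snc _"])
    qed
    show "\<forall>\<^sub>F R in at_top. AE q in lborel. norm (h q * D R q) \<le> 48 * pi\<^sup>2 * \<bar>h q\<bar>"
      using D by (intro always_eventually allI AE_I2) (subst mult.commute, simp add: abs_mult mult_right_mono)
  qed (use h in \<open>auto\<close>)
  moreover have "((\<lambda>R. LINT q|lborel. h q * C R q) \<longlongrightarrow> 16 * pi\<^sup>2 * 0) at_top"
  proof -
    have "(LINT q|lborel. h q * C R q) = 16 * pi\<^sup>2 * (LINT q|lborel. h q * (cos (R * norm q) * cos (R * norm (\<xi> - q))))" for R
      by (subst integral_mult_right_zero[symmetric]) (simp add: C_def mult_ac)
    moreover have "\<xi> \<noteq> 0" using ab by (simp add: \<xi>_def)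
    ultimately show ?thesis
      using tendsto_mult[OF tendsto_const oscillatory_two_centres[OF h], of "\<xi>" "16 * pi\<^sup>2"] by simp
  qed
  ultimately have "((\<lambda>R. (LINT q|lborel. h q * D R q) + (LINT q|lborel. h q * C R q)) \<longlongrightarrow> 0 + 16 * pi\<^sup>2 * 0) at_top"
    by (intro tendsto_add) simp_all
  moreover have "eventually (\<lambda>R. (LINT q|lborel. h q * D R q) + (LINT q|lborel. h q * C R q) = err R a b / R\<^sup>2) at_top"
    using eventually_gt_at_top[of 0]
  proof eventually_elim
    case (elim R)
    have "err R a b / R\<^sup>2 = (LINT q|lborel. h q * (D R q + C R q))"
      using elim by (simp add: err_eq h_def osc[unfolded \<xi>_def])
    also have "\<dots> = (LINT q|lborel. h q * D R q) + (LINT q|lborel. h q * C R q)"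
      unfolding distrib_left by (intro Bochner_Integration.integral_add int[OF _ D] int[OF _ C]) measurable
    finally show ?case ..
  qed
  ultimately show ?thesis
    using tendsto_cong by fastforce
qed

subsection \<open>The main term and the limit\<close>

abbreviation sigma22 :: "((real^3) \<times> (real^3)) measure" where
  "sigma22 \<equiv> sigma2 \<Otimes>\<^sub>M sigma2"

lemma sigma22_measurableI:
  fixes f :: "(real^3) \<times> (real^3) \<Rightarrow> 'c::topological_space"
  assumes "f \<in> borel_measurable (borel \<Otimes>\<^sub>M borel)"
  shows "f \<in> borel_measurable sigma22"
proof -
  have "(\<lambda>z. (fst z, snd z)) \<in> sigma22 \<rightarrow>\<^sub>M borel \<Otimes>\<^sub>M borel"
    by (intro measurable_Pair measurable_compose[OF measurable_fst id_measurable_sigma2]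
        measurable_compose[OF measurable_snd id_measurable_sigma2])
  from measurable_compose[OF this assms] show ?thesis by simp
qed

lemma norm_sum_measurable:
  fixes g :: "real \<Rightarrow> real"
  assumes [measurable]: "g \<in> borel_measurable borel"
  shows "(\<lambda>z. g (norm (fst z + snd z))) \<in> borel_measurable sigma22"
  by (rule sigma22_measurableI) measurable

text \<open>For every fixed unit vector \<open>a\<close> the norm of \<open>a + w\<close> has the
  same law with density \<open>r / 2\<close>, so the outer average over \<open>a\<close> is that of
  a constant.\<close>

lemma sigma22_norm_sum:
  fixes g :: "real \<Rightarrow> real"
  assumes g [measurable]: "g \<in> borel_measurable borel"
    and int: "integrable lborel (\<lambda>r. indicator {0..2} r * (r / 2) * g r)"
  shows "integrable sigma22 (\<lambda>z. g (norm (fst z + snd z)))"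
    and "(LINT z|sigma22. g (norm (fst z + snd z))) = (LINT r|lborel. indicator {0..2} r * (r / 2) * g r)"
proof -
  have nn: "0 \<le> indicator {0..2} r * (r / 2 :: real)" for r :: real
    by (simp add: indicator_def)
  have dm: "(\<lambda>r::real. indicator {0..2} r * (r / 2) :: real) \<in> borel_measurable lborel"
    by measurable
  have law: "(LINT w|sigma2. g (norm (a + w))) = (LINT r|lborel. indicator {0..2} r * (r / 2) * g r)"
    if "norm a = 1" for a :: "real^3"
  proof -
    have "(LINT w|sigma2. g (norm (a + w))) = (LINT r|distr sigma2 borel (\<lambda>w. norm (a + w)). g r)"
      by (rule integral_distr[symmetric]) measurable
    also have "\<dots> = (LINT r|lborel. indicator {0..2} r * (r / 2) * g r)"
      unfolding distr_norm_add_sigma2[OF that] using dm nn by (subst integral_density) auto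
    finally show ?thesis .
  qed
  have nlaw: "(\<integral>\<^sup>+w. ennreal \<bar>g (norm (a + w))\<bar> \<partial>sigma2) = (\<integral>\<^sup>+r. ennreal \<bar>indicator {0..2} r * (r / 2) * g r\<bar> \<partial>lborel)"
    if "norm a = 1" for a :: "real^3"
  proof -
    have "(\<integral>\<^sup>+w. ennreal \<bar>g (norm (a + w))\<bar> \<partial>sigma2) = (\<integral>\<^sup>+r. ennreal \<bar>g r\<bar> \<partial>distr sigma2 borel (\<lambda>w. norm (a + w)))"
      by (rule nn_integral_distr[symmetric]) measurable
    also have "\<dots> = (\<integral>\<^sup>+r. ennreal (indicator {0..2} r * (r / 2)) * ennreal \<bar>g r\<bar> \<partial>lborel)"
      unfolding distr_norm_add_sigma2[OF that] using dm by (subst nn_integral_density) auto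
    also have "\<dots> = (\<integral>\<^sup>+r. ennreal \<bar>indicator {0..2} r * (r / 2) * g r\<bar> \<partial>lborel)"
      by (intro nn_integral_cong) (auto simp: abs_mult indicator_def ennreal_mult[symmetric])
    finally show ?thesis .
  qed
  have m: "(\<lambda>z. g (norm (fst z + snd z))) \<in> borel_measurable sigma22"
    by (rule norm_sum_measurable[OF g])
  show *: "integrable sigma22 (\<lambda>z. g (norm (fst z + snd z)))"
  proof (rule integrableI_bounded[OF m])
    have "(\<integral>\<^sup>+z. ennreal (norm (g (norm (fst z + snd z)))) \<partial>sigma22) =
        (\<integral>\<^sup>+a. (\<integral>\<^sup>+w. ennreal \<bar>g (norm (a + w))\<bar> \<partial>sigma2) \<partial>sigma2)"
      using m by (subst sigma2.nn_integral_fst[symmetric]) auto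
    also have "\<dots> = (\<integral>\<^sup>+a. (\<integral>\<^sup>+r. ennreal \<bar>indicator {0..2} r * (r / 2) * g r\<bar> \<partial>lborel) \<partial>sigma2)"
      by (intro nn_integral_cong nlaw) simp
    also have "\<dots> = (\<integral>\<^sup>+r. ennreal \<bar>indicator {0..2} r * (r / 2) * g r\<bar> \<partial>lborel)"
      using emeasure_sigma2_space by simp
    also have "\<dots> < \<infinity>" using int unfolding integrable_iff_bounded by simp
    finally show "(\<integral>\<^sup>+z. ennreal (norm (g (norm (fst z + snd z)))) \<partial>sigma22) < \<infinity>" .
  qed
  have "(LINT z|sigma22. g (norm (fst z + snd z))) = (LINT a|sigma2. LINT w|sigma2. g (norm (a + w)))"
    using sigma2_pair.integral_fst'[OF *] by simp
  also have "\<dots> = (LINT a|sigma2. LINT r|lborel. indicator {0..2} r * (r / 2) * g r)"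
    by (intro Bochner_Integration.integral_cong refl law) simp
  also have "\<dots> = (LINT r|lborel. indicator {0..2} r * (r / 2) * g r)"
    using sigma2.prob_space by simp
  finally show "(LINT z|sigma22. g (norm (fst z + snd z))) = (LINT r|lborel. indicator {0..2} r * (r / 2) * g r)" .
qed

lemma integrable_inverse_norm_sum: "integrable sigma22 (\<lambda>z. 1 / norm (fst z + snd z))"
proof (rule sigma22_norm_sum(1))
  have "integrable lborel (\<lambda>r::real. indicator {0..2} r * (1 / 2 :: real))"
    by (intro integrable_mult_left integrable_real_indicator) (auto simp: emeasure_lborel_Icc_eq)
  then show "integrable lborel (\<lambda>r::real. indicator {0..2} r * (r / 2) * (1 / r))"
  proof (rule integrable_cong_AE_imp)
    show "AE r in lborel. indicator {0..2} r * (1 / 2 :: real) = indicator {0..2} r * (r / 2) * (1 / r)"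
      using AE_lborel_singleton[of 0] by eventually_elim simp
  qed measurable
qed measurable

lemma AE_sigma22_sum_nonzero: "AE z in sigma22. fst z + snd z \<noteq> 0"
proof (rule sigma2_pair.AE_pair_measure)
  have "(\<lambda>z. norm (fst z + snd z)) \<in> borel_measurable sigma22"
    using norm_sum_measurable[of "\<lambda>x. x"] by simp
  then have "{z \<in> space sigma22. norm (fst z + snd z) \<noteq> 0} \<in> sets sigma22" by measurable
  then show "{z \<in> space sigma22. fst z + snd z \<noteq> 0} \<in> sets sigma22" by simp
  show "AE a in sigma2. AE b in sigma2. fst (a, b) + snd (a, b) \<noteq> 0"
    using AE_space
  proof eventually_elim
    case (elim a)
    then have a: "norm a = 1" by simp
    have f: "(\<lambda>r::real. ennreal (indicator {0..2} r * (r / 2))) \<in> borel_measurable lborel" by measurable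
    have "AE r::real in lborel. 0 < ennreal (indicator {0..2} r * (r / 2)) \<longrightarrow> r \<noteq> 0"
      using AE_lborel_singleton[of "0::real"] by eventually_elim simp
    then have "AE r::real in density lborel (\<lambda>r. ennreal (indicator {0..2} r * (r / 2))). r \<noteq> 0"
      by (rule iffD2[OF AE_density[OF f]])
    then have "AE b in sigma2. norm (a + b) \<noteq> 0"
      unfolding distr_norm_add_sigma2[OF a, symmetric]
      by (subst (asm) AE_distr_iff) (auto intro: norm_add_measurable_sigma2)
    then show ?case by simp
  qed
qed

lemma err_measurable: "(\<lambda>z. err R (fst z) (snd z)) \<in> borel_measurable sigma22"
proof (rule sigma22_measurableI)
  have 1: "(\<lambda>(z, q). rho (q - fst z)) \<in> borel_measurable ((borel \<Otimes>\<^sub>M borel) \<Otimes>\<^sub>M (lborel :: (real^3) measure))"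
    unfolding case_prod_unfold by (rule measurable_compose[OF _ rho_measurable]) measurable
  have 2: "(\<lambda>(z, q). ball_ft R (norm q) * ball_ft R (norm (fst z + snd z - q))) \<in> borel_measurable ((borel \<Otimes>\<^sub>M borel) \<Otimes>\<^sub>M (lborel :: (real^3) measure))"
    by measurable
  have "(\<lambda>(z, q). (rho (q - fst z) - 1 / (8 * pi)) * (ball_ft R (norm q) * ball_ft R (norm (fst z + snd z - q))))
      \<in> borel_measurable ((borel \<Otimes>\<^sub>M borel) \<Otimes>\<^sub>M (lborel :: (real^3) measure))"
    using borel_measurable_times[OF borel_measurable_diff[OF 1 borel_measurable_const[of "1 / (8 * pi)"]] 2]
    by (simp add: case_prod_unfold)
  then show "(\<lambda>z. err R (fst z) (snd z)) \<in> borel_measurable (borel \<Otimes>\<^sub>M borel)"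
    unfolding err_def by (rule lborel.borel_measurable_lebesgue_integral)
qed

text \<open>Squaring turns the power -1/2 of \<open>abs_err_le\<close> into -1, which is integrable
  against the density \<open>r / 2\<close>; the majorant does not depend on
  \<open>R\<close>.\<close>

lemma err_square_bound:
  assumes R: "R > 0"
  shows "AE z in sigma22. norm ((err R (fst z) (snd z) / R\<^sup>2)\<^sup>2) \<le> (64 * pi\<^sup>2 * err_const)\<^sup>2 * (1 / norm (fst z + snd z))"
  using AE_sigma22_sum_nonzero AE_space
proof eventually_elim
  case (elim z)
  define x where "x = norm (fst z + snd z)"
  define C where "C = 64 * pi\<^sup>2 * err_const"
  have x: "x > 0" using elim by (simp add: x_def)
  have "\<bar>err R (fst z) (snd z)\<bar> \<le> R\<^sup>2 * (C / sqrt x)"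
    unfolding C_def x_def using elim R by (intro abs_err_le) (auto simp: space_pair_measure mem_Times_iff)
  then have "\<bar>err R (fst z) (snd z) / R\<^sup>2\<bar> \<le> C / sqrt x"
    using R by (simp add: pos_divide_le_eq mult.commute)
  then have "\<bar>err R (fst z) (snd z) / R\<^sup>2\<bar>\<^sup>2 \<le> (C / sqrt x)\<^sup>2"
    by (rule power_mono) simp
  then show ?case
    using x unfolding C_def[symmetric] x_def[symmetric] by (simp add: power_divide)
qed

lemma err_square:
  shows "R > 0 \<Longrightarrow> integrable sigma22 (\<lambda>z. (err R (fst z) (snd z) / R\<^sup>2)\<^sup>2)"
    and "((\<lambda>R. LINT z|sigma22. (err R (fst z) (snd z) / R\<^sup>2)\<^sup>2) \<longlongrightarrow> 0) at_top"
proof -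
  let ?w = "\<lambda>z. (64 * pi\<^sup>2 * err_const)\<^sup>2 * (1 / norm (fst z + snd z :: real^3))"
  have w: "integrable sigma22 ?w"
    by (intro integrable_mult_right integrable_inverse_norm_sum)
  have m: "(\<lambda>z. (err R (fst z) (snd z) / R\<^sup>2)\<^sup>2) \<in> borel_measurable sigma22" for R
    using err_measurable[of R] by measurable
  show "integrable sigma22 (\<lambda>z. (err R (fst z) (snd z) / R\<^sup>2)\<^sup>2)" if "R > 0"
  proof (rule Bochner_Integration.integrable_bound[OF w m])
    show "AE z in sigma22. norm ((err R (fst z) (snd z) / R\<^sup>2)\<^sup>2) \<le> norm (?w z)"
      using err_square_bound[OF that] by eventually_elim simp
  qed
  have "((\<lambda>R. LINT z|sigma22. (err R (fst z) (snd z) / R\<^sup>2)\<^sup>2) \<longlongrightarrow> (LINT z|sigma22. 0)) at_top"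
  proof (rule integral_dominated_convergence_at_top[OF _ m w])
    show "\<forall>\<^sub>F R in at_top. AE z in sigma22. norm ((err R (fst z) (snd z) / R\<^sup>2)\<^sup>2) \<le> ?w z"
      by (intro eventually_mono[OF eventually_gt_at_top[of 0]] err_square_bound)
    show "AE z in sigma22. ((\<lambda>R. (err R (fst z) (snd z) / R\<^sup>2)\<^sup>2) \<longlongrightarrow> 0) at_top"
      using AE_sigma22_sum_nonzero AE_space
    proof eventually_elim
      case (elim z)
      have "((\<lambda>R. (err R (fst z) (snd z) / R\<^sup>2)\<^sup>2) \<longlongrightarrow> 0\<^sup>2) at_top"
        using elim by (intro tendsto_power err_tendsto) (auto simp: space_pair_measure mem_Times_iff)
      then show ?case by simp
    qed
  qed simp
  then show "((\<lambda>R. LINT z|sigma22. (err R (fst z) (snd z) / R\<^sup>2)\<^sup>2) \<longlongrightarrow> 0) at_top"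
    by simp
qed

text \<open>An elementary antiderivative of the integrand of the main term. Its limits are
  \<open>- 1 / 4\<close> at 0 from the right and 0 at infinity, which accounts for the total
  \<open>1 / 4\<close>.\<close>

definition main_prim :: "real \<Rightarrow> real" where
  "main_prim s = - (sin s)\<^sup>2 / (4 * s ^ 4) + sin s * cos s / (2 * s ^ 3) - 1 / (4 * s\<^sup>2)"

lemma main_prim_deriv:
  assumes s: "s > 0"
  shows "(main_prim has_real_derivative (sin s - s * cos s)\<^sup>2 / s ^ 5) (at s)"
proof -
  define S where "S = sin s"
  define C where "C = cos s"
  have sc: "S\<^sup>2 + C\<^sup>2 = 1" by (simp add: S_def C_def)
  have p: "((\<lambda>s. 1 / s ^ n) has_real_derivative - real n / s ^ Suc n) (at s)" for n
  proof (cases n)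
    case (Suc m)
    have "((\<lambda>s. 1 / s ^ n) has_real_derivative (0 * s ^ n - 1 * (real n * s ^ (n - Suc 0))) / (s ^ n * s ^ n)) (at s)"
      using s by (intro DERIV_divide DERIV_const DERIV_pow) auto
    then show ?thesis using s by (simp add: Suc del: of_nat_Suc)
  qed simp
  have p': "((\<lambda>s. 1 / s ^ 2) has_real_derivative - 2 / s ^ 3) (at s)"
    "((\<lambda>s. 1 / s ^ 3) has_real_derivative - 3 / s ^ 4) (at s)"
    "((\<lambda>s. 1 / s ^ 4) has_real_derivative - 4 / s ^ 5) (at s)"
    using p[of 2] p[of 3] p[of 4] by simp_all
  have d: "((\<lambda>s. (sin s)\<^sup>2) has_real_derivative 2 * sin s * cos s) (at s)"
    "((\<lambda>s. sin s * cos s) has_real_derivative cos s * cos s - sin s * sin s) (at s)"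
    by (auto intro!: derivative_eq_intros)
  have "((\<lambda>s. - (1 / 4) * ((sin s)\<^sup>2 * (1 / s ^ 4)) + (1 / 2) * (sin s * cos s * (1 / s ^ 3)) - (1 / 4) * (1 / s ^ 2))
     has_real_derivative
     - (1 / 4) * (2 * S * C * (1 / s ^ 4) + - 4 / s ^ 5 * S\<^sup>2) + (1 / 2) * ((C * C - S * S) * (1 / s ^ 3) + - 3 / s ^ 4 * (S * C))
      - (1 / 4) * (- 2 / s ^ 3)) (at s)"
    unfolding S_def C_def by (intro DERIV_diff DERIV_add DERIV_cmult DERIV_mult d p')
  also have "(\<lambda>s. - (1 / 4) * ((sin s)\<^sup>2 * (1 / s ^ 4)) + (1 / 2) * (sin s * cos s * (1 / s ^ 3)) - (1 / 4) * (1 / s ^ 2)) = main_prim"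
    by (simp add: main_prim_def fun_eq_iff)
  also have "- (1 / 4) * (2 * S * C * (1 / s ^ 4) + - 4 / s ^ 5 * S\<^sup>2) + (1 / 2) * ((C * C - S * S) * (1 / s ^ 3) + - 3 / s ^ 4 * (S * C))
      - (1 / 4) * (- 2 / s ^ 3) = (S - s * C)\<^sup>2 / s ^ 5"
  proof -
    \<comment> \<open>In units of \<open>1 / s ^ 5\<close> the identity is polynomial; the summand
      \<open>- 1 / (4 * s\<^sup>2)\<close> of \<open>main_prim\<close> supplies the 1 in
      \<open>C\<^sup>2 - S\<^sup>2 + 1 = 2 * C\<^sup>2\<close>.\<close>
    define i where "i = 1 / s ^ 5"
    have e: "1 / s ^ 4 = s * i" "1 / s ^ 3 = s * s * i" "- 4 / s ^ 5 = - 4 * i"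
        "- 3 / s ^ 4 = - 3 * (s * i)" "- 2 / s ^ 3 = - 2 * (s * s * i)" "(S - s * C)\<^sup>2 / s ^ 5 = (S - s * C)\<^sup>2 * i"
      using s by (simp_all add: i_def numeral_eq_Suc)
    have "- (1 / 4) * (2 * S * C * (s * i) + - 4 * i * S\<^sup>2) + (1 / 2) * ((C * C - S * S) * (s * s * i) + - 3 * (s * i) * (S * C))
      - (1 / 4) * (- 2 * (s * s * i)) = i * (S\<^sup>2 - 2 * S * C * s + (s * s) * (C\<^sup>2 - S\<^sup>2 + 1) / 2)"
      by (simp add: field_simps power2_eq_square)
    also have "\<dots> = i * (S\<^sup>2 - 2 * S * C * s + (s * s) * C\<^sup>2)"
      by (simp add: sc[symmetric])
    also have "\<dots> = (S - s * C)\<^sup>2 * i"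
      by (simp add: power2_eq_square algebra_simps)
    finally show ?thesis
      by (simp only: e)
  qed
  finally show ?thesis by (simp add: S_def C_def)
qed

text \<open>The density \<open>r / 2\<close> times \<open>pi ^ 4 * (4 * pi)\<^sup>2\<close> gives
  the constant \<open>8 * pi ^ 6\<close>, and under \<open>s = R * r\<close> the powers of
  \<open>R\<close> cancel, so that \<open>R\<close> survives only in the endpoint
  \<open>2 * R\<close>.\<close>

lemma main_integral:
  assumes R: "R > 0"
  shows "integrable lborel (\<lambda>r. indicator {0..2} r * (r / 2) * (pi\<^sup>2 * ball_ft R r / R\<^sup>2)\<^sup>2)"
    and "(LINT r|lborel. indicator {0..2} r * (r / 2) * (pi\<^sup>2 * ball_ft R r / R\<^sup>2)\<^sup>2) = 8 * pi ^ 6 * (main_prim (R * 2) + 1 / 4)"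
proof -
  define f where "f r = 8 * pi ^ 6 * (sin (R * r) - R * r * cos (R * r))\<^sup>2 / (R ^ 4 * r ^ 5)" for r
  define F where "F r = 8 * pi ^ 6 * main_prim (R * r)" for r
  have "set_integrable lborel (einterval 0 2) f \<and> (LBINT x=0..2. f x) = 8 * pi ^ 6 * main_prim (R * 2) - (- 2 * pi ^ 6)"
  proof (rule conjI)
    have F: "DERIV F r :> f r" if "0 < r" for r
    proof -
      have "(F has_real_derivative 8 * pi ^ 6 * ((sin (R * r) - (R * r) * cos (R * r))\<^sup>2 / (R * r) ^ 5 * R)) (at r)"
        unfolding F_def [abs_def] using that R
        by (intro DERIV_cmult DERIV_chain2[where f=main_prim] main_prim_deriv) (auto intro!: derivative_eq_intros)
      also have "8 * pi ^ 6 * ((sin (R * r) - (R * r) * cos (R * r))\<^sup>2 / (R * r) ^ 5 * R) = f r"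
        using that R by (simp add: f_def power_mult_distrib numeral_eq_Suc)
      finally show ?thesis .
    qed
    have c: "isCont f r" if "0 < r" for r
      unfolding f_def [abs_def] using that R by (intro continuous_intros) auto
    have n: "AE r in lborel. 0 < ereal r \<longrightarrow> ereal r < 2 \<longrightarrow> 0 \<le> f r"
      using R by (intro AE_I2) (auto simp: f_def)
    \<comment> \<open>By the convention on division \<open>main_prim 0\<close> is 0, not the limit
      \<open>- 1 / 4\<close>; hence the fundamental theorem is used on the open interval, with
      limits in place of endpoint values.\<close>
    have l0: "((F \<circ> real_of_ereal) \<longlongrightarrow> - 2 * pi ^ 6) (at_right 0)"
    proof -
      have "((\<lambda>r. main_prim (R * r)) \<longlongrightarrow> - 1 / 4) (at_right 0)"
      proof (rule filterlim_compose[where g=main_prim])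
        show "(main_prim \<longlongrightarrow> - 1 / 4) (at_right 0)"
          unfolding main_prim_def by real_asymp
        show "filterlim (\<lambda>r. R * r) (at_right 0) (at_right 0)"
          using R by (intro filterlim_times_pos[OF filterlim_ident]) auto
      qed
      then have "((\<lambda>r. 8 * pi ^ 6 * main_prim (R * r)) \<longlongrightarrow> 8 * pi ^ 6 * (- 1 / 4)) (at_right 0)"
        by (intro tendsto_intros)
      then show ?thesis
        unfolding zero_ereal_def by (simp add: ereal_tendsto_simps F_def [abs_def])
    qed
    have l2: "((F \<circ> real_of_ereal) \<longlongrightarrow> 8 * pi ^ 6 * main_prim (R * 2)) (at_left 2)"
    proof -
      have "isCont F 2" by (rule DERIV_isCont[OF F]) simp
      then have "(F \<longlongrightarrow> F 2) (at_left 2)"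
        by (meson continuous_at_imp_continuous_at_within continuous_within)
      then have "((F \<circ> real_of_ereal) \<longlongrightarrow> F 2) (at_left (ereal 2))"
        by (simp add: ereal_tendsto_simps)
      then show ?thesis by (simp add: F_def)
    qed
    have ze: "0 < r" if "(0::ereal) < ereal r" for r using that by simp
    show "set_integrable lborel (einterval 0 2) f"
      by (rule interval_integral_FTC_nonneg(1)[OF _ F c n l0 l2]) (auto dest: ze)
    show "(LBINT x=0..2. f x) = 8 * pi ^ 6 * main_prim (R * 2) - (- 2 * pi ^ 6)"
      by (rule interval_integral_FTC_nonneg(2)[OF _ F c n l0 l2]) (auto dest: ze)
  qed
  then have f: "set_integrable lborel (einterval 0 2) f"
    and fI: "(LBINT x=0..2. f x) = 8 * pi ^ 6 * main_prim (R * 2) - (- 2 * pi ^ 6)" by auto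
  have e: "einterval 0 2 = {0<..<2::real}"
    by (auto simp: einterval_def)
  have ae: "AE r in lborel. indicator (einterval 0 2) r *\<^sub>R f r = indicator {0..2} r * (r / 2) * (pi\<^sup>2 * ball_ft R r / R\<^sup>2)\<^sup>2"
    using AE_lborel_singleton[of "0::real"] AE_lborel_singleton[of "2::real"]
  proof eventually_elim
    case (elim r)
    show ?case
    proof (cases "0 < r \<and> r < 2")
      case True
      then have "r / 2 * (pi\<^sup>2 * ball_ft R r / R\<^sup>2)\<^sup>2 = f r"
        using R by (simp add: f_def ball_ft_def power_divide power_mult_distrib) (simp add: numeral_eq_Suc mult_ac)
      moreover have "r \<in> einterval 0 2" "r \<in> {0..2}" using True unfolding e by auto
      ultimately show ?thesis by (simp only: indicator_simps scaleR_one mult_1_left)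
    next
      case False
      then have "r \<notin> einterval 0 2" "r \<notin> {0..2}" using elim unfolding e by auto
      then have "indicator (einterval 0 2) r = (0 :: real)" "indicator {0..2} r = (0 :: real)"
        by (simp_all only: indicator_simps not_False_eq_True)
      then show ?thesis by (simp only: scaleR_zero_left mult_zero_left)
    qed
  qed
  have m: "(\<lambda>r. indicator {0..2} r * (r / 2) * (pi\<^sup>2 * ball_ft R r / R\<^sup>2)\<^sup>2) \<in> borel_measurable lborel"
    by measurable
  show "integrable lborel (\<lambda>r. indicator {0..2} r * (r / 2) * (pi\<^sup>2 * ball_ft R r / R\<^sup>2)\<^sup>2)"
    using f m ae unfolding set_integrable_def by (rule integrable_cong_AE_imp)
  have "(LINT r|lborel. indicator {0..2} r * (r / 2) * (pi\<^sup>2 * ball_ft R r / R\<^sup>2)\<^sup>2) = (LINT r|lborel. indicator (einterval 0 2) r *\<^sub>R f r)"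
    using f m ae by (intro integral_cong_AE) (auto simp: set_integrable_def)
  also have "\<dots> = (LBINT x=0..2. f x)"
    by (simp add: interval_lebesgue_integral_def set_lebesgue_integral_def)
  finally show "(LINT r|lborel. indicator {0..2} r * (r / 2) * (pi\<^sup>2 * ball_ft R r / R\<^sup>2)\<^sup>2) = 8 * pi ^ 6 * (main_prim (R * 2) + 1 / 4)"
    using fI by (simp add: algebra_simps)
qed

lemma main_square:
  shows "R > 0 \<Longrightarrow> integrable sigma22 (\<lambda>z. (pi\<^sup>2 * ball_ft R (norm (fst z + snd z)) / R\<^sup>2)\<^sup>2)"
    and "((\<lambda>R. LINT z|sigma22. (pi\<^sup>2 * ball_ft R (norm (fst z + snd z)) / R\<^sup>2)\<^sup>2) \<longlongrightarrow> 2 * pi ^ 6) at_top"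
proof -
  show "integrable sigma22 (\<lambda>z. (pi\<^sup>2 * ball_ft R (norm (fst z + snd z)) / R\<^sup>2)\<^sup>2)" if "R > 0" for R
    by (rule sigma22_norm_sum(1)[OF _ main_integral(1)[OF that]]) measurable
  have eq: "(LINT z|sigma22. (pi\<^sup>2 * ball_ft R (norm (fst z + snd z)) / R\<^sup>2)\<^sup>2) = 8 * pi ^ 6 * (main_prim (R * 2) + 1 / 4)" if "R > 0" for R
    using sigma22_norm_sum(2)[OF _ main_integral(1)[OF that]] main_integral(2)[OF that] by simp
  have "((\<lambda>R. main_prim (R * 2)) \<longlongrightarrow> 0) at_top"
    unfolding main_prim_def by real_asymp
  then have "((\<lambda>R. 8 * pi ^ 6 * (main_prim (R * 2) + 1 / 4)) \<longlongrightarrow> 8 * pi ^ 6 * (0 + 1 / 4)) at_top"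
    by (intro tendsto_intros)
  then have "((\<lambda>R. 8 * pi ^ 6 * (main_prim (R * 2) + 1 / 4)) \<longlongrightarrow> 2 * pi ^ 6) at_top"
    by simp
  then show "((\<lambda>R. LINT z|sigma22. (pi\<^sup>2 * ball_ft R (norm (fst z + snd z)) / R\<^sup>2)\<^sup>2) \<longlongrightarrow> 2 * pi ^ 6) at_top"
    by (rule Lim_transform_eventually) (intro eventually_mono[OF eventually_gt_at_top[of 0]] eq[symmetric])
qed

text \<open>A perturbation that vanishes in mean square does not change the limit of the squared
  norm. The cross term is absorbed by the weighted inequality
  \<open>\<bar>2 * (x * y)\<bar> \<le> d * x\<^sup>2 + y\<^sup>2 / d\<close>: first \<open>d\<close>
  is chosen small against the bounded part, then \<open>R\<close> large for the vanishing
  part.\<close>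

lemma tendsto_integral_square_add:
  fixes f g :: "real \<Rightarrow> 'a \<Rightarrow> real"
  assumes m: "\<And>R. f R \<in> borel_measurable M" "\<And>R. g R \<in> borel_measurable M"
    and int: "\<And>R. R > 0 \<Longrightarrow> integrable M (\<lambda>z. (f R z)\<^sup>2)" "\<And>R. R > 0 \<Longrightarrow> integrable M (\<lambda>z. (g R z)\<^sup>2)"
    and f: "((\<lambda>R. LINT z|M. (f R z)\<^sup>2) \<longlongrightarrow> c) at_top" and g: "((\<lambda>R. LINT z|M. (g R z)\<^sup>2) \<longlongrightarrow> 0) at_top"
  shows "R > 0 \<Longrightarrow> integrable M (\<lambda>z. (f R z + g R z)\<^sup>2)"
    and "((\<lambda>R. LINT z|M. (f R z + g R z)\<^sup>2) \<longlongrightarrow> c) at_top"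
proof -
  have young: "\<bar>2 * (x * y)\<bar> \<le> d * x\<^sup>2 + y\<^sup>2 / d" if "d > 0" for x y d :: real
  proof -
    have "(d * X - Y)\<^sup>2 / d = d * X\<^sup>2 + Y\<^sup>2 / d - 2 * (X * Y)" for X Y
      using that by (simp add: field_simps power2_eq_square)
    from this[of "\<bar>x\<bar>" "\<bar>y\<bar>"] have "d * x\<^sup>2 + y\<^sup>2 / d - 2 * (\<bar>x\<bar> * \<bar>y\<bar>) = (d * \<bar>x\<bar> - \<bar>y\<bar>)\<^sup>2 / d"
      by simp
    also have "\<dots> \<ge> 0" using that by simp
    finally show ?thesis by (simp add: abs_mult)
  qed
  have fg: "integrable M (\<lambda>z. 2 * (f R z * g R z))" if "R > 0" for R
  proof (rule Bochner_Integration.integrable_bound)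
    show "integrable M (\<lambda>z. 1 * (f R z)\<^sup>2 + (g R z)\<^sup>2 / 1)" using int[OF that] by simp
    show "AE z in M. norm (2 * (f R z * g R z)) \<le> norm (1 * (f R z)\<^sup>2 + (g R z)\<^sup>2 / 1)"
      using young[of 1] by (intro AE_I2) (metis abs_ge_self order_trans real_norm_def zero_less_one)
    show "(\<lambda>z. 2 * (f R z * g R z)) \<in> borel_measurable M" using m by measurable
  qed
  have sq: "(f R z + g R z)\<^sup>2 = (f R z)\<^sup>2 + (g R z)\<^sup>2 + 2 * (f R z * g R z)" for R z
    by (simp add: power2_sum)
  show "integrable M (\<lambda>z. (f R z + g R z)\<^sup>2)" if "R > 0"
    unfolding sq using int[OF that] fg[OF that] by (intro Bochner_Integration.integrable_add)
  have "((\<lambda>R. LINT z|M. 2 * (f R z * g R z)) \<longlongrightarrow> 0) at_top"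
  proof (rule tendstoI)
    fix e :: real assume e: "e > 0"
    \<comment> \<open>The \<open>+ 1\<close> keeps the denominator positive when
      \<open>c = 0\<close> and leaves room for the integral of \<open>(f R z)\<^sup>2\<close> to be
      eventually below \<open>\<bar>c\<bar> + 1\<close>.\<close>
    define d where "d = e / (2 * (\<bar>c\<bar> + 1))"
    have d: "d > 0" using e by (simp add: d_def)
    have "eventually (\<lambda>R. (LINT z|M. (f R z)\<^sup>2) < \<bar>c\<bar> + 1) at_top"
      by (rule order_tendstoD(2)[OF f]) simp
    moreover have "eventually (\<lambda>R. (LINT z|M. (g R z)\<^sup>2) < e / 2 * d) at_top"
      using e d by (intro order_tendstoD(2)[OF g]) simp
    ultimately show "eventually (\<lambda>R. dist (LINT z|M. 2 * (f R z * g R z)) 0 < e) at_top"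
      using eventually_gt_at_top[of 0]
    proof eventually_elim
      case (elim R)
      have "\<bar>LINT z|M. 2 * (f R z * g R z)\<bar> \<le> (LINT z|M. d * (f R z)\<^sup>2 + (g R z)\<^sup>2 / d)"
        using int[OF elim(3)] young[OF d]
        by (intro integral_abs_bound[THEN order_trans] integral_mono integrable_abs fg elim
          Bochner_Integration.integrable_add integrable_mult_right integrable_divide) auto
      also have "\<dots> = d * (LINT z|M. (f R z)\<^sup>2) + (LINT z|M. (g R z)\<^sup>2) / d"
        using int[OF elim(3)] by simp
      also have "\<dots> < d * (\<bar>c\<bar> + 1) + e / 2"
        using elim d by (intro add_strict_mono mult_strict_left_mono) (auto simp: pos_divide_less_eq)
      also have "d * (\<bar>c\<bar> + 1) = e / 2"
        by (simp add: d_def field_simps)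
      finally show ?case by simp
    qed
  qed
  then have "((\<lambda>R. (LINT z|M. (f R z)\<^sup>2) + (LINT z|M. (g R z)\<^sup>2) + (LINT z|M. 2 * (f R z * g R z))) \<longlongrightarrow> c + 0 + 0) at_top"
    by (intro tendsto_add f g)
  then have "((\<lambda>R. (LINT z|M. (f R z)\<^sup>2) + (LINT z|M. (g R z)\<^sup>2) + (LINT z|M. 2 * (f R z * g R z))) \<longlongrightarrow> c) at_top"
    by simp
  then show "((\<lambda>R. LINT z|M. (f R z + g R z)\<^sup>2) \<longlongrightarrow> c) at_top"
  proof (rule Lim_transform_eventually)
    show "\<forall>\<^sub>F R in at_top. (LINT z|M. (f R z)\<^sup>2) + (LINT z|M. (g R z)\<^sup>2) + (LINT z|M. 2 * (f R z * g R z)) = (LINT z|M. (f R z + g R z)\<^sup>2)"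
      using eventually_gt_at_top[of 0]
    proof eventually_elim
      case (elim R)
      show ?case
        unfolding sq
        using Bochner_Integration.integral_add[OF Bochner_Integration.integrable_add[OF int(1)[OF elim] int(2)[OF elim]] fg[OF elim]]
          Bochner_Integration.integral_add[OF int(1)[OF elim] int(2)[OF elim]] by simp
    qed
  qed
qed

theorem theorem6:
  shows "I_ball \<sim>[at_top] (\<lambda>R. complex_of_real (2 * pi ^ 6 * R ^ 4))"
proof (rule asymp_equivI')
  \<comment> \<open>Dividing the main part and the error of the kernel by \<open>R\<^sup>2\<close>
    makes their mean squares converge; the square of this factor returns as the \<open>R ^ 4\<close>
    of the claim.\<close>
  define f where "f R z = pi\<^sup>2 * ball_ft R (norm (fst z + snd z)) / R\<^sup>2" for R and z :: "(real^3) \<times> (real^3)"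
  define g where "g R z = err R (fst z) (snd z) / R\<^sup>2" for R and z :: "(real^3) \<times> (real^3)"
  have m: "f R \<in> borel_measurable sigma22" "g R \<in> borel_measurable sigma22" for R
  proof -
    show "f R \<in> borel_measurable sigma22"
      unfolding f_def [abs_def] using norm_sum_measurable[of "ball_ft R"] by simp
    show "g R \<in> borel_measurable sigma22"
      unfolding g_def [abs_def] using err_measurable[of R] by simp
  qed
  have fg_int: "integrable sigma22 (\<lambda>z. (f R z + g R z)\<^sup>2)" if "R > 0" for R
    by (rule tendsto_integral_square_add(1)[OF m _ _ main_square(2)[folded f_def] err_square(2)[folded g_def] that])
       (simp_all add: f_def g_def main_square(1) err_square(1))
  have fg_lim: "((\<lambda>R. LINT z|sigma22. (f R z + g R z)\<^sup>2) \<longlongrightarrow> 2 * pi ^ 6) at_top"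
    by (rule tendsto_integral_square_add(2)[OF m _ _ main_square(2)[folded f_def] err_square(2)[folded g_def]])
       (simp_all add: f_def g_def main_square(1) err_square(1))
  have I: "I_ball R / complex_of_real (2 * pi ^ 6 * R ^ 4) =
      complex_of_real ((LINT z|sigma22. (f R z + g R z)\<^sup>2) / (2 * pi ^ 6))" if R: "R > 0" for R
  proof -
    have K_real: "(K_real R (fst z) (snd z))\<^sup>2 = R ^ 4 * (f R z + g R z)\<^sup>2" for z
    proof -
      have "K_real R (fst z) (snd z) = R\<^sup>2 * (f R z + g R z)"
        using R by (simp add: K_real_eq f_def g_def distrib_left)
      then show ?thesis by (simp add: power_mult_distrib flip: power_mult)
    qed
    have int: "integrable sigma22 (\<lambda>z. (K_real R (fst z) (snd z))\<^sup>2)"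
      unfolding K_real using fg_int[OF R] by (intro integrable_mult_right)
    have "I_ball R = (LINT a|sigma2. LINT b|sigma2. complex_of_real ((K_real R a b)\<^sup>2))"
      unfolding I_ball_def K_ball_eq[OF R] by simp
    also have "\<dots> = complex_of_real (LINT a|sigma2. LINT b|sigma2. (K_real R a b)\<^sup>2)"
      by (simp only: integral_complex_of_real)
    also have "(LINT a|sigma2. LINT b|sigma2. (K_real R a b)\<^sup>2) = (LINT z|sigma22. (K_real R (fst z) (snd z))\<^sup>2)"
      using sigma2_pair.integral_fst'[OF int] by simp
    also have "\<dots> = R ^ 4 * (LINT z|sigma22. (f R z + g R z)\<^sup>2)"
      unfolding K_real by simp
    finally show ?thesis using R by simp
  qed
  have "((\<lambda>R. complex_of_real ((LINT z|sigma22. (f R z + g R z)\<^sup>2) / (2 * pi ^ 6))) \<longlongrightarrow> complex_of_real (2 * pi ^ 6 / (2 * pi ^ 6))) at_top"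
    by (intro tendsto_of_real tendsto_divide fg_lim tendsto_const) simp
  then have "((\<lambda>R. complex_of_real ((LINT z|sigma22. (f R z + g R z)\<^sup>2) / (2 * pi ^ 6))) \<longlongrightarrow> 1) at_top"
    by simp
  then show "((\<lambda>R. I_ball R / complex_of_real (2 * pi ^ 6 * R ^ 4)) \<longlongrightarrow> 1) at_top"
    by (rule Lim_transform_eventually) (intro eventually_mono[OF eventually_gt_at_top[of 0]] I[symmetric])
qed

end
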